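(* Let $\mathscr{L}=\langle L_\alpha:\alpha\in\Lambda\rangle$ be a $\clubsuit_C$-sequence such that $L_\alpha\subset\Lambda$ whenever $\alpha\in\Lambda_2$. Then: (a) $M(\mathscr{L},1)$ is of order $\infty$. (b) $M(\mathscr{L},\frac{2\pi}{n})$ is of order $n$ for each integer $n\ge 1$.
   Context: Basic notions. $\Lambda$ is the set of (nonzero) limit ordinals in $\omega_1$ and $\Lambda_2\subset\Lambda$ the set of limits of members of $\Lambda$. Club means closed and unbounded. A ladder system is a sequence $\langle L_\alpha:\alpha\in\Lambda\rangle$ where each $L_\alpha$ is a strictly increasing $\omega$-sequence of ordinals with limit $\alpha$; $\sigma_\alpha(k)$ ($k\in\omega$) denotes the $k$-th member of $L_\alpha$ in increasing order. It is a $\clubsuit_C$-sequence if for each club $C\subset\omega_1$ the set $\{\alpha\in\Lambda:L_\alpha\subset C\}$ is stationary. The long ray $\mathbb{L}_+$ is $\omega_1\times[0,1)$ with lexicographic order topology, smallest point removed; points are written $\alpha+r$, and nonzero ordinals are identified with points having $r=0$ (clubs of $\omega_1$ used as subsets of $\mathbb{L}_+$ do not contain $0$). $\mathbb{S}^1$ is the reals modulo $2\pi$. Principal bundles and order. A principal $\mathbb{S}^1$-bundle $\pi:M\to\mathbb{L}_+$ is a locally trivial bundle with fiber $\mathbb{S}^1$ together with a continuous action of $\mathbb{S}^1$ on $M$ leaving each fiber $M_p=\pi^{-1}(\{p\})$ invariant and free and transitive on fibers; $x+\theta$ is the image of $x$ under the action of $\theta$. A subset $A\subset M$ is unbounded if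 $\pi(A)$ is unbounded in $\mathbb{L}_+$, and club if closed and unbounded. $M$ is of order $\infty$ if for every club $F\subset M$ there is a club $C\subset\omega_1$ with $\pi^{-1}(C)\subset F$. Otherwise the order of $M$ is the least $n\ge1$ for which there are a club $E\subset M$ and a club $C\subset\omega_1$ such that for every $\alpha\in C$, $|E\cap M_\alpha|=n$ and $E\cap M_\alpha=\{x+\frac{2\pi k}{n}:k=0,\dots,n-1\}$ for each $x\in E\cap M_\alpha$. Construction of $M(\mathscr{L},\theta)$, for a ladder system $\mathscr{L}$ with $L_\alpha\subset\Lambda$ for $\alpha\in\Lambda_2$, and an angle $\theta$. Step 1 (sequences $\delta_\alpha$). For $\alpha\in\Lambda_2$ define $D_\alpha\supset L_\alpha$ by adding, for each $n\ge1$, finitely many points of the interval $(\sigma_\alpha(n-1),\sigma_\alpha(n)]$ as follows. Let $\xi_0=\sigma_\alpha(n)$. Given $\xi_i\in\Lambda$ with $\sigma_\alpha(n-1)<\xi_i\le\sigma_\alpha(n)$: - if $(\sigma_\alpha(n-1),\xi_i]\cap\Lambda_2=\varnothing$, then $\xi_i=\sigma_\alpha(n-1)+\omega\cdot m$ for some $0<m<\omega$; add all $\sigma_\alpha(n-1)+\omega\cdot\ell$, $1\le\ell\le m-1$, and stop; - otherwise let $\nu_i$ be the largest member of $\Lambda_2$ in $(\sigma_\alpha(n-1),\xi_i]$. If $\nu_i<\xi_i$, then $\xi_i=\nu_i+\omega\cdot m$ with $0<m<\omega$, and add all $\nu_i+\omega\cdot\ell$, $0\le\ell\le m-1$. If $\sigma_{\nu_i}(0)\le\sigma_\alpha(n-1)$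 let $\xi_{i+1}=\sigma_{\nu_i}(k)$ for the smallest $k>0$ with $\sigma_{\nu_i}(k)>\sigma_\alpha(n-1)$; if $\sigma_{\nu_i}(0)>\sigma_\alpha(n-1)$ let $\xi_{i+1}=\sigma_{\nu_i}(0)$. Add $\xi_{i+1}$ and repeat with $\xi_{i+1}$ in place of $\xi_i$. The procedure stops after finitely many steps since the $\xi_i$ strictly decrease. Let $\langle\delta_\alpha(k):k\in\omega\rangle$ be the increasing enumeration of $D_\alpha$ (so $\delta_\alpha(0)=\sigma_\alpha(0)$ and $\delta_\alpha(k)\to\alpha$). Step 2 (functions $z_\alpha:[0,\alpha]\to\omega$). Let $z_0(0)=0$. For $\alpha\in\Lambda\cup\{0\}$, $z_{\alpha+\omega}$ equals $z_\alpha$ on $[0,\alpha]$ and $0$ on $[\alpha+1,\alpha+\omega]$, and $z_{\alpha+n}=z_{\alpha+\omega}\upharpoonright[0,\alpha+n]$ for $n\in\omega$. For $\alpha\in\Lambda_2$: $z_\alpha(\alpha)=0$; $z_\alpha=z_{\delta_\alpha(0)}$ on $[0,\delta_\alpha(0)]$; and for each $n\ge0$, letting $k$ be smallest with $\sigma_{\delta_\alpha(n+1)}(k)>\delta_\alpha(n)$, for $\beta\in(\delta_\alpha(n),\delta_\alpha(n+1)]$ put $z_\alpha(\beta)=z_{\delta_\alpha(n+1)}(\beta)+1$ if $\beta\in(\sigma_{\delta_\alpha(n+1)}(k),\sigma_{\delta_\alpha(n+1)}(k+1)]$ and $z_\alpha(\beta)=z_{\delta_\alpha(n+1)}(\beta)$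 otherwise. Step 3 (arcs). Extend $z_\alpha$ by $z_\alpha(\beta)=0$ for $\beta>\alpha$. Define $a_\alpha:\mathbb{L}_+\to\mathbb{S}^1$ by linear interpolation: $a_\alpha(\beta+r)=\theta\cdot\bigl((1-r)z_\alpha(\beta)+r\,z_\alpha(\beta+1)\bigr)$ modulo $2\pi$, for $\beta\in\omega_1$, $r\in[0,1)$. Step 4 (topology). Let $R_\alpha=(0,\alpha+1)\times\mathbb{S}^1$ (interval in $\mathbb{L}_+$), $f_\alpha:R_\alpha\to R_\alpha$, $f_\alpha(\langle p,\phi\rangle)=\langle p,a_\alpha(p)+\phi\rangle$, and $\tau_\alpha=\{f_\alpha(U):U\subset R_\alpha\text{ open in the product topology}\}$. Then $M(\mathscr{L},\theta)$ is the set $\mathbb{L}_+\times\mathbb{S}^1$ with the topology having basis $\bigcup_{\alpha<\omega_1}\tau_\alpha$, with $\pi$ the projection on the first factor and $\mathbb{S}^1$ acting by addition on the second coordinate; it is a principal $\mathbb{S}^1$-bundle over $\mathbb{L}_+$. *)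

theory Defs
  imports "HOL-Analysis.Analysis"
begin

section \<open>The ordinal \<open>\<omega>\<^sub>1\<close>\<close>

text \<open>
  The type \<open>omega1\<close> carries the well-order \<open>cardSuc natLeq\<close>, i.e. its elements are the ordinals
  below \<open>\<omega>\<^sub>1\<close>. The lemmas \<open>countable_lessThan_omega1\<close> and \<open>uncountable_omega1\<close> below determine this
  order up to isomorphism.
\<close>

unbundle cardinal_syntax

typedef omega1 = "Field (cardSuc natLeq)"
proof -
  have "natLeq <o cardSuc natLeq"
    by (rule cardSuc_greater[OF natLeq_Card_order])
  then have "cardSuc natLeq \<noteq> {}"
    by (metis cardSuc_finite natLeq_Card_order Field_natLeq infinite_UNIV_nat Field_empty
        finite.emptyI)
  then show ?thesis
    by (metis Field_empty FieldI1 equals0I ex_in_conv surj_pair)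
qed

lemma Well_order_cardSuc_natLeq: "Well_order (cardSuc natLeq)"
  using cardSuc_Card_order[OF natLeq_Card_order] by (rule card_order_on_well_order_on)

instantiation omega1 :: linorder
begin

definition less_eq_omega1 :: "omega1 \<Rightarrow> omega1 \<Rightarrow> bool" where
  "\<alpha> \<le> \<beta> \<longleftrightarrow> (Rep_omega1 \<alpha>, Rep_omega1 \<beta>) \<in> cardSuc natLeq"

definition less_omega1 :: "omega1 \<Rightarrow> omega1 \<Rightarrow> bool" where
  "\<alpha> < \<beta> \<longleftrightarrow> \<alpha> \<le> \<beta> \<and> \<not> \<beta> \<le> (\<alpha> :: omega1)"

instance
proof -
  have "Linear_order (cardSuc natLeq)"
    using Well_order_cardSuc_natLeq by (simp add: well_order_on_def)
  then have lin: "refl_on (Field (cardSuc natLeq)) (cardSuc natLeq)" "trans (cardSuc natLeq)"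
    "antisym (cardSuc natLeq)" "total_on (Field (cardSuc natLeq)) (cardSuc natLeq)"
    by (auto simp: linear_order_on_def partial_order_on_def preorder_on_def)
  show "OFCLASS(omega1, linorder_class)"
  proof
    fix x y z :: omega1
    show refl: "x \<le> x"
      using lin(1) Rep_omega1[of x] by (auto simp: less_eq_omega1_def refl_on_def)
    show "x \<le> y \<Longrightarrow> y \<le> z \<Longrightarrow> x \<le> z"
      using lin(2) unfolding less_eq_omega1_def trans_def by blast
    show "x \<le> y \<Longrightarrow> y \<le> x \<Longrightarrow> x = y"
      using lin(3) unfolding less_eq_omega1_def antisym_def by (metis Rep_omega1_inject)
    show "x \<le> y \<or> y \<le> x"
      using lin(4) Rep_omega1[of x] Rep_omega1[of y] refl
      unfolding less_eq_omega1_def total_on_def by (metis Rep_omega1_inject)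
  qed (auto simp: less_omega1_def)
qed

end

instance omega1 :: wellorder
proof
  fix P :: "omega1 \<Rightarrow> bool" and a :: omega1
  assume step: "\<And>x. (\<And>y. y < x \<Longrightarrow> P y) \<Longrightarrow> P x"
  have "wf (cardSuc natLeq - Id)"
    using Well_order_cardSuc_natLeq by (simp add: well_order_on_def)
  then have "wf (inv_image (cardSuc natLeq - Id) Rep_omega1)"
    by (rule wf_inv_image)
  moreover have "{(x, y). x < (y :: omega1)} \<subseteq> inv_image (cardSuc natLeq - Id) Rep_omega1"
    by (auto simp: less_omega1_def less_eq_omega1_def inv_image_def)
  ultimately have "wf {(x, y). x < (y :: omega1)}"
    by (rule wf_subset)
  then show "P a"
    by (rule wf_induct_rule) (use step in auto)
qed

instantiation omega1 :: linorder_topology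
begin

definition open_omega1 :: "omega1 set \<Rightarrow> bool" where
  "open_omega1 = generate_topology (range (\<lambda>a. {..<a}) \<union> range (\<lambda>a. {a<..}))"

instance
  by standard (fact open_omega1_def)

end

instantiation omega1 :: zero
begin

definition zero_omega1 :: omega1 where
  "0 = (LEAST \<alpha> :: omega1. True)"

instance ..

end

lemma card_of_UNIV_omega1: "(card_of (UNIV :: omega1 set), cardSuc natLeq) \<in> ordIso"
proof -
  have "bij_betw Rep_omega1 UNIV (Field (cardSuc natLeq))"
    using type_definition.Rep_range[OF type_definition_omega1] Rep_omega1_inject
    by (auto simp: bij_betw_def inj_on_def)
  then have "|UNIV :: omega1 set| =o |Field (cardSuc natLeq)|"
    using card_of_ordIso by blast
  also have "|Field (cardSuc natLeq)| =o cardSuc natLeq"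
    by (rule card_of_Field_ordIso[OF cardSuc_Card_order[OF natLeq_Card_order]])
  finally show ?thesis .
qed

lemma countable_iff_ordLeq_natLeq: "countable A \<longleftrightarrow> |A| \<le>o natLeq"
proof -
  have "countable A \<longleftrightarrow> |A| \<le>o |UNIV :: nat set|"
    unfolding countable_def card_of_ordLeq[symmetric] by auto
  then show ?thesis
    using card_of_nat ordIso_symmetric ordLeq_ordIso_trans by blast
qed

lemma uncountable_omega1: "uncountable (UNIV :: omega1 set)"
proof
  assume "countable (UNIV :: omega1 set)"
  then have "cardSuc natLeq \<le>o natLeq"
    using countable_iff_ordLeq_natLeq card_of_UNIV_omega1 ordIso_ordLeq_trans ordIso_symmetric
    by blast
  then show False
    using cardSuc_greater[OF natLeq_Card_order] not_ordLess_ordLeq by blast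
qed

lemma countable_lessThan_omega1: "countable {..<\<alpha> :: omega1}"
proof -
  let ?r = "cardSuc natLeq"
  let ?U = "underS ?r (Rep_omega1 \<alpha>)"
  have "|?U| <o ?r"
    by (rule card_of_underS[OF cardSuc_Card_order[OF natLeq_Card_order] Rep_omega1])
  then have "|?U| \<le>o natLeq"
    using cardSuc_ordLeq_ordLess[OF natLeq_Card_order card_of_Card_order] by blast
  then have "countable ?U"
    by (simp add: countable_iff_ordLeq_natLeq)
  moreover have "Rep_omega1 ` {..<\<alpha>} \<subseteq> ?U"
    by (auto simp: underS_def less_omega1_def less_eq_omega1_def Rep_omega1_inject)
  ultimately have "countable (Rep_omega1 ` {..<\<alpha>})"
    using countable_subset by blast
  moreover have "inj_on Rep_omega1 {..<\<alpha>}"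
    by (auto simp: inj_on_def Rep_omega1_inject)
  ultimately show ?thesis
    by (rule countable_image_inj_on)
qed

unbundle no cardinal_syntax

text \<open>\<open>succ_omega1 \<alpha>\<close> is \<open>\<alpha> + 1\<close> and \<open>(succ_omega1 ^^ n) \<alpha>\<close> is \<open>\<alpha> + n\<close>; similarly
  \<open>(add_omega ^^ m) \<alpha>\<close> is \<open>\<alpha> + \<omega> \<cdot> m\<close>.\<close>

definition succ_omega1 :: "omega1 \<Rightarrow> omega1" where
  "succ_omega1 \<alpha> = (LEAST \<beta>. \<alpha> < \<beta>)"

definition add_omega :: "omega1 \<Rightarrow> omega1" where
  "add_omega \<alpha> = (LEAST \<beta>. \<forall>n. (succ_omega1 ^^ n) \<alpha> < \<beta>)"

definition LimOrd :: "omega1 set" where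
  "LimOrd = {\<alpha>. \<alpha> \<noteq> 0 \<and> (\<forall>\<gamma><\<alpha>. \<exists>\<beta><\<alpha>. \<gamma> < \<beta>)}"

definition LimOrd2 :: "omega1 set" where
  "LimOrd2 = {\<alpha>\<in>LimOrd. \<forall>\<gamma><\<alpha>. \<exists>\<beta>\<in>LimOrd. \<gamma> < \<beta> \<and> \<beta> < \<alpha>}"

lemma countable_bounded_omega1:
  assumes "countable A"
  shows "\<exists>\<beta> :: omega1. \<forall>\<alpha>\<in>A. \<alpha> < \<beta>"
proof -
  have "countable {..\<alpha>}" for \<alpha> :: omega1
    using countable_lessThan_omega1[of \<alpha>] by (simp add: ivl_disj_un_singleton(2)[symmetric])
  then have "countable (\<Union>\<alpha>\<in>A. {..\<alpha>})"
    using assms by auto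
  then have "(\<Union>\<alpha>\<in>A. {..\<alpha>}) \<noteq> UNIV"
    using uncountable_omega1 by auto
  then show ?thesis
    by (force simp: not_le)
qed

lemma less_succ_omega1: "\<alpha> < succ_omega1 \<alpha>"
  using countable_bounded_omega1[of "{\<alpha>}"] unfolding succ_omega1_def by (auto intro: LeastI_ex)

lemma succ_omega1_le: "\<alpha> < \<beta> \<Longrightarrow> succ_omega1 \<alpha> \<le> \<beta>"
  unfolding succ_omega1_def by (rule Least_le)

lemma add_nat_less_add_omega: "(succ_omega1 ^^ n) \<alpha> < add_omega \<alpha>"
proof -
  have "\<exists>\<beta>. \<forall>n. (succ_omega1 ^^ n) \<alpha> < \<beta>"
    using countable_bounded_omega1[of "range (\<lambda>n. (succ_omega1 ^^ n) \<alpha>)"] by auto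
  then show ?thesis
    unfolding add_omega_def by (rule LeastI2_ex) blast
qed

lemma less_add_omega: "\<alpha> < add_omega \<alpha>"
  using add_nat_less_add_omega[of 0] by simp

lemma less_add_omega_ex:
  assumes "\<gamma> < add_omega \<alpha>" "\<alpha> \<le> \<gamma>"
  shows "\<exists>n. \<gamma> = (succ_omega1 ^^ n) \<alpha>"
proof -
  have "\<exists>n. \<gamma> \<le> (succ_omega1 ^^ n) \<alpha>"
    using not_less_Least[OF assms(1)[unfolded add_omega_def]] by (auto simp: not_less)
  then obtain n where n: "\<gamma> \<le> (succ_omega1 ^^ n) \<alpha>"
    and least: "\<And>m. m < n \<Longrightarrow> \<not> \<gamma> \<le> (succ_omega1 ^^ m) \<alpha>"
    using exists_least_iff[of "\<lambda>n. \<gamma> \<le> (succ_omega1 ^^ n) \<alpha>"] by blast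
  have "\<gamma> = (succ_omega1 ^^ n) \<alpha>"
  proof (cases n)
    case 0
    then show ?thesis
      using n assms(2) by simp
  next
    case (Suc m)
    then have "(succ_omega1 ^^ m) \<alpha> < \<gamma>"
      using least[of m] by simp
    then show ?thesis
      using n Suc succ_omega1_le[of "(succ_omega1 ^^ m) \<alpha>" \<gamma>] by simp
  qed
  then show ?thesis ..
qed

lemma zero_le_omega1: "0 \<le> (\<alpha> :: omega1)"
  unfolding zero_omega1_def by (simp add: Least_le)

lemma succ_omega1_notin_limord: "succ_omega1 \<alpha> \<notin> LimOrd"
  using less_succ_omega1[of \<alpha>] succ_omega1_le by (fastforce simp: LimOrd_def not_le)

lemma add_nat_ge: "\<alpha> \<le> (succ_omega1 ^^ n) \<alpha>"
  by (induction n) (use less_succ_omega1 in \<open>auto intro: order.trans less_imp_le\<close>)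

lemma between_notin_limord:
  assumes "\<alpha> < \<gamma>" "\<gamma> < add_omega \<alpha>"
  shows "\<gamma> \<notin> LimOrd"
proof -
  obtain n where n: "\<gamma> = (succ_omega1 ^^ n) \<alpha>"
    using less_add_omega_ex[OF assms(2)] assms(1) by (metis less_imp_le)
  with assms(1) show ?thesis
    by (cases n) (auto simp: succ_omega1_notin_limord)
qed

lemma add_omega_in_limord: "add_omega \<alpha> \<in> LimOrd"
proof -
  have "\<exists>\<beta><add_omega \<alpha>. \<gamma> < \<beta>" if less: "\<gamma> < add_omega \<alpha>" for \<gamma>
  proof (cases "\<gamma> < \<alpha>")
    case True
    then show ?thesis
      using less_add_omega by blast
  next
    case False
    then obtain n where "\<gamma> = (succ_omega1 ^^ n) \<alpha>"
      using less_add_omega_ex[OF less] by (metis not_less)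
    then show ?thesis
      using add_nat_less_add_omega[of "Suc n" \<alpha>] less_succ_omega1[of \<gamma>] by auto
  qed
  then show ?thesis
    using less_add_omega[of \<alpha>] zero_le_omega1[of \<alpha>] by (auto simp: LimOrd_def)
qed

lemma add_omega_notin_limord2: "add_omega \<alpha> \<notin> LimOrd2"
  using less_add_omega[of \<alpha>] between_notin_limord by (auto simp: LimOrd2_def)

definition club :: "omega1 set \<Rightarrow> bool" where
  "club C \<longleftrightarrow> closed C \<and> \<not> bdd_above C"

definition stationary :: "omega1 set \<Rightarrow> bool" where
  "stationary S \<longleftrightarrow> (\<forall>C. club C \<longrightarrow> S \<inter> C \<noteq> {})"


section \<open>Ladder systems\<close>

text \<open>A ladder system is given by its enumerations \<open>\<sigma> \<alpha> k\<close>, so that \<open>L\<^sub>\<alpha>\<close> is \<open>range (\<sigma> \<alpha>)\<close>.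
  The values of \<open>\<sigma> \<alpha>\<close> for \<open>\<alpha>\<close> outside \<open>LimOrd\<close> are irrelevant.\<close>

definition ladder_system :: "(omega1 \<Rightarrow> nat \<Rightarrow> omega1) \<Rightarrow> bool" where
  "ladder_system \<sigma> \<longleftrightarrow> (\<forall>\<alpha>\<in>LimOrd. strict_mono (\<sigma> \<alpha>) \<and> \<sigma> \<alpha> \<longlonglongrightarrow> \<alpha>)"

definition clubsuit_C_sequence :: "(omega1 \<Rightarrow> nat \<Rightarrow> omega1) \<Rightarrow> bool" where
  "clubsuit_C_sequence \<sigma> \<longleftrightarrow>
     ladder_system \<sigma> \<and> (\<forall>C. club C \<longrightarrow> stationary {\<alpha>\<in>LimOrd. range (\<sigma> \<alpha>) \<subseteq> C})"


section \<open>The circle and the long ray\<close>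

quotient_type circle = real / "\<lambda>x y. \<exists>k::int. x - y = 2 * pi * of_int k"
  morphisms rep_circle circle_of
proof (rule equivpI)
  show "reflp (\<lambda>x y. \<exists>k::int. x - y = 2 * pi * of_int k)"
    by (auto intro!: reflpI exI[of _ 0])
  show "symp (\<lambda>x y. \<exists>k::int. x - y = 2 * pi * of_int k)"
  proof (rule sympI)
    fix x y :: real
    assume "\<exists>k::int. x - y = 2 * pi * of_int k"
    then obtain k :: int where "x - y = 2 * pi * of_int k" ..
    then have "y - x = 2 * pi * of_int (- k)"
      by simp
    then show "\<exists>k::int. y - x = 2 * pi * of_int k" ..
  qed
  show "transp (\<lambda>x y. \<exists>k::int. x - y = 2 * pi * of_int k)"
  proof (rule transpI)
    fix x y z :: real
    assume "\<exists>k::int. x - y = 2 * pi * of_int k" "\<exists>k::int. y - z = 2 * pi * of_int k"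
    then obtain k l :: int where "x - y = 2 * pi * of_int k" "y - z = 2 * pi * of_int l"
      by blast
    then have "x - z = 2 * pi * of_int (k + l)"
      by (simp add: algebra_simps)
    then show "\<exists>k::int. x - z = 2 * pi * of_int k" ..
  qed
qed

instantiation circle :: ab_group_add
begin

lift_definition zero_circle :: circle is 0 .

lift_definition plus_circle :: "circle \<Rightarrow> circle \<Rightarrow> circle" is "(+)"
proof -
  fix x x' y y' :: real
  assume "\<exists>k::int. x - x' = 2 * pi * of_int k" "\<exists>k::int. y - y' = 2 * pi * of_int k"
  then obtain k l :: int where "x - x' = 2 * pi * of_int k" "y - y' = 2 * pi * of_int l"
    by blast
  then have "x + y - (x' + y') = 2 * pi * of_int (k + l)"
    by (simp add: algebra_simps)
  then show "\<exists>k::int. x + y - (x' + y') = 2 * pi * of_int k" ..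
qed

lift_definition uminus_circle :: "circle \<Rightarrow> circle" is uminus
proof -
  fix x x' :: real
  assume "\<exists>k::int. x - x' = 2 * pi * of_int k"
  then obtain k :: int where "x - x' = 2 * pi * of_int k" ..
  then have "- x - (- x') = 2 * pi * of_int (- k)"
    by simp
  then show "\<exists>k::int. - x - (- x') = 2 * pi * of_int k" ..
qed

definition minus_circle :: "circle \<Rightarrow> circle \<Rightarrow> circle" where
  "s - t = s + (- t :: circle)"

instance
proof
  fix a b c :: circle
  show "a + b + c = a + (b + c)"
    by transfer (auto intro!: exI[of _ 0])
  show "a + b = b + a"
    by transfer (auto intro!: exI[of _ 0])
  show "0 + a = a"
    by transfer (auto intro!: exI[of _ 0])
  show "- a + a = 0"
    by transfer (auto intro!: exI[of _ 0])
qed (simp add: minus_circle_def)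

end

instantiation circle :: topological_space
begin

definition open_circle :: "circle set \<Rightarrow> bool" where
  "open_circle U \<longleftrightarrow> open (circle_of -` U)"

instance
  by standard (auto simp: open_circle_def vimage_Int vimage_Union)

end

typedef long_ray = "{(\<beta> :: omega1, r :: real). 0 \<le> r \<and> r < 1} - {(0, 0)}"
  by (rule exI[of _ "(0, 1/2)"]) simp

instantiation long_ray :: linorder
begin

definition less_eq_long_ray :: "long_ray \<Rightarrow> long_ray \<Rightarrow> bool" where
  "p \<le> q \<longleftrightarrow> fst (Rep_long_ray p) < fst (Rep_long_ray q) \<or>
     fst (Rep_long_ray p) = fst (Rep_long_ray q) \<and> snd (Rep_long_ray p) \<le> snd (Rep_long_ray q)"

definition less_long_ray :: "long_ray \<Rightarrow> long_ray \<Rightarrow> bool" where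
  "p < q \<longleftrightarrow> p \<le> q \<and> \<not> q \<le> (p :: long_ray)"

instance
  by standard
    (auto simp: less_long_ray_def less_eq_long_ray_def Rep_long_ray_inject[symmetric] prod_eq_iff)

end

instantiation long_ray :: linorder_topology
begin

definition open_long_ray :: "long_ray set \<Rightarrow> bool" where
  "open_long_ray = generate_topology (range (\<lambda>a. {..<a}) \<union> range (\<lambda>a. {a<..}))"

instance
  by standard (fact open_long_ray_def)

end

text \<open>The point of the long ray corresponding to an ordinal; meaningful for \<open>\<alpha> \<noteq> 0\<close> only.\<close>

definition ord_point :: "omega1 \<Rightarrow> long_ray" where
  "ord_point \<alpha> = Abs_long_ray (\<alpha>, 0)"


section \<open>Principal circle bundles over the long ray and their order\<close>

record 'm circle_bundle =
  total_space :: "'m topology"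
  proj :: "'m \<Rightarrow> long_ray"
  act :: "'m \<Rightarrow> circle \<Rightarrow> 'm"

definition over :: "'m circle_bundle \<Rightarrow> long_ray set \<Rightarrow> 'm set" where
  "over M A = {x \<in> topspace (total_space M). proj M x \<in> A}"

definition locally_trivial :: "'m circle_bundle \<Rightarrow> bool" where
  "locally_trivial M \<longleftrightarrow>
     (\<forall>p. \<exists>U h. open U \<and> p \<in> U \<and>
        homeomorphic_map (subtopology (total_space M) (over M U))
          (prod_topology (top_of_set U) (euclidean :: circle topology)) h \<and>
        (\<forall>x\<in>over M U. fst (h x) = proj M x))"

definition principal_circle_bundle :: "'m circle_bundle \<Rightarrow> bool" where
  "principal_circle_bundle M \<longleftrightarrow>
     continuous_map (total_space M) euclidean (proj M) \<and>
     locally_trivial M \<and>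
     continuous_map (prod_topology (total_space M) euclidean) (total_space M) (\<lambda>(x, t). act M x t) \<and>
     (\<forall>x\<in>topspace (total_space M).
        act M x 0 = x \<and>
        (\<forall>s t. act M (act M x s) t = act M x (s + t)) \<and>
        (\<forall>t. proj M (act M x t) = proj M x) \<and>
        (\<forall>t. act M x t = x \<longrightarrow> t = 0) \<and>
        (\<forall>y\<in>topspace (total_space M). proj M y = proj M x \<longrightarrow> (\<exists>t. act M x t = y)))"

definition bundle_club :: "'m circle_bundle \<Rightarrow> 'm set \<Rightarrow> bool" where
  "bundle_club M F \<longleftrightarrow> closedin (total_space M) F \<and> \<not> bdd_above (proj M ` F)"

definition has_infinite_order :: "'m circle_bundle \<Rightarrow> bool" where
  "has_infinite_order M \<longleftrightarrow> principal_circle_bundle M \<and>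
     (\<forall>F. bundle_club M F \<longrightarrow> (\<exists>C. club C \<and> 0 \<notin> C \<and> over M (ord_point ` C) \<subseteq> F))"

definition has_cyclic_club :: "'m circle_bundle \<Rightarrow> nat \<Rightarrow> bool" where
  "has_cyclic_club M n \<longleftrightarrow>
     (\<exists>E C. bundle_club M E \<and> club C \<and> 0 \<notin> C \<and>
        (\<forall>\<alpha>\<in>C. card (E \<inter> over M {ord_point \<alpha>}) = n \<and>
           (\<forall>x\<in>E \<inter> over M {ord_point \<alpha>}.
              E \<inter> over M {ord_point \<alpha>} =
                {act M x (circle_of (2 * pi * real k / real n)) | k. k < n})))"

definition has_finite_order :: "'m circle_bundle \<Rightarrow> nat \<Rightarrow> bool" where
  "has_finite_order M n \<longleftrightarrow> principal_circle_bundle M \<and> \<not> has_infinite_order M \<and>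
     1 \<le> n \<and> has_cyclic_club M n \<and> (\<forall>m\<ge>1. has_cyclic_club M m \<longrightarrow> n \<le> m)"


section \<open>The bundle of a ladder system\<close>

subsection \<open>The sequences \<open>\<delta>\<^sub>\<alpha>\<close>\<close>

text \<open>One interval of the construction, with \<open>lo = \<sigma>\<^sub>\<alpha>(n - 1)\<close> and \<open>hi = \<sigma>\<^sub>\<alpha>(n)\<close>:
  \<open>top_limord2 lo \<xi>\<^sub>i\<close> is \<open>\<nu>\<^sub>i\<close>, \<open>rung \<sigma> lo \<nu>\<^sub>i\<close> is \<open>\<xi>\<^sub>i\<^sub>+\<^sub>1\<close>, \<open>descent \<sigma> lo hi\<close> consists of all \<open>\<xi>\<^sub>i\<close>, and
  \<open>fill lo \<xi>\<^sub>i\<close> of the points \<open>lo + \<omega> \<cdot> l\<close> resp. \<open>\<nu>\<^sub>i + \<omega> \<cdot> l\<close> added along with \<open>\<xi>\<^sub>i\<close>.\<close>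

definition top_limord2 :: "omega1 \<Rightarrow> omega1 \<Rightarrow> omega1" where
  "top_limord2 lo \<xi> = (GREATEST \<nu>. \<nu> \<in> {lo<..\<xi>} \<inter> LimOrd2)"

definition rung :: "(omega1 \<Rightarrow> nat \<Rightarrow> omega1) \<Rightarrow> omega1 \<Rightarrow> omega1 \<Rightarrow> omega1" where
  "rung \<sigma> lo \<nu> = (if \<sigma> \<nu> 0 \<le> lo then \<sigma> \<nu> (LEAST k. 0 < k \<and> lo < \<sigma> \<nu> k) else \<sigma> \<nu> 0)"

inductive_set descent :: "(omega1 \<Rightarrow> nat \<Rightarrow> omega1) \<Rightarrow> omega1 \<Rightarrow> omega1 \<Rightarrow> omega1 set"
  for \<sigma> :: "omega1 \<Rightarrow> nat \<Rightarrow> omega1" and lo hi :: omega1 where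
  start: "hi \<in> descent \<sigma> lo hi"
| step: "\<xi> \<in> descent \<sigma> lo hi \<Longrightarrow> {lo<..\<xi>} \<inter> LimOrd2 \<noteq> {} \<Longrightarrow>
    rung \<sigma> lo (top_limord2 lo \<xi>) \<in> descent \<sigma> lo hi"

definition fill :: "omega1 \<Rightarrow> omega1 \<Rightarrow> omega1 set" where
  "fill lo \<xi> =
     (if {lo<..\<xi>} \<inter> LimOrd2 = {}
      then {(add_omega ^^ l) lo | l m. \<xi> = (add_omega ^^ m) lo \<and> 1 \<le> l \<and> l < m}
      else {(add_omega ^^ l) (top_limord2 lo \<xi>) | l m. \<xi> = (add_omega ^^ m) (top_limord2 lo \<xi>) \<and> l < m})"

definition ladder_points :: "(omega1 \<Rightarrow> nat \<Rightarrow> omega1) \<Rightarrow> omega1 \<Rightarrow> omega1 set" where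
  "ladder_points \<sigma> \<alpha> = range (\<sigma> \<alpha>) \<union>
     (\<Union>n. \<Union>\<xi>\<in>descent \<sigma> (\<sigma> \<alpha> n) (\<sigma> \<alpha> (Suc n)). insert \<xi> (fill (\<sigma> \<alpha> n) \<xi>))"

definition delta :: "(omega1 \<Rightarrow> nat \<Rightarrow> omega1) \<Rightarrow> omega1 \<Rightarrow> nat \<Rightarrow> omega1" where
  "delta \<sigma> \<alpha> = enumerate (ladder_points \<sigma> \<alpha>)"

subsection \<open>The functions \<open>z\<^sub>\<alpha>\<close>\<close>

text \<open>The functions \<open>z\<^sub>\<alpha>\<close>, extended by \<open>0\<close> above \<open>\<alpha>\<close>. An ordinal \<open>\<alpha> \<noteq> 0\<close> outside \<open>LimOrd2\<close> is
  \<open>\<lambda> + n\<close> with \<open>n \<ge> 1\<close> or \<open>\<lambda> + \<omega>\<close>, where \<open>\<lambda>\<close> is the largest element of \<open>insert 0 LimOrd\<close> below \<open>\<alpha>\<close>;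
  in both cases \<open>z\<^sub>\<alpha>\<close> is \<open>z\<^sub>\<lambda>\<close> continued by \<open>0\<close>. The recursion in \<open>\<alpha>\<close> is by \<open>wfrec\<close> as it is
  well-founded for ladder systems only; the recursion equations are \<open>zfun_zero\<close>, \<open>zfun_add_omega\<close>,
  \<open>zfun_add_nat\<close>, \<open>zfun_limord2_self\<close>, \<open>zfun_limord2_init\<close> and \<open>zfun_limord2_step\<close> below.\<close>

definition zfun :: "(omega1 \<Rightarrow> nat \<Rightarrow> omega1) \<Rightarrow> omega1 \<Rightarrow> omega1 \<Rightarrow> nat" where
  "zfun \<sigma> = wfrec {(\<gamma>, \<alpha>). \<gamma> < \<alpha>} (\<lambda>z \<alpha> \<beta>.
     if \<alpha> < \<beta> \<or> \<alpha> = 0 then 0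
     else if \<alpha> \<in> LimOrd2 then
       (if \<beta> = \<alpha> then 0
        else if \<beta> \<le> delta \<sigma> \<alpha> 0 then z (delta \<sigma> \<alpha> 0) \<beta>
        else let n = (LEAST n. \<beta> \<le> delta \<sigma> \<alpha> (Suc n));
                 \<epsilon> = delta \<sigma> \<alpha> (Suc n);
                 k = (LEAST k. delta \<sigma> \<alpha> n < \<sigma> \<epsilon> k)
             in if \<beta> \<in> {\<sigma> \<epsilon> k<..\<sigma> \<epsilon> (Suc k)} then z \<epsilon> \<beta> + 1 else z \<epsilon> \<beta>)
     else let \<mu> = (GREATEST \<mu>. \<mu> \<in> insert 0 LimOrd \<and> \<mu> < \<alpha>)
          in if \<beta> \<le> \<mu> then z \<mu> \<beta> else 0)"

lemma zfun_unfold: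
  "zfun \<sigma> \<alpha> \<beta> = (let z = cut (zfun \<sigma>) {(\<gamma>, \<alpha>). \<gamma> < \<alpha>} \<alpha> in
     if \<alpha> < \<beta> \<or> \<alpha> = 0 then 0
     else if \<alpha> \<in> LimOrd2 then
       (if \<beta> = \<alpha> then 0
        else if \<beta> \<le> delta \<sigma> \<alpha> 0 then z (delta \<sigma> \<alpha> 0) \<beta>
        else let n = (LEAST n. \<beta> \<le> delta \<sigma> \<alpha> (Suc n));
                 \<epsilon> = delta \<sigma> \<alpha> (Suc n);
                 k = (LEAST k. delta \<sigma> \<alpha> n < \<sigma> \<epsilon> k)
             in if \<beta> \<in> {\<sigma> \<epsilon> k<..\<sigma> \<epsilon> (Suc k)} then z \<epsilon> \<beta> + 1 else z \<epsilon> \<beta>)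
     else let \<mu> = (GREATEST \<mu>. \<mu> \<in> insert 0 LimOrd \<and> \<mu> < \<alpha>)
          in if \<beta> \<le> \<mu> then z \<mu> \<beta> else 0)"
  unfolding zfun_def by (subst wfrec[OF wf]) (simp only: Let_def)

lemma zfun_above: "\<alpha> < \<beta> \<Longrightarrow> zfun \<sigma> \<alpha> \<beta> = 0"
  by (subst zfun_unfold) (simp add: Let_def)

lemma zfun_zero: "zfun \<sigma> 0 \<beta> = 0"
  by (subst zfun_unfold) (simp add: Let_def)

lemma zfun_above_limord:
  assumes "\<alpha> \<in> insert 0 LimOrd" "\<alpha> < \<gamma>" "\<gamma> \<le> add_omega \<alpha>"
  shows "zfun \<sigma> \<gamma> \<beta> = (if \<beta> \<le> \<alpha> then zfun \<sigma> \<alpha> \<beta> else 0)"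
proof -
  have "(GREATEST \<mu>. \<mu> \<in> insert 0 LimOrd \<and> \<mu> < \<gamma>) = \<alpha>"
  proof (rule Greatest_equality)
    fix \<mu>
    assume "\<mu> \<in> insert 0 LimOrd \<and> \<mu> < \<gamma>"
    then show "\<mu> \<le> \<alpha>"
      using between_notin_limord[of \<alpha> \<mu>] assms(3) zero_le_omega1[of \<alpha>] by fastforce
  qed (use assms in auto)
  moreover have "\<gamma> \<notin> LimOrd2"
  proof (cases "\<gamma> = add_omega \<alpha>")
    case True
    then show ?thesis by (simp add: add_omega_notin_limord2)
  next
    case False
    then have "\<gamma> \<notin> LimOrd"
      using between_notin_limord assms by auto
    then show ?thesis by (simp add: LimOrd2_def)
  qed
  moreover have "\<gamma> \<noteq> 0"
    using assms(2) zero_le_omega1[of \<alpha>] by auto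
  ultimately show ?thesis
    using assms(2) by (subst zfun_unfold) (auto simp: Let_def cut_def)
qed

lemma zfun_add_omega:
  assumes "\<alpha> \<in> insert 0 LimOrd"
  shows "zfun \<sigma> (add_omega \<alpha>) \<beta> = (if \<beta> \<le> \<alpha> then zfun \<sigma> \<alpha> \<beta> else 0)"
  using assms less_add_omega by (rule zfun_above_limord) simp

lemma zfun_add_nat:
  assumes "\<alpha> \<in> insert 0 LimOrd" "\<beta> \<le> (succ_omega1 ^^ n) \<alpha>"
  shows "zfun \<sigma> ((succ_omega1 ^^ n) \<alpha>) \<beta> = zfun \<sigma> (add_omega \<alpha>) \<beta>"
proof (cases "(succ_omega1 ^^ n) \<alpha> = \<alpha>")
  case True
  then show ?thesis
    using assms by (simp add: zfun_add_omega)
next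
  case False
  then have "\<alpha> < (succ_omega1 ^^ n) \<alpha>"
    using add_nat_ge[of \<alpha> n] by auto
  then show ?thesis
    using assms zfun_above_limord[of \<alpha> "(succ_omega1 ^^ n) \<alpha>"] add_nat_less_add_omega[of n \<alpha>]
    by (simp add: zfun_add_omega)
qed

lemma zfun_limord2_self: "\<alpha> \<in> LimOrd2 \<Longrightarrow> zfun \<sigma> \<alpha> \<alpha> = 0"
  by (subst zfun_unfold) (simp add: Let_def)

lemma ladder_less:
  assumes "ladder_system \<sigma>" "\<alpha> \<in> LimOrd"
  shows "\<sigma> \<alpha> k < \<alpha>"
proof -
  have mono: "strict_mono (\<sigma> \<alpha>)" and lim: "\<sigma> \<alpha> \<longlonglongrightarrow> \<alpha>"
    using assms by (auto simp: ladder_system_def)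
  have "\<sigma> \<alpha> (Suc k) \<le> \<alpha>"
    by (rule incseq_le[OF strict_mono_mono[OF mono] lim])
  then show ?thesis
    using strict_monoD[OF mono, of k "Suc k"] by simp
qed

lemma ladder_cofinal:
  assumes "ladder_system \<sigma>" "\<alpha> \<in> LimOrd" "\<gamma> < \<alpha>"
  shows "\<exists>k. \<gamma> < \<sigma> \<alpha> k"
proof -
  have "\<sigma> \<alpha> \<longlonglongrightarrow> \<alpha>"
    using assms by (auto simp: ladder_system_def)
  then have "\<forall>\<^sub>F k in sequentially. \<gamma> < \<sigma> \<alpha> k"
    using assms(3) by (rule order_tendstoD(1))
  then show ?thesis
    by (auto simp: eventually_sequentially)
qed

lemma top_limord2:
  assumes "{lo<..\<xi>} \<inter> LimOrd2 \<noteq> {}"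
  shows "top_limord2 lo \<xi> \<in> {lo<..\<xi>} \<inter> LimOrd2"
    and "\<And>\<nu>. \<nu> \<in> {lo<..\<xi>} \<inter> LimOrd2 \<Longrightarrow> \<nu> \<le> top_limord2 lo \<xi>"
proof -
  let ?S = "{lo<..\<xi>} \<inter> LimOrd2"
  define s where "s = (LEAST s. \<forall>\<nu>\<in>?S. \<nu> \<le> s)"
  have "\<forall>\<nu>\<in>?S. \<nu> \<le> \<xi>" by auto
  then have ub: "\<forall>\<nu>\<in>?S. \<nu> \<le> s" and "s \<le> \<xi>"
    unfolding s_def by (rule LeastI, rule Least_le)
  have ex: "\<exists>\<nu>\<in>?S. \<gamma> < \<nu>" if "\<gamma> < s" for \<gamma>
    using not_less_Least[OF that[unfolded s_def]] by (auto simp: not_le)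
  obtain \<nu>0 where \<nu>0: "\<nu>0 \<in> ?S" using assms by blast
  have "s \<in> ?S"
  proof (rule ccontr)
    assume "s \<notin> ?S"
    have *: "\<exists>\<nu>\<in>LimOrd2. \<gamma> < \<nu> \<and> \<nu> < s" if "\<gamma> < s" for \<gamma>
      using ex[OF that] ub \<open>s \<notin> ?S\<close> by (metis IntE order_less_le)
    have "\<nu>0 \<le> s" using ub \<nu>0 by blast
    then have "s \<noteq> 0"
      using \<nu>0 zero_le_omega1[of lo] by auto
    then have "s \<in> LimOrd2"
      using * unfolding LimOrd2_def LimOrd_def by blast
    then show False
      using \<open>s \<notin> ?S\<close> \<open>s \<le> \<xi>\<close> \<nu>0 \<open>\<nu>0 \<le> s\<close> by auto
  qed
  then have "top_limord2 lo \<xi> = s"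
    unfolding top_limord2_def using ub by (intro Greatest_equality) auto
  with \<open>s \<in> ?S\<close> ub show "top_limord2 lo \<xi> \<in> ?S"
    "\<And>\<nu>. \<nu> \<in> ?S \<Longrightarrow> \<nu> \<le> top_limord2 lo \<xi>" by auto
qed

lemma rung_bounds:
  assumes "ladder_system \<sigma>" "\<nu> \<in> LimOrd2" "lo < \<nu>"
  shows "lo < rung \<sigma> lo \<nu>" "rung \<sigma> lo \<nu> < \<nu>"
proof -
  have \<nu>: "\<nu> \<in> LimOrd" using assms by (simp add: LimOrd2_def)
  show "rung \<sigma> lo \<nu> < \<nu>"
    using ladder_less[OF assms(1) \<nu>] by (simp add: rung_def)
  obtain k where k: "lo < \<sigma> \<nu> k"
    using ladder_cofinal[OF assms(1) \<nu> assms(3)] by blast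
  show "lo < rung \<sigma> lo \<nu>"
  proof (cases "\<sigma> \<nu> 0 \<le> lo")
    case True
    then have "0 < k \<and> lo < \<sigma> \<nu> k"
      using k by (cases k) auto
    then show ?thesis
      using LeastI[of "\<lambda>k. 0 < k \<and> lo < \<sigma> \<nu> k"] True by (auto simp: rung_def)
  qed (auto simp: rung_def)
qed

lemma descent_bounds:
  assumes "ladder_system \<sigma>" "lo < hi" "\<xi> \<in> descent \<sigma> lo hi"
  shows "\<xi> \<in> {lo<..hi}"
  using assms(3)
proof induction
  case (step \<xi>)
  then show ?case
    using top_limord2(1)[of lo \<xi>] rung_bounds[OF assms(1), of "top_limord2 lo \<xi>" lo] by auto
qed (use assms in auto)

lemma add_omega_pow_less_iff: "(add_omega ^^ l) \<alpha> < (add_omega ^^ m) \<alpha> \<longleftrightarrow> l < m"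
proof -
  have "strict_mono (\<lambda>m. (add_omega ^^ m) \<alpha>)"
    by (rule strict_monoI_Suc) (simp add: less_add_omega)
  then show ?thesis
    by (rule strict_mono_less)
qed

lemma fill_bounds: "\<eta> \<in> fill lo \<xi> \<Longrightarrow> \<eta> \<in> {lo<..<\<xi>}"
proof -
  assume \<eta>: "\<eta> \<in> fill lo \<xi>"
  show "\<eta> \<in> {lo<..<\<xi>}"
  proof (cases "{lo<..\<xi>} \<inter> LimOrd2 = {}")
    case True
    from \<eta> True obtain l m where lm: "\<eta> = (add_omega ^^ l) lo"
      "\<xi> = (add_omega ^^ m) lo" "1 \<le> l" "l < m"
      by (auto simp: fill_def)
    then show ?thesis
      using add_omega_pow_less_iff[of 0 lo l] add_omega_pow_less_iff[of l lo m] by simp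
  next
    case False
    from \<eta> False obtain l m where lm: "\<eta> = (add_omega ^^ l) (top_limord2 lo \<xi>)"
      "\<xi> = (add_omega ^^ m) (top_limord2 lo \<xi>)" "l < m"
      by (auto simp: fill_def)
    have "top_limord2 lo \<xi> \<le> \<eta>"
      using add_omega_pow_less_iff[of l "top_limord2 lo \<xi>" 0] lm(1) by (simp add: not_less)
    then show ?thesis
      using lm add_omega_pow_less_iff[of l "top_limord2 lo \<xi>" m] top_limord2(1)[OF False] by auto
  qed
qed

lemma ladder_points_less:
  assumes "ladder_system \<sigma>" "\<alpha> \<in> LimOrd" "\<eta> \<in> ladder_points \<sigma> \<alpha>"
  shows "\<eta> < \<alpha>"
proof -
  have mono: "\<sigma> \<alpha> n < \<sigma> \<alpha> (Suc n)" for n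
    using assms by (auto simp: ladder_system_def strict_mono_Suc_iff)
  have less: "\<sigma> \<alpha> n < \<alpha>" for n
    using ladder_less assms by blast
  from assms(3) consider (ladder) n where "\<eta> = \<sigma> \<alpha> n"
    | (added) n \<xi> where "\<xi> \<in> descent \<sigma> (\<sigma> \<alpha> n) (\<sigma> \<alpha> (Suc n))" "\<eta> \<in> insert \<xi> (fill (\<sigma> \<alpha> n) \<xi>)"
    unfolding ladder_points_def by blast
  then show ?thesis
  proof cases
    case ladder
    then show ?thesis using less by simp
  next
    case added
    have "\<xi> \<le> \<sigma> \<alpha> (Suc n)"
      using descent_bounds[OF assms(1) mono added(1)] by simp
    moreover have "\<eta> \<le> \<xi>"
      using added(2) fill_bounds[of \<eta> "\<sigma> \<alpha> n" \<xi>] by auto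
    ultimately show ?thesis
      using less[of "Suc n"] by simp
  qed
qed

lemma infinite_ladder_points:
  assumes "ladder_system \<sigma>" "\<alpha> \<in> LimOrd"
  shows "infinite (ladder_points \<sigma> \<alpha>)"
proof -
  have "inj (\<sigma> \<alpha>)"
    using assms by (auto simp: ladder_system_def intro: strict_mono_imp_inj_on)
  then have "infinite (range (\<sigma> \<alpha>))"
    by (rule range_inj_infinite)
  then show ?thesis
    by (simp add: ladder_points_def)
qed

lemma delta_less:
  assumes "ladder_system \<sigma>" "\<alpha> \<in> LimOrd"
  shows "delta \<sigma> \<alpha> n < \<alpha>"
  using ladder_points_less[OF assms] enumerate_in_set[OF infinite_ladder_points[OF assms]]
  by (simp add: delta_def)

lemma zfun_limord2_init:
  assumes "ladder_system \<sigma>" "\<alpha> \<in> LimOrd2" "\<beta> \<le> delta \<sigma> \<alpha> 0"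
  shows "zfun \<sigma> \<alpha> \<beta> = zfun \<sigma> (delta \<sigma> \<alpha> 0) \<beta>"
proof -
  have "\<alpha> \<noteq> 0" "delta \<sigma> \<alpha> 0 < \<alpha>"
    using assms delta_less by (auto simp: LimOrd2_def LimOrd_def)
  then show ?thesis
    using assms by (subst zfun_unfold) (auto simp: Let_def cut_def)
qed

lemma zfun_limord2_step:
  assumes "ladder_system \<sigma>" "\<alpha> \<in> LimOrd2" "\<beta> \<in> {delta \<sigma> \<alpha> n<..delta \<sigma> \<alpha> (Suc n)}"
  defines "\<epsilon> \<equiv> delta \<sigma> \<alpha> (Suc n)"
  defines "k \<equiv> (LEAST k. delta \<sigma> \<alpha> n < \<sigma> \<epsilon> k)"
  shows "zfun \<sigma> \<alpha> \<beta> =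
    (if \<beta> \<in> {\<sigma> \<epsilon> k<..\<sigma> \<epsilon> (Suc k)} then zfun \<sigma> \<epsilon> \<beta> + 1 else zfun \<sigma> \<epsilon> \<beta>)"
proof -
  have \<alpha>: "\<alpha> \<in> LimOrd" "\<alpha> \<noteq> 0"
    using assms(2) by (auto simp: LimOrd2_def LimOrd_def)
  have less: "\<epsilon> < \<alpha>" "delta \<sigma> \<alpha> 0 < \<alpha>"
    using delta_less[OF assms(1) \<alpha>(1)] by (auto simp: \<epsilon>_def)
  have mono: "delta \<sigma> \<alpha> i \<le> delta \<sigma> \<alpha> j \<longleftrightarrow> i \<le> j" for i j
    using infinite_ladder_points[OF assms(1) \<alpha>(1)] by (simp add: delta_def)
  have n: "(LEAST n. \<beta> \<le> delta \<sigma> \<alpha> (Suc n)) = n"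
  proof (rule Least_equality)
    fix m
    assume "\<beta> \<le> delta \<sigma> \<alpha> (Suc m)"
    then have "\<not> delta \<sigma> \<alpha> (Suc m) \<le> delta \<sigma> \<alpha> n"
      using assms(3) by auto
    then show "n \<le> m"
      by (simp add: mono)
  qed (use assms(3) in simp)
  have "\<not> \<beta> \<le> delta \<sigma> \<alpha> 0"
    using assms(3) mono[of 0 n] by auto
  moreover have "\<not> \<alpha> < \<beta>" "\<beta> \<noteq> \<alpha>"
    using assms(3) less(1) by (auto simp: \<epsilon>_def)
  ultimately show ?thesis
    using less(1) assms(2) \<alpha>(2)
    by (subst zfun_unfold) (simp add: Let_def cut_def n \<epsilon>_def[symmetric] k_def[symmetric])
qed

subsection \<open>The arcs and the total space\<close>

definition arc_angle :: "(omega1 \<Rightarrow> nat \<Rightarrow> omega1) \<Rightarrow> real \<Rightarrow> omega1 \<Rightarrow> long_ray \<Rightarrow> circle" where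
  "arc_angle \<sigma> \<theta> \<alpha> p = (case Rep_long_ray p of (\<beta>, r) \<Rightarrow>
     circle_of (\<theta> * ((1 - r) * real (zfun \<sigma> \<alpha> \<beta>) + r * real (zfun \<sigma> \<alpha> (succ_omega1 \<beta>)))))"

definition strip :: "omega1 \<Rightarrow> (long_ray \<times> circle) set" where
  "strip \<alpha> = {..<ord_point (succ_omega1 \<alpha>)} \<times> UNIV"

definition twist ::
  "(omega1 \<Rightarrow> nat \<Rightarrow> omega1) \<Rightarrow> real \<Rightarrow> omega1 \<Rightarrow> long_ray \<times> circle \<Rightarrow> long_ray \<times> circle" where
  "twist \<sigma> \<theta> \<alpha> = (\<lambda>(p, \<phi>). (p, arc_angle \<sigma> \<theta> \<alpha> p + \<phi>))"

definition strip_opens ::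
  "(omega1 \<Rightarrow> nat \<Rightarrow> omega1) \<Rightarrow> real \<Rightarrow> omega1 \<Rightarrow> (long_ray \<times> circle) set set" where
  "strip_opens \<sigma> \<theta> \<alpha> = {twist \<sigma> \<theta> \<alpha> ` U | U. openin (top_of_set (strip \<alpha>)) U}"

text \<open>The sets \<open>strip_opens \<sigma> \<theta> \<alpha>\<close> increase with \<open>\<alpha>\<close>, so that their union is a basis; the topology
  generated by it as a subbasis is therefore the topology with this basis.\<close>

definition ladder_bundle ::
  "(omega1 \<Rightarrow> nat \<Rightarrow> omega1) \<Rightarrow> real \<Rightarrow> (long_ray \<times> circle) circle_bundle" where
  "ladder_bundle \<sigma> \<theta> =
     \<lparr>total_space = topology_generated_by (\<Union>\<alpha>. strip_opens \<sigma> \<theta> \<alpha>),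
      proj = fst,
      act = (\<lambda>(p, \<phi>) t. (p, \<phi> + t))\<rparr>"

end

theory Submission
  imports Defs
begin

text \<open>
  Both parts rest on one fact about a club \<open>F\<close> of \<open>M(\<sigma>, \<theta>)\<close>: over every club of \<open>\<omega>\<^sub>1\<close> there is a fibre
  that contains two points of \<open>F\<close> which differ by \<open>\<theta>\<close> (\<open>rotated_pair_over_club\<close>).

  Such points exist for the following reason. The fibres over ordinals \<open>\<beta>\<close> carry a fixed coordinate in the circle, and closedness of \<open>F\<close> at
  a limit \<open>\<alpha>\<close> means that the fibres of \<open>F\<close> over \<open>\<beta> < \<alpha>\<close>, turned back by \<open>\<theta> \<cdot> z\<^sub>\<alpha>(\<beta>)\<close>, come arbitrarily
  close to the fibre over \<open>\<alpha>\<close> as \<open>\<beta>\<close> approaches \<open>\<alpha>\<close> (\<open>lifted_fibre_usc\<close>). Let \<open>N\<close> be the club of limit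
  ordinals over which \<open>F\<close> has points. By the guessing principle the set \<open>B\<close> of all \<open>\<alpha>\<close> with
  \<open>L\<^sub>\<alpha> \<subseteq> N\<close> is stationary, and pressing down makes the approximation at \<open>\<alpha>\<close> valid on all of \<open>(\<gamma>, \<alpha>)\<close>,
  with one \<open>\<gamma>\<close> for unboundedly many \<open>\<alpha> \<in> B\<close>. Now let \<open>\<epsilon>\<close> be a limit of such \<open>\<alpha>\<close>. The walk from \<open>\<epsilon>\<close>
  down to \<open>\<alpha>\<close> along the sets \<open>D\<close> shows that on a final segment of \<open>\<alpha>\<close> the functions \<open>z\<^sub>\<epsilon>\<close> and \<open>z\<^sub>\<alpha>\<close>
  differ by a constant \<open>c\<close>, except that \<open>z\<^sub>\<epsilon>\<close> is larger by one more on one interval between two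
  consecutive points of \<open>L\<^sub>\<alpha>\<close> (\<open>zfun_walk\<close>). The upper end \<open>\<beta>\<close> of this interval is in \<open>N\<close>. Take a point
  \<open>x\<close> of \<open>F\<close> over \<open>\<beta>\<close>. Going from \<open>\<beta>\<close> to \<open>\<alpha>\<close> and then to \<open>\<epsilon>\<close> shows that the fibre over \<open>\<epsilon>\<close> almost contains
  \<open>x - \<theta> \<cdot> (z\<^sub>\<alpha>(\<beta>) + c)\<close>; going from \<open>\<beta>\<close> to \<open>\<epsilon>\<close> directly shows that it almost contains
  \<open>x - \<theta> \<cdot> (z\<^sub>\<alpha>(\<beta>) + c + 1)\<close>. These two angles differ by \<open>\<theta>\<close>, and compactness of the fibre removes the
  word ``almost'' if \<open>\<epsilon>\<close> is a limit of suitable \<open>\<alpha>\<close> for every precision \<open>1/m\<close>.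

  For \<open>\<theta> = 1\<close> the points \<open>x\<close> of \<open>F\<close> with \<open>x + 1 \<in> F\<close> form again a club. Iterating this \<open>\<omega>\<close> times gives
  unboundedly many fibres in which \<open>F\<close> contains a whole orbit \<open>x, x + 1, x + 2, \<dots>\<close>; this is dense as
  \<open>\<pi>\<close> is irrational, so that \<open>F\<close> contains these fibres, hence those over a club. For \<open>\<theta> = 2 * \<pi> / n\<close> the
  angles \<open>2 * \<pi> * k / n\<close> over the ordinals form a club since all twists \<open>\<theta> \<cdot> z\<^sub>\<alpha>(\<beta>)\<close> preserve them,
  and a cyclic club of order \<open>m\<close> contains two points of one fibre that differ by \<open>2 * \<pi> / n\<close>, whence \<open>n\<close> divides \<open>m\<close>.

  That \<open>M(\<sigma>, \<theta>)\<close> is a principal bundle at all amounts to the coherence of the \<open>z\<^sub>\<alpha>\<close>: the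
  difference of two of them is continuous on the common initial segment (\<open>zfun_coherent\<close>).
\<close>

section \<open>Limits and clubs in \<open>\<omega>\<^sub>1\<close>\<close>

lemma less_succ_omega1_iff: "\<beta> < succ_omega1 \<alpha> \<longleftrightarrow> \<beta> \<le> \<alpha>"
  using less_succ_omega1[of \<alpha>] succ_omega1_le[of \<alpha> \<beta>] by (meson leD leI order.strict_trans1)

lemma not_bdd_above_omega1_iff: "\<not> bdd_above S \<longleftrightarrow> (\<forall>\<gamma>::omega1. \<exists>\<alpha>\<in>S. \<gamma> < \<alpha>)"
  by (auto simp: bdd_above_def not_le)

lemma LimOrd_pos: "\<alpha> \<in> LimOrd \<Longrightarrow> 0 < \<alpha>"
  using zero_le_omega1[of \<alpha>] by (auto simp: LimOrd_def order.order_iff_strict)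

lemma succ_or_limit:
  assumes "\<beta> \<noteq> 0"
  shows "\<beta> \<in> LimOrd \<or> (\<exists>\<gamma>. \<beta> = succ_omega1 \<gamma>)"
proof (cases "\<beta> \<in> LimOrd")
  case False
  then obtain \<gamma> where "\<gamma> < \<beta>" "\<And>\<xi>. \<xi> < \<beta> \<Longrightarrow> \<not> \<gamma> < \<xi>"
    using assms unfolding LimOrd_def by blast
  then have "\<beta> = succ_omega1 \<gamma>"
    using less_succ_omega1[of \<gamma>] succ_omega1_le[of \<gamma> \<beta>] by (metis order.not_eq_order_implies_strict)
  then show ?thesis by blast
qed simp

text \<open>
  Zero and successors are isolated, so closedness is a condition at limit ordinals only.
\<close>

lemma closed_omega1I:
  assumes "\<And>\<alpha>. \<alpha> \<in> LimOrd \<Longrightarrow> (\<And>\<mu>. \<mu> < \<alpha> \<Longrightarrow> \<exists>\<beta>\<in>C. \<mu> < \<beta> \<and> \<beta> < \<alpha>) \<Longrightarrow> \<alpha> \<in> C"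
  shows "closed C"
  unfolding closed_def
proof (subst open_subopen, intro ballI)
  fix \<alpha> assume \<alpha>: "\<alpha> \<in> - C"
  consider (lim) "\<alpha> \<in> LimOrd" | (zero) "\<alpha> = 0" | (succ) \<gamma> where "\<gamma> < \<alpha>" "\<And>\<beta>. \<beta> < \<alpha> \<Longrightarrow> \<not> \<gamma> < \<beta>"
    unfolding LimOrd_def by blast
  then show "\<exists>T. open T \<and> \<alpha> \<in> T \<and> T \<subseteq> - C"
  proof cases
    case lim
    then obtain \<mu> where \<mu>: "\<mu> < \<alpha>" "\<And>\<beta>. \<beta> \<in> C \<Longrightarrow> \<mu> < \<beta> \<Longrightarrow> \<not> \<beta> < \<alpha>"
      using assms \<alpha> by blast
    have "{\<mu><..<succ_omega1 \<alpha>} \<subseteq> - C"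
      using \<mu>(2) \<alpha> by (auto simp: less_succ_omega1_iff order.order_iff_strict)
    then show ?thesis
      using \<mu>(1) by (intro exI[of _ "{\<mu><..<succ_omega1 \<alpha>}"]) (auto simp: less_succ_omega1)
  next
    case zero
    then have "{..<succ_omega1 \<alpha>} \<subseteq> - C"
      using \<alpha> zero_le_omega1 by (auto simp: less_succ_omega1_iff) (metis antisym)
    then show ?thesis
      by (intro exI[of _ "{..<succ_omega1 \<alpha>}"]) (auto simp: less_succ_omega1)
  next
    case succ
    have "{\<gamma><..<succ_omega1 \<alpha>} \<subseteq> - C"
      using succ(2) \<alpha> by (auto simp: less_succ_omega1_iff order.order_iff_strict)
    then show ?thesis
      using succ(1) by (intro exI[of _ "{\<gamma><..<succ_omega1 \<alpha>}"]) (auto simp: less_succ_omega1)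
  qed
qed

lemma closed_omega1D:
  assumes "closed C" "\<alpha> \<in> LimOrd" "\<And>\<mu>. \<mu> < \<alpha> \<Longrightarrow> \<exists>\<beta>\<in>C. \<mu> < \<beta> \<and> \<beta> < \<alpha>"
  shows "\<alpha> \<in> C"
proof (rule ccontr)
  assume "\<alpha> \<notin> C"
  then obtain \<mu> where "\<mu> < \<alpha>" "{\<mu><..\<alpha>} \<subseteq> - C"
    using open_left[of "- C" \<alpha> 0] assms(1) LimOrd_pos[OF assms(2)] by auto
  then show False
    using assms(3)[of \<mu>] by fastforce
qed

text \<open>
  For unboundedness, start above \<open>\<gamma>\<close>, and pass \<open>\<omega>\<close> times to a bound of the countably many values of \<open>h\<close> so
  far; the supremum is closed under \<open>h\<close>.
\<close>

lemma club_closure_points: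
  fixes h :: "omega1 \<Rightarrow> omega1"
  shows "club {\<alpha>\<in>LimOrd. \<forall>\<gamma><\<alpha>. h \<gamma> < \<alpha>}" (is "club ?C")
  unfolding club_def
proof
  show "closed ?C"
  proof (rule closed_omega1I)
    fix \<alpha> assume \<alpha>: "\<alpha> \<in> LimOrd" and ex: "\<And>\<mu>. \<mu> < \<alpha> \<Longrightarrow> \<exists>\<beta>\<in>?C. \<mu> < \<beta> \<and> \<beta> < \<alpha>"
    have "h \<gamma> < \<alpha>" if "\<gamma> < \<alpha>" for \<gamma>
      using ex[OF that] by fastforce
    with \<alpha> show "\<alpha> \<in> ?C" by simp
  qed
  show "\<not> bdd_above ?C"
    unfolding not_bdd_above_omega1_iff
  proof
    fix \<gamma>
    have "\<exists>\<beta>. \<forall>\<alpha>\<in>insert \<xi> (h ` {..\<xi>}). \<alpha> < \<beta>" for \<xi>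
    proof (rule countable_bounded_omega1)
      show "countable (insert \<xi> (h ` {..\<xi>}))"
        using countable_lessThan_omega1[of \<xi>] by (simp add: ivl_disj_un_singleton(2)[symmetric])
    qed
    then obtain b where b: "\<And>\<xi>. \<xi> < b \<xi>" "\<And>\<xi> \<eta>. \<eta> \<le> \<xi> \<Longrightarrow> h \<eta> < b \<xi>"
      by (metis atMost_iff imageI insert_iff)
    define s where "s n = (b ^^ n) \<gamma>" for n
    define \<alpha> where "\<alpha> = (LEAST \<alpha>. \<forall>n. s n < \<alpha>)"
    have "\<exists>\<alpha>. \<forall>n. s n < \<alpha>"
      using countable_bounded_omega1[of "range s"] by auto
    then have ub: "s n < \<alpha>" for n
      unfolding \<alpha>_def by (rule LeastI2_ex) blast
    have lub: "\<exists>n. \<mu> \<le> s n" if "\<mu> < \<alpha>" for \<mu>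
      using not_less_Least[OF that[unfolded \<alpha>_def]] by (auto simp: not_less)
    have step: "s n < s (Suc n)" "\<And>\<eta>. \<eta> \<le> s n \<Longrightarrow> h \<eta> < s (Suc n)" for n
      by (simp_all add: s_def b)
    have "\<gamma> < \<alpha>"
      using ub[of 0] by (simp add: s_def)
    moreover have "\<alpha> \<in> LimOrd"
    proof -
      have "\<exists>\<beta><\<alpha>. \<mu> < \<beta>" if "\<mu> < \<alpha>" for \<mu>
        using lub[OF that] ub step(1) by (meson le_less_trans)
      moreover have "\<alpha> \<noteq> 0"
        using \<open>\<gamma> < \<alpha>\<close> zero_le_omega1[of \<gamma>] by auto
      ultimately show ?thesis
        by (simp add: LimOrd_def)
    qed
    moreover have "\<forall>\<mu><\<alpha>. h \<mu> < \<alpha>"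
      using lub ub step(2) by (meson order.strict_trans)
    ultimately show "\<exists>\<alpha>\<in>?C. \<gamma> < \<alpha>" by blast
  qed
qed

text \<open>
  One function dominates the next-element functions of all \<open>U m\<close>, and its closure points are
  limits of every \<open>U m\<close>.
\<close>

lemma common_limit_of_unbounded:
  fixes U :: "nat \<Rightarrow> omega1 set"
  assumes "\<And>m \<gamma>. \<exists>\<beta>\<in>U m. \<gamma> < \<beta>"
  shows "\<exists>\<alpha>\<in>LimOrd. \<gamma>0 < \<alpha> \<and> (\<forall>m. \<forall>\<mu><\<alpha>. \<exists>\<beta>\<in>U m. \<mu> < \<beta> \<and> \<beta> < \<alpha>)"
proof -
  obtain g where g: "\<And>m \<gamma>. g m \<gamma> \<in> U m" "\<And>m \<gamma>. \<gamma> < g m \<gamma>"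
    using assms by metis
  have "\<exists>\<beta>. \<forall>\<alpha>\<in>range (\<lambda>m. g m \<gamma>). \<alpha> < \<beta>" for \<gamma>
    by (rule countable_bounded_omega1) simp
  then obtain h where h: "\<And>m \<gamma>. g m \<gamma> < h \<gamma>"
    by (metis rangeI)
  obtain \<alpha> where "\<alpha> \<in> LimOrd" "\<gamma>0 < \<alpha>" "\<forall>\<gamma><\<alpha>. h \<gamma> < \<alpha>"
    using club_closure_points[of h] unfolding club_def not_bdd_above_omega1_iff by blast
  then show ?thesis
    using g h by (meson order.strict_trans)
qed

text \<open>
  A weak form of Fodor's lemma. If each value \<open>\<gamma>\<close> were taken only below some \<open>h \<gamma>\<close>, then a closure
  point \<open>\<alpha> \<in> B\<close> of \<open>h\<close> would satisfy \<open>\<alpha> \<le> h (f \<alpha>) < \<alpha>\<close>.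
\<close>

lemma stationary_regressive_unbounded:
  fixes f :: "omega1 \<Rightarrow> omega1"
  assumes "stationary B" "\<And>\<alpha>. \<alpha> \<in> B \<Longrightarrow> f \<alpha> < \<alpha>"
  shows "\<exists>\<gamma>. \<forall>\<xi>. \<exists>\<alpha>\<in>B. f \<alpha> = \<gamma> \<and> \<xi> < \<alpha>"
proof (rule ccontr)
  assume "\<not> ?thesis"
  then obtain h where h: "\<And>\<gamma> \<alpha>. \<alpha> \<in> B \<Longrightarrow> f \<alpha> = \<gamma> \<Longrightarrow> \<alpha> \<le> h \<gamma>"
    by (metis not_le)
  obtain \<alpha> where "\<alpha> \<in> B" "\<forall>\<gamma><\<alpha>. h \<gamma> < \<alpha>"
    using assms(1) club_closure_points[of h] unfolding stationary_def by blast
  then show False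
    using h[of \<alpha> "f \<alpha>"] assms(2)[of \<alpha>] by (metis leD)
qed

section \<open>Consecutive points of \<open>D\<^sub>\<alpha>\<close>\<close>

lemma LimOrd2_LimOrd: "\<alpha> \<in> LimOrd2 \<Longrightarrow> \<alpha> \<in> LimOrd"
  by (simp add: LimOrd2_def)

lemma LimOrd2I:
  assumes "\<alpha> \<noteq> 0" "\<And>\<gamma>. \<gamma> < \<alpha> \<Longrightarrow> \<exists>\<beta>\<in>LimOrd. \<gamma> < \<beta> \<and> \<beta> < \<alpha>"
  shows "\<alpha> \<in> LimOrd2"
  using assms unfolding LimOrd2_def LimOrd_def by blast

text \<open>
  If all \<open>lo + \<omega> \<cdot> m\<close> were below \<open>\<xi>\<close>, then their supremum would be a limit of limits in \<open>(lo, \<xi>]\<close>.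
\<close>

lemma limord_eq_add_omega_pow:
  assumes "lo \<in> LimOrd" "\<xi> \<in> LimOrd" "lo \<le> \<xi>" "{lo<..\<xi>} \<inter> LimOrd2 = {}"
  shows "\<exists>m. \<xi> = (add_omega ^^ m) lo"
proof -
  let ?a = "\<lambda>m. (add_omega ^^ m) lo"
  have lim: "?a m \<in> LimOrd" for m
    using assms(1) by (cases m) (auto simp: add_omega_in_limord)
  have "\<exists>m. \<xi> \<le> ?a m"
  proof (rule ccontr)
    assume "\<not> ?thesis"
    then have below: "\<forall>m. ?a m < \<xi>" by (auto simp: not_le)
    define \<kappa> where "\<kappa> = (LEAST \<kappa>. \<forall>m. ?a m < \<kappa>)"
    have ub: "?a m < \<kappa>" for m
      unfolding \<kappa>_def using below by (rule LeastI2) blast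
    have "\<kappa> \<le> \<xi>"
      unfolding \<kappa>_def using below by (rule Least_le)
    have "\<exists>\<beta>\<in>LimOrd. \<gamma> < \<beta> \<and> \<beta> < \<kappa>" if less: "\<gamma> < \<kappa>" for \<gamma>
    proof -
      obtain m where "\<gamma> \<le> ?a m"
        using not_less_Least[OF less[unfolded \<kappa>_def]] by (auto simp: not_less)
      also have "\<dots> < ?a (Suc m)" by (simp add: less_add_omega)
      finally show ?thesis using lim ub by blast
    qed
    then have "\<kappa> \<in> LimOrd2"
      using ub[of 0] zero_le_omega1[of lo] by (intro LimOrd2I) auto
    then show False
      using assms(4) ub[of 0] \<open>\<kappa> \<le> \<xi>\<close> by auto
  qed
  then obtain m where m: "\<xi> \<le> ?a m" and least: "\<And>j. j < m \<Longrightarrow> \<not> \<xi> \<le> ?a j"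
    using exists_least_iff[of "\<lambda>m. \<xi> \<le> ?a m"] by blast
  show ?thesis
  proof (cases m)
    case 0
    then show ?thesis using m assms(3) by (intro exI[of _ 0]) simp
  next
    case (Suc j)
    then have "?a j < \<xi>" "\<xi> \<le> add_omega (?a j)"
      using m least[of j] by auto
    then have "\<xi> = ?a (Suc j)"
      using between_notin_limord[of "?a j" \<xi>] assms(2) by fastforce
    then show ?thesis ..
  qed
qed

text \<open>
  The inductive set read as a recursion from the top, which allows induction on \<open>hi\<close>.
\<close>

lemma descent_unfold:
  "descent \<sigma> lo hi = insert hi
     (if {lo<..hi} \<inter> LimOrd2 = {} then {} else descent \<sigma> lo (rung \<sigma> lo (top_limord2 lo hi)))"
  (is "_ = insert hi ?R")
proof (intro equalityI subsetI)
  fix \<xi> assume "\<xi> \<in> descent \<sigma> lo hi"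
  then show "\<xi> \<in> insert hi ?R"
    by induction (auto split: if_splits intro: descent.intros)
next
  fix \<xi> assume "\<xi> \<in> insert hi ?R"
  moreover have "\<xi> \<in> descent \<sigma> lo hi"
    if "{lo<..hi} \<inter> LimOrd2 \<noteq> {}" "\<xi> \<in> descent \<sigma> lo (rung \<sigma> lo (top_limord2 lo hi))"
    using that(2) by induction (use that(1) in \<open>auto intro: descent.intros\<close>)
  ultimately show "\<xi> \<in> descent \<sigma> lo hi"
    by (auto split: if_splits intro: descent.intros)
qed

text \<open>
  The part of \<open>D\<^sub>\<alpha>\<close> in a closed ladder interval. Its lower end is included so that consecutive points
  of \<open>D\<^sub>\<alpha>\<close> always lie in a common part.
\<close>

definition interval_points :: "(omega1 \<Rightarrow> nat \<Rightarrow> omega1) \<Rightarrow> omega1 \<Rightarrow> omega1 \<Rightarrow> omega1 set" where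
  "interval_points \<sigma> lo hi = insert lo (\<Union>\<xi>\<in>descent \<sigma> lo hi. insert \<xi> (fill lo \<xi>))"

lemma interval_points_unfold:
  "interval_points \<sigma> lo hi = insert lo (insert hi (fill lo hi \<union>
     (if {lo<..hi} \<inter> LimOrd2 = {} then {} else interval_points \<sigma> lo (rung \<sigma> lo (top_limord2 lo hi)))))"
  unfolding interval_points_def by (subst descent_unfold) auto

lemma interval_points_bounds:
  assumes "ladder_system \<sigma>" "lo < hi" "\<eta> \<in> interval_points \<sigma> lo hi"
  shows "lo \<le> \<eta>" "\<eta> \<le> hi"
  using assms(3) descent_bounds[OF assms(1,2)] fill_bounds assms(2) unfolding interval_points_def
  by (force simp: less_imp_le)+

text \<open>
  The two ways in which \<open>\<epsilon>\<close> follows \<open>\<delta>\<close> in a set \<open>D\<^sub>\<alpha>\<close>. In the second one the walk that enters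
  \<open>D\<^sub>\<epsilon>\<close> next finds \<open>\<delta>\<close> there again, so that its lower ends never decrease.
\<close>

definition next_point :: "(omega1 \<Rightarrow> nat \<Rightarrow> omega1) \<Rightarrow> omega1 \<Rightarrow> omega1 \<Rightarrow> bool" where
  "next_point \<sigma> \<delta> \<epsilon> \<longleftrightarrow> \<epsilon> = add_omega \<delta> \<or> \<epsilon> \<in> LimOrd2 \<and> \<delta> \<in> range (\<sigma> \<epsilon>)"

text \<open>
  Induction along the descent. With \<open>\<nu>\<close> the largest limit of limits up to \<open>hi\<close> and \<open>r\<close> its chosen rung,
  the points above \<open>r\<close> are the \<open>\<nu> + \<omega> \<cdot> l\<close> up to \<open>hi\<close>, the one before \<open>\<nu>\<close> is \<open>r \<in> L\<^sub>\<nu>\<close>, and the points up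
  to \<open>r\<close> are those of the shorter interval from \<open>lo\<close> to \<open>r\<close>. At the bottom of the descent there is no such \<open>\<nu>\<close>,
  and the points are the \<open>lo + \<omega> \<cdot> l\<close> up to \<open>hi\<close>.
\<close>

lemma interval_points_consecutive:
  assumes "ladder_system \<sigma>" "\<And>\<alpha>. \<alpha> \<in> LimOrd2 \<Longrightarrow> range (\<sigma> \<alpha>) \<subseteq> LimOrd"
    and "lo \<in> LimOrd" "hi \<in> LimOrd" "lo < hi"
    and "\<delta> \<in> interval_points \<sigma> lo hi" "\<epsilon> \<in> interval_points \<sigma> lo hi" "\<delta> < \<epsilon>"
    and "\<And>\<eta>. \<eta> \<in> interval_points \<sigma> lo hi \<Longrightarrow> \<delta> < \<eta> \<Longrightarrow> \<not> \<eta> < \<epsilon>"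
  shows "next_point \<sigma> \<delta> \<epsilon>"
  using assms(4-9)
proof (induction hi rule: less_induct)
  case (less hi)
  note E = interval_points_unfold[of \<sigma> lo hi]
  show ?case
  proof (cases "{lo<..hi} \<inter> LimOrd2 = {}")
    case True
    obtain m where m: "hi = (add_omega ^^ m) lo"
      using limord_eq_add_omega_pow[OF assms(3) less.prems(1) _ True] less.prems(2) less_imp_le by blast
    have "0 < m" using m less.prems(2) by (cases m) auto
    have mem: "\<eta> \<in> interval_points \<sigma> lo hi \<longleftrightarrow> (\<exists>l\<le>m. \<eta> = (add_omega ^^ l) lo)" for \<eta>
    proof
      assume "\<eta> \<in> interval_points \<sigma> lo hi"
      then consider "\<eta> = lo" | "\<eta> = hi" | "\<eta> \<in> fill lo hi"
        using E True by auto
      then show "\<exists>l\<le>m. \<eta> = (add_omega ^^ l) lo"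
      proof cases
        case 1 then show ?thesis by (intro exI[of _ 0]) simp
      next
        case 2 then show ?thesis using m by blast
      next
        case 3
        then obtain l m' where "\<eta> = (add_omega ^^ l) lo" "hi = (add_omega ^^ m') lo" "l < m'"
          using True by (auto simp: fill_def)
        moreover have "l < m"
          using calculation m add_omega_pow_less_iff[of l lo m] add_omega_pow_less_iff[of l lo m'] by simp
        ultimately show ?thesis by (metis less_imp_le)
      qed
    next
      assume "\<exists>l\<le>m. \<eta> = (add_omega ^^ l) lo"
      then obtain l where l: "l \<le> m" "\<eta> = (add_omega ^^ l) lo" by blast
      consider "l = 0" | "l = m" | "1 \<le> l" "l < m" using l(1) by linarith
      then show "\<eta> \<in> interval_points \<sigma> lo hi"
        by cases (use l m True E in \<open>auto simp: fill_def\<close>)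
    qed
    obtain i j where ij: "\<delta> = (add_omega ^^ i) lo" "\<epsilon> = (add_omega ^^ j) lo" "j \<le> m"
      using less.prems(3,4) mem by blast
    have "i < j"
      using less.prems(5) ij by (simp add: add_omega_pow_less_iff)
    moreover have "\<not> Suc i < j"
    proof
      assume "Suc i < j"
      then have "(add_omega ^^ Suc i) lo \<in> interval_points \<sigma> lo hi"
        using mem ij(3) by (metis less_imp_le order.trans)
      then show False
        using less.prems(6) \<open>Suc i < j\<close> unfolding ij by (metis add_omega_pow_less_iff lessI)
    qed
    ultimately have "j = Suc i" by simp
    then show ?thesis
      using ij by (simp add: next_point_def)
  next
    case False
    define \<nu> where "\<nu> = top_limord2 lo hi"
    define r where "r = rung \<sigma> lo \<nu>"
    have \<nu>: "lo < \<nu>" "\<nu> \<le> hi" "\<nu> \<in> LimOrd2" and top: "\<And>\<kappa>. lo < \<kappa> \<Longrightarrow> \<kappa> \<le> hi \<Longrightarrow> \<kappa> \<in> LimOrd2 \<Longrightarrow> \<kappa> \<le> \<nu>"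
      using top_limord2[OF False] unfolding \<nu>_def by auto
    have r: "lo < r" "r < \<nu>" "r \<in> range (\<sigma> \<nu>)"
      using rung_bounds[OF assms(1) \<nu>(3,1)] by (auto simp: r_def rung_def)
    have rlim: "r \<in> LimOrd"
      using assms(2)[OF \<nu>(3)] r(3) by blast
    have "\<kappa> \<notin> LimOrd2" if "\<nu> < \<kappa>" "\<kappa> \<le> hi" for \<kappa>
      using top[of \<kappa>] that order.strict_trans[OF \<nu>(1) that(1)] leD by blast
    then have "{\<nu><..hi} \<inter> LimOrd2 = {}" by auto
    then obtain m where m: "hi = (add_omega ^^ m) \<nu>"
      using limord_eq_add_omega_pow[OF LimOrd2_LimOrd[OF \<nu>(3)] less.prems(1) \<nu>(2)] by blast
    have fill: "\<eta> \<in> fill lo hi \<longleftrightarrow> (\<exists>l<m. \<eta> = (add_omega ^^ l) \<nu>)" for \<eta>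
    proof -
      have inj: "hi = (add_omega ^^ m') \<nu> \<longleftrightarrow> m' = m" for m'
      proof (cases m m' rule: linorder_cases)
        case less
        then have "hi < (add_omega ^^ m') \<nu>"
          unfolding m by (simp only: add_omega_pow_less_iff)
        then show ?thesis using less by auto
      next
        case greater
        then have "(add_omega ^^ m') \<nu> < hi"
          unfolding m by (simp only: add_omega_pow_less_iff)
        then show ?thesis using greater by auto
      qed (use m in simp)
      show ?thesis
        using False by (auto simp: fill_def \<nu>_def[symmetric] inj)
    qed
    have mem: "\<eta> \<in> interval_points \<sigma> lo hi \<longleftrightarrow>
      \<eta> \<in> interval_points \<sigma> lo r \<or> (\<exists>l\<le>m. \<eta> = (add_omega ^^ l) \<nu>)" for \<eta>
    proof -
      have "\<eta> \<in> interval_points \<sigma> lo hi \<longleftrightarrow>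
          \<eta> = lo \<or> \<eta> = hi \<or> \<eta> \<in> fill lo hi \<or> \<eta> \<in> interval_points \<sigma> lo r"
        unfolding E r_def \<nu>_def using False by simp
      moreover have "lo \<in> interval_points \<sigma> lo r"
        by (simp add: interval_points_def)
      moreover have "(\<exists>l\<le>m. \<eta> = (add_omega ^^ l) \<nu>) \<longleftrightarrow> \<eta> = hi \<or> (\<exists>l<m. \<eta> = (add_omega ^^ l) \<nu>)"
        unfolding m by (auto simp: order.order_iff_strict)
      ultimately show ?thesis
        unfolding fill by blast
    qed
    have ge: "\<nu> \<le> (add_omega ^^ l) \<nu>" for l
      using add_omega_pow_less_iff[of l \<nu> 0] by (simp add: not_less)
    have le: "\<eta> \<le> r" if "\<eta> \<in> interval_points \<sigma> lo r" for \<eta>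
      using interval_points_bounds[OF assms(1) r(1) that] by simp
    have "r \<in> interval_points \<sigma> lo r"
      by (auto simp: interval_points_def intro: descent.intros)
    then have rmem: "r \<in> interval_points \<sigma> lo hi" by (simp add: mem)
    show ?thesis
    proof (cases "\<epsilon> \<le> r")
      case True
      then have "\<epsilon> \<in> interval_points \<sigma> lo r" "\<delta> \<in> interval_points \<sigma> lo r"
        using less.prems(3-5) mem ge r(2) by (metis leD le_less_trans less_imp_le order.strict_trans)+
      then show ?thesis
        using less.IH[of r] less.prems(5,6) r(1,2) \<nu>(2) rlim mem by auto
    next
      case False
      then obtain j where j: "\<epsilon> = (add_omega ^^ j) \<nu>" "j \<le> m"
        using less.prems(4) mem le by blast
      have "r \<le> \<delta>"
        using less.prems(6)[OF rmem] False by (meson not_le)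
      show ?thesis
      proof (cases j)
        case 0
        then have "\<delta> \<in> interval_points \<sigma> lo r"
          using less.prems(3,5) mem j ge by (auto simp: not_less[symmetric])
        then have "\<delta> = r" using le \<open>r \<le> \<delta>\<close> by (simp add: antisym)
        then show ?thesis
          using j 0 \<nu>(3) r(3) by (simp add: next_point_def)
      next
        case (Suc i)
        let ?p = "(add_omega ^^ i) \<nu>"
        have "i \<le> m" using j(2) Suc by simp
        then have p: "?p \<in> interval_points \<sigma> lo hi" "?p < \<epsilon>"
          unfolding mem using j(1) Suc by (auto simp: less_add_omega)
        have "\<not> \<delta> < ?p"
          using less.prems(6)[OF p(1)] p(2) by blast
        moreover have "\<not> ?p < \<delta>"
        proof
          assume "?p < \<delta>"
          then have "\<not> \<delta> \<le> r" using ge[of i] r(2) by auto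
          then obtain l where "\<delta> = (add_omega ^^ l) \<nu>"
            using le less.prems(3) mem by blast
          then show False
            using \<open>?p < \<delta>\<close> less.prems(5) j Suc by (simp add: add_omega_pow_less_iff del: funpow.simps)
        qed
        ultimately show ?thesis
          using j Suc by (simp add: next_point_def)
      qed
    qed
  qed
qed

lemma ladder_points_eq: "ladder_points \<sigma> \<alpha> = (\<Union>n. interval_points \<sigma> (\<sigma> \<alpha> n) (\<sigma> \<alpha> (Suc n)))"
  unfolding ladder_points_def interval_points_def by auto

lemma ladder_strict_mono: "ladder_system \<sigma> \<Longrightarrow> \<alpha> \<in> LimOrd \<Longrightarrow> strict_mono (\<sigma> \<alpha>)"
  by (simp add: ladder_system_def)

lemma ladder_points_consecutive:
  assumes "ladder_system \<sigma>" "\<And>\<alpha>. \<alpha> \<in> LimOrd2 \<Longrightarrow> range (\<sigma> \<alpha>) \<subseteq> LimOrd"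
    and "\<alpha> \<in> LimOrd2" "\<delta> \<in> ladder_points \<sigma> \<alpha>" "\<epsilon> \<in> ladder_points \<sigma> \<alpha>" "\<delta> < \<epsilon>"
    and none: "\<And>\<eta>. \<eta> \<in> ladder_points \<sigma> \<alpha> \<Longrightarrow> \<delta> < \<eta> \<Longrightarrow> \<not> \<eta> < \<epsilon>"
  shows "next_point \<sigma> \<delta> \<epsilon>"
proof -
  have \<alpha>: "\<alpha> \<in> LimOrd" using assms(3) by (rule LimOrd2_LimOrd)
  have mono: "strict_mono (\<sigma> \<alpha>)" using ladder_strict_mono[OF assms(1) \<alpha>] .
  let ?E = "\<lambda>n. interval_points \<sigma> (\<sigma> \<alpha> n) (\<sigma> \<alpha> (Suc n))"
  have bounds: "\<sigma> \<alpha> n \<le> \<eta> \<and> \<eta> \<le> \<sigma> \<alpha> (Suc n)" if "\<eta> \<in> ?E n" for n \<eta>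
    using interval_points_bounds[OF assms(1) _ that] strict_monoD[OF mono, of n "Suc n"] by simp
  have ends: "\<sigma> \<alpha> n \<in> ?E n" "\<sigma> \<alpha> (Suc n) \<in> ?E n" for n
    by (auto simp: interval_points_def intro: descent.intros)
  then have rung: "\<sigma> \<alpha> n \<in> ladder_points \<sigma> \<alpha>" for n
    unfolding ladder_points_eq by blast
  have mono_le: "\<sigma> \<alpha> i \<le> \<sigma> \<alpha> j" if "i \<le> j" for i j
    using that strict_mono_less_eq[OF mono] by simp
  obtain i j where i: "\<delta> \<in> ?E i" and j: "\<epsilon> \<in> ?E j"
    using assms(4,5) unfolding ladder_points_eq by blast
  obtain n where n: "\<epsilon> \<le> \<sigma> \<alpha> (Suc n)" and least: "\<And>m. m < n \<Longrightarrow> \<not> \<epsilon> \<le> \<sigma> \<alpha> (Suc m)"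
    using exists_least_iff[of "\<lambda>n. \<epsilon> \<le> \<sigma> \<alpha> (Suc n)"] bounds[OF j] by blast
  have "\<sigma> \<alpha> n < \<epsilon>"
  proof (cases n)
    case 0
    then show ?thesis
      using bounds[OF i] mono_le[of 0 i] assms(6) by auto
  next
    case (Suc m)
    then show ?thesis using least[of m] by simp
  qed
  then have "\<sigma> \<alpha> n \<le> \<delta>"
    using none[OF rung[of n]] by (meson not_le)
  have "\<epsilon> \<in> ?E n"
  proof (cases n j rule: linorder_cases)
    case less
    then have "\<epsilon> = \<sigma> \<alpha> (Suc n)"
      using n bounds[OF j] mono_le[of "Suc n" j] by auto
    then show ?thesis using ends by simp
  next
    case greater
    then show ?thesis
      using bounds[OF j] mono_le[of "Suc j" n] \<open>\<sigma> \<alpha> n < \<epsilon>\<close> by auto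
  qed (use j in simp)
  moreover have "\<delta> \<in> ?E n"
  proof (cases n i rule: linorder_cases)
    case less
    then show ?thesis
      using n bounds[OF i] mono_le[of "Suc n" i] assms(6) by auto
  next
    case greater
    then have "\<delta> = \<sigma> \<alpha> n"
      using bounds[OF i] mono_le[of "Suc i" n] \<open>\<sigma> \<alpha> n \<le> \<delta>\<close> by auto
    then show ?thesis using ends by simp
  qed (use i in simp)
  moreover have "\<sigma> \<alpha> n \<in> LimOrd" "\<sigma> \<alpha> (Suc n) \<in> LimOrd"
    using assms(2)[OF assms(3)] by auto
  moreover have "\<sigma> \<alpha> n < \<sigma> \<alpha> (Suc n)"
    using strict_monoD[OF mono] by simp
  ultimately show ?thesis
    using assms(6) none unfolding ladder_points_eq
    by (intro interval_points_consecutive[OF assms(1,2)]) auto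
qed

section \<open>Coherence of the functions \<open>z\<^sub>\<alpha>\<close> and the walk between ladders\<close>

text \<open>
  The supremum of zero and the limits below \<open>\<gamma>\<close>; were it not among them, it would be a limit of limits,
  hence below \<open>\<gamma>\<close> and among them after all.
\<close>

lemma largest_limord_below:
  assumes "\<gamma> \<noteq> 0" "\<gamma> \<notin> LimOrd2"
  shows "\<exists>\<kappa>\<in>insert 0 LimOrd. \<kappa> < \<gamma> \<and> \<gamma> \<le> add_omega \<kappa>"
proof -
  let ?S = "{\<mu>\<in>insert 0 LimOrd. \<mu> < \<gamma>}"
  define \<kappa> where "\<kappa> = (LEAST \<kappa>. \<forall>\<mu>\<in>?S. \<mu> \<le> \<kappa>)"
  have "\<forall>\<mu>\<in>?S. \<mu> \<le> \<gamma>" by auto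
  then have ub: "\<forall>\<mu>\<in>?S. \<mu> \<le> \<kappa>" and "\<kappa> \<le> \<gamma>"
    unfolding \<kappa>_def by (rule LeastI, rule Least_le)
  have ex: "\<exists>\<mu>\<in>?S. \<xi> < \<mu>" if less: "\<xi> < \<kappa>" for \<xi>
    using not_less_Least[OF less[unfolded \<kappa>_def]] by (auto simp: not_le)
  have "\<kappa> \<in> ?S"
  proof (rule ccontr)
    assume *: "\<kappa> \<notin> ?S"
    have "0 \<in> ?S"
      using assms(1) zero_le_omega1[of \<gamma>] by (simp add: order.order_iff_strict)
    then have "\<kappa> \<noteq> 0" using * by blast
    have "\<exists>\<beta>\<in>LimOrd. \<xi> < \<beta> \<and> \<beta> < \<kappa>" if less: "\<xi> < \<kappa>" for \<xi>
    proof -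
      obtain \<mu> where \<mu>: "\<mu> \<in> ?S" "\<xi> < \<mu>" using ex[OF less] by blast
      have "\<mu> \<le> \<kappa>" using ub \<mu>(1) by blast
      moreover have "\<mu> \<noteq> \<kappa>" using \<mu>(1) * by blast
      ultimately have "\<mu> < \<kappa>" by simp
      moreover have "\<mu> \<noteq> 0" using \<mu>(2) zero_le_omega1[of \<xi>] leD by blast
      ultimately show ?thesis using \<mu> by auto
    qed
    then have "\<kappa> \<in> LimOrd2" by (rule LimOrd2I[OF \<open>\<kappa> \<noteq> 0\<close>])
    moreover have "\<kappa> \<noteq> \<gamma>" using calculation assms(2) by auto
    ultimately show False
      using * \<open>\<kappa> \<le> \<gamma>\<close> LimOrd2_LimOrd[of \<kappa>] by simp
  qed
  moreover have "\<gamma> \<le> add_omega \<kappa>"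
  proof (rule ccontr)
    assume "\<not> \<gamma> \<le> add_omega \<kappa>"
    then have "add_omega \<kappa> \<in> ?S"
      by (simp add: add_omega_in_limord)
    then show False
      using ub less_add_omega[of \<kappa>] leD by blast
  qed
  ultimately show ?thesis by auto
qed

lemma zfun_self: "zfun \<sigma> \<alpha> \<alpha> = 0"
proof -
  consider "\<alpha> = 0" | "\<alpha> \<in> LimOrd2" | "\<alpha> \<noteq> 0" "\<alpha> \<notin> LimOrd2" by blast
  then show ?thesis
  proof cases
    case 3
    then obtain \<kappa> where "\<kappa> \<in> insert 0 LimOrd" "\<kappa> < \<alpha>" "\<alpha> \<le> add_omega \<kappa>"
      using largest_limord_below by blast
    then show ?thesis using zfun_above_limord[of \<kappa> \<alpha> \<sigma> \<alpha>] by (simp add: not_le[symmetric])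
  qed (simp_all add: zfun_zero zfun_limord2_self)
qed

lemma finite_fill: "finite (fill lo \<xi>)"
proof -
  have fin: "finite {(add_omega ^^ l) \<nu> | l m. \<xi> = (add_omega ^^ m) \<nu> \<and> l < m}" for \<nu>
  proof (cases "\<exists>m. \<xi> = (add_omega ^^ m) \<nu>")
    case True
    then obtain m where m: "\<xi> = (add_omega ^^ m) \<nu>" ..
    have "{(add_omega ^^ l) \<nu> | l m. \<xi> = (add_omega ^^ m) \<nu> \<and> l < m} \<subseteq> (\<lambda>l. (add_omega ^^ l) \<nu>) ` {..<m}"
    proof clarify
      fix l m' assume "\<xi> = (add_omega ^^ m') \<nu>" "l < m'"
      then have "(add_omega ^^ l) \<nu> < (add_omega ^^ m) \<nu>"
        unfolding m by (simp only: add_omega_pow_less_iff)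
      then show "(add_omega ^^ l) \<nu> \<in> (\<lambda>l. (add_omega ^^ l) \<nu>) ` {..<m}"
        by (simp add: add_omega_pow_less_iff)
    qed
    then show ?thesis by (rule finite_subset) simp
  next
    case False
    then have "{(add_omega ^^ l) \<nu> | l m. \<xi> = (add_omega ^^ m) \<nu> \<and> l < m} = {}" by auto
    then show ?thesis by (simp only: finite.emptyI)
  qed
  have "fill lo \<xi> \<subseteq> {(add_omega ^^ l) lo | l m. \<xi> = (add_omega ^^ m) lo \<and> l < m} \<union>
      {(add_omega ^^ l) (top_limord2 lo \<xi>) | l m. \<xi> = (add_omega ^^ m) (top_limord2 lo \<xi>) \<and> l < m}"
    unfolding fill_def by auto
  then show ?thesis
    by (rule finite_subset) (simp only: finite_Un fin simp_thms)
qed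

lemma finite_descent:
  assumes "ladder_system \<sigma>" "lo < hi"
  shows "finite (descent \<sigma> lo hi)"
  using assms(2)
proof (induction hi rule: less_induct)
  case (less hi)
  show ?case
  proof (cases "{lo<..hi} \<inter> LimOrd2 = {}")
    case True
    then show ?thesis by (subst descent_unfold) simp
  next
    case False
    let ?r = "rung \<sigma> lo (top_limord2 lo hi)"
    have "lo < ?r" "?r < hi"
      using top_limord2(1)[OF False] rung_bounds[OF assms(1), of "top_limord2 lo hi" lo]
      by (auto intro: order.strict_trans2)
    then have "finite (descent \<sigma> lo ?r)"
      using less.IH by blast
    then show ?thesis
      using False by (subst descent_unfold) simp
  qed
qed

text \<open>
  Finiteness of the initial segments makes the order type of \<open>D\<^sub>\<alpha>\<close> equal to \<open>\<omega>\<close>; otherwise \<open>enumerate\<close>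
  would list only the first \<open>\<omega>\<close> points.
\<close>

lemma finite_ladder_points_below:
  assumes "ladder_system \<sigma>" "\<alpha> \<in> LimOrd" "\<gamma> < \<alpha>"
  shows "finite {\<eta>\<in>ladder_points \<sigma> \<alpha>. \<eta> < \<gamma>}"
proof -
  have mono: "strict_mono (\<sigma> \<alpha>)" using ladder_strict_mono[OF assms(1,2)] .
  obtain k where k: "\<gamma> < \<sigma> \<alpha> k" using ladder_cofinal[OF assms] by blast
  have less: "\<sigma> \<alpha> n < \<sigma> \<alpha> (Suc n)" for n
    using mono by (simp add: strict_mono_Suc_iff)
  have "{\<eta>\<in>ladder_points \<sigma> \<alpha>. \<eta> < \<gamma>} \<subseteq> (\<Union>n\<in>{..<k}. interval_points \<sigma> (\<sigma> \<alpha> n) (\<sigma> \<alpha> (Suc n)))"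
  proof clarify
    fix \<eta> assume "\<eta> \<in> ladder_points \<sigma> \<alpha>" "\<eta> < \<gamma>"
    then obtain n where n: "\<eta> \<in> interval_points \<sigma> (\<sigma> \<alpha> n) (\<sigma> \<alpha> (Suc n))"
      unfolding ladder_points_eq by blast
    have "\<sigma> \<alpha> n < \<sigma> \<alpha> k"
      using interval_points_bounds(1)[OF assms(1) less n] \<open>\<eta> < \<gamma>\<close> k by (meson le_less_trans order.strict_trans)
    then have "n < k" using strict_mono_less[OF mono] by simp
    then show "\<eta> \<in> (\<Union>n\<in>{..<k}. interval_points \<sigma> (\<sigma> \<alpha> n) (\<sigma> \<alpha> (Suc n)))"
      using n by blast
  qed
  moreover have "finite (interval_points \<sigma> (\<sigma> \<alpha> n) (\<sigma> \<alpha> (Suc n)))" for n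
    unfolding interval_points_def using finite_descent[OF assms(1) less] finite_fill by simp
  ultimately show ?thesis
    by (meson finite_UN_I finite_lessThan finite_subset)
qed

lemma range_enumerate_if_finite_below:
  fixes S :: "'a::wellorder set"
  assumes "infinite S" "\<And>y. y \<in> S \<Longrightarrow> finite {x\<in>S. x < y}"
  shows "range (enumerate S) = S"
proof
  show "range (enumerate S) \<subseteq> S"
    using enumerate_in_set[OF assms(1)] by blast
  show "S \<subseteq> range (enumerate S)"
  proof (rule subsetI, rule ccontr)
    fix y assume y: "y \<in> S" "y \<notin> range (enumerate S)"
    have "enumerate S n < y" for n
    proof (induction n)
      case 0
      have "enumerate S 0 \<le> y" using y(1) by (simp add: enumerate_0 Least_le)
      then show ?case using y(2) by (metis order.not_eq_order_implies_strict rangeI)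
    next
      case (Suc n)
      have "enumerate S (Suc n) \<le> y"
        unfolding enumerate_Suc''[OF assms(1)] using y(1) Suc by (intro Least_le) simp
      then show ?case using y(2) by (metis order.not_eq_order_implies_strict rangeI)
    qed
    then have "range (enumerate S) \<subseteq> {x\<in>S. x < y}"
      using enumerate_in_set[OF assms(1)] by blast
    then have "finite (range (enumerate S))"
      using assms(2)[OF y(1)] finite_subset by blast
    moreover have "inj (enumerate S)"
      using enumerate_mono[OF _ assms(1)] by (intro strict_mono_imp_inj_on strict_monoI) blast
    ultimately show False
      using range_inj_infinite by blast
  qed
qed

lemma delta_strict_mono: "ladder_system \<sigma> \<Longrightarrow> \<alpha> \<in> LimOrd \<Longrightarrow> strict_mono (delta \<sigma> \<alpha>)"
  unfolding delta_def using enumerate_mono infinite_ladder_points by (blast intro: strict_monoI)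

lemma range_delta: "ladder_system \<sigma> \<Longrightarrow> \<alpha> \<in> LimOrd \<Longrightarrow> range (delta \<sigma> \<alpha>) = ladder_points \<sigma> \<alpha>"
  unfolding delta_def
  by (intro range_enumerate_if_finite_below infinite_ladder_points finite_ladder_points_below ladder_points_less)

lemma delta_cofinal:
  assumes "ladder_system \<sigma>" "\<alpha> \<in> LimOrd" "\<gamma> < \<alpha>"
  shows "\<exists>n. \<gamma> < delta \<sigma> \<alpha> n"
proof -
  obtain k where "\<gamma> < \<sigma> \<alpha> k" using ladder_cofinal[OF assms] by blast
  moreover have "\<sigma> \<alpha> k \<in> range (delta \<sigma> \<alpha>)"
    unfolding range_delta[OF assms(1,2)] ladder_points_def by blast
  ultimately show ?thesis by auto
qed

lemma delta_interval:
  assumes "ladder_system \<sigma>" "\<alpha> \<in> LimOrd" "\<gamma> < \<alpha>"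
  obtains "\<gamma> \<le> delta \<sigma> \<alpha> 0" | n where "delta \<sigma> \<alpha> n < \<gamma>" "\<gamma> \<le> delta \<sigma> \<alpha> (Suc n)"
proof -
  obtain n where n: "\<gamma> \<le> delta \<sigma> \<alpha> n" and least: "\<And>m. m < n \<Longrightarrow> \<not> \<gamma> \<le> delta \<sigma> \<alpha> m"
    using exists_least_iff[of "\<lambda>n. \<gamma> \<le> delta \<sigma> \<alpha> n"] delta_cofinal[OF assms] less_imp_le by blast
  show thesis
  proof (cases n)
    case 0
    then show ?thesis using n that(1) by simp
  next
    case (Suc m)
    then show ?thesis using n least[of m] that(2) by (simp add: not_le)
  qed
qed

text \<open>
  Continuity of the difference \<open>z - w\<close> at \<open>\<zeta>\<close>: its values are integers, so it has to be constant on
  a left neighbourhood that includes \<open>\<zeta>\<close> itself.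
\<close>

definition eventually_parallel :: "omega1 \<Rightarrow> (omega1 \<Rightarrow> nat) \<Rightarrow> (omega1 \<Rightarrow> nat) \<Rightarrow> bool" where
  "eventually_parallel \<zeta> z w \<longleftrightarrow> (\<exists>c. \<exists>\<mu><\<zeta>. \<forall>\<beta>\<in>{\<mu><..\<zeta>}. int (z \<beta>) = int (w \<beta>) + c)"

lemma eventually_parallel_sym:
  assumes "eventually_parallel \<zeta> z w"
  shows "eventually_parallel \<zeta> w z"
proof -
  obtain c \<mu> where \<mu>: "\<mu> < \<zeta>" "\<And>\<beta>. \<beta> \<in> {\<mu><..\<zeta>} \<Longrightarrow> int (z \<beta>) = int (w \<beta>) + c"
    using assms unfolding eventually_parallel_def by blast
  have "int (w \<beta>) = int (z \<beta>) + (- c)" if "\<beta> \<in> {\<mu><..\<zeta>}" for \<beta>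
    using \<mu>(2)[OF that] by linarith
  then show ?thesis
    unfolding eventually_parallel_def using \<mu>(1) by blast
qed

lemma eventually_parallel_trans:
  assumes "eventually_parallel \<zeta> z w" "eventually_parallel \<zeta> w v"
  shows "eventually_parallel \<zeta> z v"
proof -
  obtain c \<mu> where \<mu>: "\<mu> < \<zeta>" "\<And>\<beta>. \<beta> \<in> {\<mu><..\<zeta>} \<Longrightarrow> int (z \<beta>) = int (w \<beta>) + c"
    using assms(1) unfolding eventually_parallel_def by blast
  obtain d \<mu>' where \<mu>': "\<mu>' < \<zeta>" "\<And>\<beta>. \<beta> \<in> {\<mu>'<..\<zeta>} \<Longrightarrow> int (w \<beta>) = int (v \<beta>) + d"
    using assms(2) unfolding eventually_parallel_def by blast
  have "int (z \<beta>) = int (v \<beta>) + (c + d)" if "\<beta> \<in> {max \<mu> \<mu>'<..\<zeta>}" for \<beta>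
    using \<mu>(2)[of \<beta>] \<mu>'(2)[of \<beta>] that by simp
  moreover have "max \<mu> \<mu>' < \<zeta>" using \<mu>(1) \<mu>'(1) by simp
  ultimately show ?thesis
    unfolding eventually_parallel_def by blast
qed

lemma eventually_parallel_if_eq:
  assumes "\<mu> < \<zeta>" "\<And>\<beta>. \<mu> < \<beta> \<Longrightarrow> \<beta> \<le> \<zeta> \<Longrightarrow> z \<beta> = w \<beta>"
  shows "eventually_parallel \<zeta> z w"
  unfolding eventually_parallel_def using assms by (intro exI[of _ 0] exI[of _ \<mu>]) auto

text \<open>
  The indicator function of a half-open interval is locally constant from the left, whether its ends
  are below, at or above \<open>\<zeta>\<close>.
\<close>

lemma eventually_parallel_if_step:
  assumes "\<mu> < \<zeta>" "\<And>\<beta>. \<mu> < \<beta> \<Longrightarrow> \<beta> \<le> \<zeta> \<Longrightarrow> z \<beta> = (if \<beta> \<in> {a<..b} then w \<beta> + 1 else w \<beta>)"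
  shows "eventually_parallel \<zeta> z w"
proof -
  define \<mu>' where "\<mu>' = max \<mu> (max (if a < \<zeta> then a else \<mu>) (if b < \<zeta> then b else \<mu>))"
  have "\<mu>' < \<zeta>" "\<mu> \<le> \<mu>'"
    using assms(1) by (simp_all add: \<mu>'_def)
  have same: "\<beta> \<in> {a<..b} \<longleftrightarrow> \<zeta> \<in> {a<..b}" if "\<mu>' < \<beta>" "\<beta> \<le> \<zeta>" for \<beta>
  proof -
    have "x < \<beta> \<longleftrightarrow> x < \<zeta>" if x: "x = a \<or> x = b" for x
    proof
      assume "x < \<beta>" then show "x < \<zeta>" using \<open>\<beta> \<le> \<zeta>\<close> by (rule less_le_trans)
    next
      assume "x < \<zeta>"
      then have "x \<le> \<mu>'" using x unfolding \<mu>'_def le_max_iff_disj by (elim disjE) simp_all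
      then show "x < \<beta>" using \<open>\<mu>' < \<beta>\<close> by (rule le_less_trans)
    qed
    then show ?thesis unfolding greaterThanAtMost_iff not_less[symmetric, of \<beta>] not_less[symmetric, of \<zeta>] by blast
  qed
  have "int (z \<beta>) = int (w \<beta>) + (if \<zeta> \<in> {a<..b} then 1 else 0)" if "\<beta> \<in> {\<mu>'<..\<zeta>}" for \<beta>
  proof -
    have \<beta>: "\<mu>' < \<beta>" "\<beta> \<le> \<zeta>" "\<mu> < \<beta>"
      using that \<open>\<mu> \<le> \<mu>'\<close> by auto
    then show ?thesis
      using assms(2)[OF \<beta>(3,2)] unfolding same[OF \<beta>(1,2)] by simp
  qed
  then show ?thesis
    unfolding eventually_parallel_def using \<open>\<mu>' < \<zeta>\<close> by blast
qed

text \<open>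
  By induction on \<open>\<gamma>\<close>: near \<open>\<zeta>\<close> the function \<open>z\<^sub>\<gamma>\<close> is an earlier \<open>z\<^sub>\<epsilon>\<close> with \<open>\<zeta> \<le> \<epsilon> < \<gamma>\<close>, up to the
  indicator function of a half-open interval.
\<close>

lemma zfun_coherent_self:
  assumes "ladder_system \<sigma>" "\<zeta> \<in> LimOrd" "\<zeta> \<le> \<gamma>"
  shows "eventually_parallel \<zeta> (zfun \<sigma> \<gamma>) (zfun \<sigma> \<zeta>)"
  using assms(3)
proof (induction \<gamma> rule: less_induct)
  case (less \<gamma>)
  note pos = LimOrd_pos[OF assms(2)]
  show ?case
  proof (cases "\<zeta> = \<gamma>")
    case True
    then show ?thesis using pos by (intro eventually_parallel_if_eq[of 0]) auto
  next
    case False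
    then have "\<zeta> < \<gamma>" using less.prems by simp
    show ?thesis
    proof (cases "\<gamma> \<in> LimOrd2")
      case True
      have \<gamma>: "\<gamma> \<in> LimOrd" using True by (rule LimOrd2_LimOrd)
      from delta_interval[OF assms(1) \<gamma> \<open>\<zeta> < \<gamma>\<close>]
      show ?thesis
      proof cases
        case 1
        have "eventually_parallel \<zeta> (zfun \<sigma> \<gamma>) (zfun \<sigma> (delta \<sigma> \<gamma> 0))"
          using pos zfun_limord2_init[OF assms(1) True] 1
          by (intro eventually_parallel_if_eq[of 0]) auto
        then show ?thesis
          using less.IH[OF delta_less[OF assms(1) \<gamma>] 1] eventually_parallel_trans by blast
      next
        case (2 n)
        have "eventually_parallel \<zeta> (zfun \<sigma> \<gamma>) (zfun \<sigma> (delta \<sigma> \<gamma> (Suc n)))"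
        proof (rule eventually_parallel_if_step[OF 2(1)])
          let ?\<epsilon> = "delta \<sigma> \<gamma> (Suc n)"
          let ?k = "LEAST k. delta \<sigma> \<gamma> n < \<sigma> ?\<epsilon> k"
          fix \<beta> assume "delta \<sigma> \<gamma> n < \<beta>" "\<beta> \<le> \<zeta>"
          then have "\<beta> \<in> {delta \<sigma> \<gamma> n<..?\<epsilon>}" using 2(2) by auto
          then show "zfun \<sigma> \<gamma> \<beta> = (if \<beta> \<in> {\<sigma> ?\<epsilon> ?k<..\<sigma> ?\<epsilon> (Suc ?k)}
              then zfun \<sigma> ?\<epsilon> \<beta> + 1 else zfun \<sigma> ?\<epsilon> \<beta>)"
            by (rule zfun_limord2_step[OF assms(1) True])
        qed
        then show ?thesis
          using less.IH[OF delta_less[OF assms(1) \<gamma>] 2(2)] eventually_parallel_trans by blast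
      qed
    next
      case False
      have "\<gamma> \<noteq> 0" using \<open>\<zeta> < \<gamma>\<close> pos by auto
      then obtain \<kappa> where \<kappa>: "\<kappa> \<in> insert 0 LimOrd" "\<kappa> < \<gamma>" "\<gamma> \<le> add_omega \<kappa>"
        using largest_limord_below False by blast
      have "\<zeta> \<le> \<kappa>"
        using between_notin_limord[of \<kappa> \<zeta>] assms(2) \<open>\<zeta> < \<gamma>\<close> \<kappa>(3) by (meson leI less_le_trans)
      have "eventually_parallel \<zeta> (zfun \<sigma> \<gamma>) (zfun \<sigma> \<kappa>)"
        using pos zfun_above_limord[OF \<kappa>] \<open>\<zeta> \<le> \<kappa>\<close> by (intro eventually_parallel_if_eq[of 0]) auto
      then show ?thesis
        using less.IH[OF \<kappa>(2) \<open>\<zeta> \<le> \<kappa>\<close>] eventually_parallel_trans by blast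
    qed
  qed
qed

lemma zfun_coherent:
  assumes "ladder_system \<sigma>" "\<zeta> \<in> LimOrd" "\<zeta> \<le> \<alpha>" "\<zeta> \<le> \<gamma>"
  shows "eventually_parallel \<zeta> (zfun \<sigma> \<alpha>) (zfun \<sigma> \<gamma>)"
  by (rule eventually_parallel_trans[OF zfun_coherent_self[OF assms(1-3)]
      eventually_parallel_sym[OF zfun_coherent_self[OF assms(1,2,4)]]])

text \<open>
  The combinatorial core. Walk from \<open>\<epsilon> = \<epsilon>\<^sub>0\<close> to \<open>\<alpha>\<close> by taking as \<open>\<epsilon>\<^sub>i\<^sub>+\<^sub>1\<close> the least element of \<open>D\<close> of \<open>\<epsilon>\<^sub>i\<close>
  that is not below \<open>\<alpha>\<close>, and let \<open>\<delta>\<^sub>i\<^sub>+\<^sub>1\<close> be its predecessor there. Since \<open>\<alpha>\<close> is a limit of limits,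
  \<open>\<delta>\<^sub>i\<^sub>+\<^sub>1\<close> is a rung of \<open>\<epsilon>\<^sub>i\<^sub>+\<^sub>1\<close>, so the \<open>\<delta>\<^sub>i\<close> never decrease and the last one is a rung \<open>\<sigma> \<alpha> k\<close> of \<open>\<alpha>\<close> itself. Each step
  adds the indicator function of an interval between rungs of \<open>\<epsilon>\<^sub>i\<^sub>+\<^sub>1\<close>. Before the last step there are no such
  rungs strictly between the next \<open>\<delta>\<close> and \<open>\<alpha>\<close>, so the indicator is constant on \<open>(\<sigma> \<alpha> k, \<alpha>]\<close>; the last step, where
  \<open>\<epsilon>\<^sub>i\<^sub>+\<^sub>1 = \<alpha>\<close>, contributes the visible jump.

  The bound on \<open>ladder_points \<sigma> \<epsilon>\<close> below \<open>\<alpha>\<close> makes the induction work and says that the jump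
  lies above the last rung of \<open>\<epsilon>\<close> below \<open>\<alpha>\<close>.
\<close>

lemma zfun_walk:
  assumes "ladder_system \<sigma>" "\<And>\<alpha>. \<alpha> \<in> LimOrd2 \<Longrightarrow> range (\<sigma> \<alpha>) \<subseteq> LimOrd"
    and "\<alpha> \<in> LimOrd2" "\<epsilon> \<in> LimOrd2" "\<alpha> < \<epsilon>" "delta \<sigma> \<epsilon> 0 < \<alpha>"
  shows "\<exists>k c. (\<forall>\<eta>\<in>ladder_points \<sigma> \<epsilon>. \<eta> < \<alpha> \<longrightarrow> \<eta> \<le> \<sigma> \<alpha> k) \<and>
    (\<forall>\<beta>\<in>{\<sigma> \<alpha> k<..\<alpha>}. zfun \<sigma> \<epsilon> \<beta> =
       zfun \<sigma> \<alpha> \<beta> + c + (if \<beta> \<in> {\<sigma> \<alpha> (Suc k)<..\<sigma> \<alpha> (Suc (Suc k))} then 1 else 0))"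
  using assms(4-6)
proof (induction \<epsilon> rule: less_induct)
  case (less \<epsilon>)
  have \<epsilon>: "\<epsilon> \<in> LimOrd" and \<alpha>: "\<alpha> \<in> LimOrd"
    using less.prems(1) assms(3) by (simp_all add: LimOrd2_LimOrd)
  note \<delta>_mono = delta_strict_mono[OF assms(1) \<epsilon>]
  note \<delta>_range = range_delta[OF assms(1) \<epsilon>]
  obtain n where n: "delta \<sigma> \<epsilon> n < \<alpha>" "\<alpha> \<le> delta \<sigma> \<epsilon> (Suc n)"
    using delta_interval[OF assms(1) \<epsilon> less.prems(2)] less.prems(3) by (metis leD)
  define \<delta> where "\<delta> = delta \<sigma> \<epsilon> n"
  define \<epsilon>' where "\<epsilon>' = delta \<sigma> \<epsilon> (Suc n)"
  have below: "\<eta> \<le> \<delta>" if \<eta>: "\<eta> \<in> ladder_points \<sigma> \<epsilon>" "\<eta> < \<epsilon>'" for \<eta>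
  proof -
    obtain i where i: "\<eta> = delta \<sigma> \<epsilon> i" using \<eta>(1) \<delta>_range by blast
    then have "i < Suc n" using \<eta>(2) strict_mono_less[OF \<delta>_mono] by (simp add: \<epsilon>'_def)
    then show ?thesis using strict_mono_less_eq[OF \<delta>_mono] by (simp add: i \<delta>_def)
  qed
  have "next_point \<sigma> \<delta> \<epsilon>'"
  proof (rule ladder_points_consecutive[OF assms(1,2) less.prems(1)])
    show "\<delta> \<in> ladder_points \<sigma> \<epsilon>" "\<epsilon>' \<in> ladder_points \<sigma> \<epsilon>"
      using \<delta>_range by (auto simp: \<delta>_def \<epsilon>'_def)
    show "\<delta> < \<epsilon>'" using n by (simp add: \<delta>_def \<epsilon>'_def)
    show "\<not> \<eta> < \<epsilon>'" if "\<eta> \<in> ladder_points \<sigma> \<epsilon>" "\<delta> < \<eta>" for \<eta>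
      using below that by (meson leD)
  qed
  moreover have "\<epsilon>' \<noteq> add_omega \<delta>"
    using between_notin_limord[of \<delta> \<alpha>] add_omega_notin_limord2[of \<delta>] n assms(3) \<alpha>
    by (auto simp: \<delta>_def \<epsilon>'_def order.order_iff_strict)
  ultimately obtain j where \<epsilon>': "\<epsilon>' \<in> LimOrd2" and j: "\<delta> = \<sigma> \<epsilon>' j"
    by (auto simp: next_point_def)
  note mono' = ladder_strict_mono[OF assms(1) LimOrd2_LimOrd[OF \<epsilon>']]
  \<comment> \<open>As \<open>\<delta>\<close> is itself the rung number \<open>j\<close> of \<open>\<epsilon>'\<close>, the jump at this step is one interval further up.\<close>
  have "(LEAST k. \<delta> < \<sigma> \<epsilon>' k) = Suc j"
    using strict_mono_less[OF mono'] by (intro Least_equality) (auto simp: j)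
  then have z: "zfun \<sigma> \<epsilon> \<beta> = zfun \<sigma> \<epsilon>' \<beta> + (if \<beta> \<in> {\<sigma> \<epsilon>' (Suc j)<..\<sigma> \<epsilon>' (Suc (Suc j))} then 1 else 0)"
    if "\<beta> \<in> {\<delta><..\<epsilon>'}" for \<beta>
    using zfun_limord2_step[OF assms(1) less.prems(1), of \<beta> n] that
    by (simp add: \<delta>_def[symmetric] \<epsilon>'_def[symmetric])
  have sub: "\<sigma> \<epsilon>' i \<in> ladder_points \<sigma> \<epsilon>'" for i
    by (simp add: ladder_points_def)
  show ?case
  proof (cases "\<alpha> = \<epsilon>'")
    case True
    then show ?thesis
      using below z j by (intro exI[of _ j] exI[of _ 0]) auto
  next
    case False
    then have "\<alpha> < \<epsilon>'" using n by (simp add: \<epsilon>'_def)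
    have "delta \<sigma> \<epsilon>' 0 \<le> \<delta>"
      using range_delta[OF assms(1) LimOrd2_LimOrd[OF \<epsilon>']] sub[of j]
        strict_mono_less_eq[OF delta_strict_mono[OF assms(1) LimOrd2_LimOrd[OF \<epsilon>']]]
      unfolding j by (metis imageE le0)
    then have "delta \<sigma> \<epsilon>' 0 < \<alpha>" using n(1) by (simp add: \<delta>_def)
    then obtain k c where k: "\<forall>\<eta>\<in>ladder_points \<sigma> \<epsilon>'. \<eta> < \<alpha> \<longrightarrow> \<eta> \<le> \<sigma> \<alpha> k"
      and c: "\<And>\<beta>. \<beta> \<in> {\<sigma> \<alpha> k<..\<alpha>} \<Longrightarrow> zfun \<sigma> \<epsilon>' \<beta> =
        zfun \<sigma> \<alpha> \<beta> + c + (if \<beta> \<in> {\<sigma> \<alpha> (Suc k)<..\<sigma> \<alpha> (Suc (Suc k))} then 1 else 0)"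
      using less.IH[of \<epsilon>'] \<epsilon>' \<open>\<alpha> < \<epsilon>'\<close> delta_less[OF assms(1) \<epsilon>, of "Suc n"]
      unfolding \<epsilon>'_def[symmetric] by blast
    have "\<delta> \<le> \<sigma> \<alpha> k"
      using k sub[of j] n(1) j by (simp add: \<delta>_def)
    \<comment> \<open>No rung of \<open>\<epsilon>'\<close> separates points of \<open>(\<sigma> \<alpha> k, \<alpha>]\<close>, so the jump of this step is constant there.\<close>
    have side: "\<sigma> \<epsilon>' i \<le> \<sigma> \<alpha> k \<or> \<alpha> \<le> \<sigma> \<epsilon>' i" for i
      using k sub[of i] by (meson not_le)
    have const: "\<beta> \<in> {\<sigma> \<epsilon>' (Suc j)<..\<sigma> \<epsilon>' (Suc (Suc j))} \<longleftrightarrow> \<alpha> \<in> {\<sigma> \<epsilon>' (Suc j)<..\<sigma> \<epsilon>' (Suc (Suc j))}"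
      if "\<beta> \<in> {\<sigma> \<alpha> k<..\<alpha>}" for \<beta>
      using that side[of "Suc j"] side[of "Suc (Suc j)"] by auto
    let ?c = "c + (if \<alpha> \<in> {\<sigma> \<epsilon>' (Suc j)<..\<sigma> \<epsilon>' (Suc (Suc j))} then 1 else 0)"
    have "zfun \<sigma> \<epsilon> \<beta> = zfun \<sigma> \<alpha> \<beta> + ?c +
        (if \<beta> \<in> {\<sigma> \<alpha> (Suc k)<..\<sigma> \<alpha> (Suc (Suc k))} then 1 else 0)"
      if \<beta>: "\<beta> \<in> {\<sigma> \<alpha> k<..\<alpha>}" for \<beta>
    proof -
      have "\<beta> \<in> {\<delta><..\<epsilon>'}" using \<beta> \<open>\<delta> \<le> \<sigma> \<alpha> k\<close> \<open>\<alpha> < \<epsilon>'\<close> by auto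
      then show ?thesis using z c[OF \<beta>] const[OF \<beta>] by simp
    qed
    moreover have "\<forall>\<eta>\<in>ladder_points \<sigma> \<epsilon>. \<eta> < \<alpha> \<longrightarrow> \<eta> \<le> \<sigma> \<alpha> k"
      using below \<open>\<delta> \<le> \<sigma> \<alpha> k\<close> \<open>\<alpha> < \<epsilon>'\<close> by (meson order.strict_trans order.trans)
    ultimately show ?thesis by blast
  qed
qed

section \<open>Topology of the circle and of the long ray\<close>

lemma circle_of_eq_iff: "circle_of x = circle_of y \<longleftrightarrow> (\<exists>k::int. x - y = 2 * pi * of_int k)"
  by (rule circle.abs_eq_iff)

lemma circle_of_cases: obtains x where "\<phi> = circle_of x"
proof -
  have "\<exists>x. \<phi> = circle_of x"
    by (induction \<phi> rule: circle.abs_induct) blast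
  then show thesis using that by blast
qed

lemma circle_of_add: "circle_of x + circle_of y = circle_of (x + y)"
  by (rule plus_circle.abs_eq)

lemma circle_of_uminus: "- circle_of x = circle_of (- x)"
  by (rule uminus_circle.abs_eq)

lemma circle_of_diff: "circle_of x - circle_of y = circle_of (x - y)"
  by (simp add: minus_circle_def circle_of_uminus circle_of_add)

lemma circle_of_zero: "circle_of 0 = 0"
  by (rule zero_circle.abs_eq[symmetric])

lemma continuous_on_circle_of [continuous_intros]:
  assumes "continuous_on S f"
  shows "continuous_on S (\<lambda>x. circle_of (f x))"
proof -
  have "continuous_on UNIV circle_of"
    by (auto simp: continuous_on_open_vimage open_circle_def)
  then show ?thesis
    using continuous_on_compose2[OF _ assms, of UNIV circle_of] by simp
qed

text \<open>
  The saturation of an open set is a union of translates.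
\<close>

lemma open_circle_of_image:
  assumes "open U"
  shows "open (circle_of ` U)"
proof -
  have "circle_of -` circle_of ` U = (\<Union>k::int. (\<lambda>x. x + 2 * pi * of_int k) ` U)"
  proof (intro equalityI subsetI)
    fix x assume "x \<in> circle_of -` circle_of ` U"
    then obtain u k where "u \<in> U" "x - u = 2 * pi * of_int k"
      by (auto simp: circle_of_eq_iff)
    then show "x \<in> (\<Union>k::int. (\<lambda>x. x + 2 * pi * of_int k) ` U)"
      by (intro UN_I[of k] UNIV_I image_eqI[of _ _ u]) simp_all
  next
    fix x assume "x \<in> (\<Union>k::int. (\<lambda>x. x + 2 * pi * of_int k) ` U)"
    then obtain u k where "u \<in> U" "x = u + 2 * pi * of_int k" by blast
    then have "u \<in> U" "circle_of x = circle_of u"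
      unfolding circle_of_eq_iff by simp_all
    then show "x \<in> circle_of -` circle_of ` U" by simp
  qed
  moreover have "open ((\<lambda>x. x + 2 * pi * of_int k) ` U)" for k :: int
    using open_translation[OF assms, of "2 * pi * of_int k"] by (simp add: add.commute)
  ultimately show ?thesis
    unfolding open_circle_def by auto
qed

lemma ex_shift_into_period: "\<exists>k::int. x + 2 * pi * of_int k \<in> {0..2 * pi}"
proof -
  define k where "k = \<lfloor>x / (2 * pi)\<rfloor>"
  have "of_int k \<le> x / (2 * pi)" "x / (2 * pi) < of_int k + 1"
    unfolding k_def by linarith+
  then have "x + 2 * pi * of_int (- k) \<in> {0..2 * pi}"
    by (simp add: field_simps)
  then show ?thesis ..
qed

lemma compact_UNIV_circle: "compact (UNIV :: circle set)"
proof -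
  have "\<exists>y\<in>{0..2 * pi}. circle_of x = circle_of y" for x
  proof -
    obtain k :: int where "x + 2 * pi * of_int k \<in> {0..2 * pi}"
      using ex_shift_into_period by blast
    moreover have "circle_of x = circle_of (x + 2 * pi * of_int k)"
      unfolding circle_of_eq_iff by (intro exI[of _ "- k"]) simp
    ultimately show ?thesis by blast
  qed
  then have "UNIV = circle_of ` {0..2 * pi}"
    by (metis (mono_tags, lifting) UNIV_eq_I circle_of_cases imageI)
  then show ?thesis
    using compact_continuous_image[OF continuous_on_circle_of[OF continuous_on_id], of "{0..2*pi}"] by simp
qed

lemma eventually_nhds_circle_of:
  assumes "eventually P (nhds x)"
  shows "eventually (\<lambda>\<phi>. \<exists>y. P y \<and> \<phi> = circle_of y) (nhds (circle_of x))"
proof -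
  obtain U where "open U" "x \<in> U" "\<forall>y\<in>U. P y"
    using assms unfolding eventually_nhds by blast
  then show ?thesis
    unfolding eventually_nhds using open_circle_of_image[of U] by blast
qed

text \<open>
  The group operations are continuous because the quotient map is open, so that neighbourhoods can
  be lifted to the reals and pushed down again.
\<close>

instance circle :: topological_group_add
proof
  fix a b :: circle
  obtain x y where xy: "a = circle_of x" "b = circle_of y"
    by (metis circle_of_cases)
  show "((\<lambda>x. fst x + snd x) \<longlongrightarrow> a + b) (nhds a \<times>\<^sub>F nhds b)"
  proof (rule topological_tendstoI)
    fix W assume W: "open W" "a + b \<in> W"
    have "\<forall>\<^sub>F p in nhds x \<times>\<^sub>F nhds y. fst p + snd p \<in> circle_of -` W"
      using tendsto_add_Pair[of x y] W by (intro topological_tendstoD) (auto simp: open_circle_def xy circle_of_add)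
    then obtain P Q where PQ: "eventually P (nhds x)" "eventually Q (nhds y)"
      "\<And>s t. P s \<Longrightarrow> Q t \<Longrightarrow> circle_of (s + t) \<in> W"
      unfolding eventually_prod_filter by auto
    show "\<forall>\<^sub>F p in nhds a \<times>\<^sub>F nhds b. fst p + snd p \<in> W"
      unfolding eventually_prod_filter xy
      using eventually_nhds_circle_of[OF PQ(1)] eventually_nhds_circle_of[OF PQ(2)] PQ(3)
      by (intro exI conjI) (auto simp: circle_of_add)
  qed
  show "(uminus \<longlongrightarrow> - a) (nhds a)"
  proof (rule topological_tendstoI)
    fix W assume W: "open W" "- a \<in> W"
    have "\<forall>\<^sub>F s in nhds x. - s \<in> circle_of -` W"
      using tendsto_uminus_nhds[of x] W by (intro topological_tendstoD) (auto simp: open_circle_def xy circle_of_uminus)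
    from eventually_nhds_circle_of[OF this] show "\<forall>\<^sub>F \<phi> in nhds a. - \<phi> \<in> W"
      unfolding xy by eventually_elim (auto simp: circle_of_uminus)
  qed
qed

definition ray_base :: "long_ray \<Rightarrow> omega1" where
  "ray_base p = fst (Rep_long_ray p)"

definition ray_frac :: "long_ray \<Rightarrow> real" where
  "ray_frac p = snd (Rep_long_ray p)"

definition ray_point :: "omega1 \<Rightarrow> real \<Rightarrow> long_ray" where
  "ray_point \<beta> r = Abs_long_ray (\<beta>, r)"

lemma ray_frac_bounds: "0 \<le> ray_frac p" "ray_frac p < 1" "ray_base p = 0 \<Longrightarrow> 0 < ray_frac p"
  using Rep_long_ray[of p] by (auto simp: ray_frac_def ray_base_def order.order_iff_strict prod_eq_iff)

lemma ray_point_simps: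
  assumes "0 \<le> r" "r < 1" "\<beta> \<noteq> 0 \<or> r \<noteq> 0"
  shows "ray_base (ray_point \<beta> r) = \<beta>" "ray_frac (ray_point \<beta> r) = r"
  using assms by (auto simp: ray_base_def ray_frac_def ray_point_def Abs_long_ray_inverse)

lemma ray_eqI: "ray_base p = ray_base q \<Longrightarrow> ray_frac p = ray_frac q \<Longrightarrow> p = q"
  by (metis Rep_long_ray_inject prod_eqI ray_base_def ray_frac_def)

lemma ray_less_iff: "p < q \<longleftrightarrow> ray_base p < ray_base q \<or> ray_base p = ray_base q \<and> ray_frac p < ray_frac q"
  unfolding less_long_ray_def less_eq_long_ray_def ray_base_def ray_frac_def by auto

lemma ray_le_iff: "p \<le> q \<longleftrightarrow> ray_base p < ray_base q \<or> ray_base p = ray_base q \<and> ray_frac p \<le> ray_frac q"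
  unfolding less_eq_long_ray_def ray_base_def ray_frac_def by auto

lemma ord_point_simps:
  assumes "\<alpha> \<noteq> 0"
  shows "ray_base (ord_point \<alpha>) = \<alpha>" "ray_frac (ord_point \<alpha>) = 0"
  using ray_point_simps[of 0 \<alpha>] assms by (simp_all add: ord_point_def ray_point_def)

lemma succ_omega1_nonzero [simp]: "succ_omega1 \<alpha> \<noteq> 0"
  using less_succ_omega1[of \<alpha>] zero_le_omega1[of \<alpha>] by auto

lemma less_ord_point_iff: "\<alpha> \<noteq> 0 \<Longrightarrow> p < ord_point \<alpha> \<longleftrightarrow> ray_base p < \<alpha>"
  using ray_frac_bounds(1)[of p] by (auto simp: ray_less_iff ord_point_simps)

lemma less_ord_point_succ_iff: "p < ord_point (succ_omega1 \<alpha>) \<longleftrightarrow> ray_base p \<le> \<alpha>"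
  by (simp add: less_ord_point_iff less_succ_omega1_iff)

definition interpolate :: "(omega1 \<Rightarrow> real) \<Rightarrow> long_ray \<Rightarrow> real" where
  "interpolate d p = (1 - ray_frac p) * d (ray_base p) + ray_frac p * d (succ_omega1 (ray_base p))"

lemma abs_mult_less_if_less_divide:
  fixes h D e :: real
  assumes "\<bar>h\<bar> < e / (\<bar>D\<bar> + 1)"
  shows "\<bar>h * D\<bar> < e"
proof -
  have "\<bar>h\<bar> * (\<bar>D\<bar> + 1) < e"
    using assms by (simp add: pos_less_divide_eq)
  then show ?thesis
    by (simp add: abs_mult distrib_left)
qed

text \<open>
  A limit ordinal is the only kind of point where infinitely many linear pieces accumulate, and they
  accumulate from the left only; there \<open>d\<close> is assumed to be locally constant.
\<close>

lemma isCont_interpolate: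
  assumes "ray_base p \<in> LimOrd \<Longrightarrow> \<exists>c. \<exists>\<mu><ray_base p. \<forall>\<beta>\<in>{\<mu><..ray_base p}. d \<beta> = c"
  shows "isCont (interpolate d) p"
  unfolding continuous_at_split unfolding continuous_within
proof
  let ?G = "interpolate d"
  define \<beta> where "\<beta> = ray_base p"
  define r where "r = ray_frac p"
  have r: "0 \<le> r" "r < 1"
    using ray_frac_bounds[of p] by (simp_all add: r_def)
  have Gp: "?G p = (1 - r) * d \<beta> + r * d (succ_omega1 \<beta>)"
    by (simp add: r_def \<beta>_def interpolate_def)
  define D where "D = d (succ_omega1 \<beta>) - d \<beta>"
  have Gy: "?G y - ?G p = (ray_frac y - r) * D" if "ray_base y = \<beta>" for y
    unfolding Gp unfolding interpolate_def that D_def by (simp add: algebra_simps)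
  show "(?G \<longlongrightarrow> ?G p) (at_right p)"
  proof (rule tendstoI)
    fix e :: real assume "0 < e"
    define r' where "r' = min ((r + 1) / 2) (r + e / (\<bar>D\<bar> + 1))"
    have r': "r < r'" "r' < 1" "r' \<le> r + e / (\<bar>D\<bar> + 1)"
      using r \<open>0 < e\<close> by (simp_all add: r'_def min_less_iff_disj add_pos_nonneg)
    define q where "q = ray_point \<beta> r'"
    have q: "ray_base q = \<beta>" "ray_frac q = r'"
      using r' r by (simp_all add: q_def ray_point_simps)
    have "p < q" using q r' by (simp add: ray_less_iff r_def \<beta>_def)
    moreover have "dist (?G y) (?G p) < e" if "p < y" "y < q" for y
    proof -
      have y: "ray_base y = \<beta>" "r < ray_frac y" "ray_frac y < r'"
        using that q unfolding ray_less_iff r_def \<beta>_def by auto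
      then show ?thesis
        unfolding dist_real_def Gy[OF y(1)] using r' by (intro abs_mult_less_if_less_divide) simp
    qed
    ultimately show "\<forall>\<^sub>F y in at_right p. dist (?G y) (?G p) < e"
      unfolding eventually_at_right[OF \<open>p < q\<close>] by blast
  qed
  show "(?G \<longlongrightarrow> ?G p) (at_left p)"
  proof (rule tendstoI)
    fix e :: real assume "0 < e"
    have "\<exists>q<p. \<forall>y. q < y \<longrightarrow> y < p \<longrightarrow> dist (?G y) (?G p) < e"
    proof (cases "r = 0")
      case False
      define r' where "r' = max (r / 2) (r - e / (\<bar>D\<bar> + 1))"
      have r': "r' < r" "0 < r'" "r - e / (\<bar>D\<bar> + 1) \<le> r'"
        using r False \<open>0 < e\<close> by (simp_all add: r'_def less_max_iff_disj add_pos_nonneg)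
      define q where "q = ray_point \<beta> r'"
      have q: "ray_base q = \<beta>" "ray_frac q = r'"
        using r' r by (simp_all add: q_def ray_point_simps)
      have "q < p" using q r' by (simp add: ray_less_iff r_def \<beta>_def)
      moreover have "dist (?G y) (?G p) < e" if "q < y" "y < p" for y
      proof -
        have y: "ray_base y = \<beta>" "ray_frac y < r" "r' < ray_frac y"
          using that q unfolding ray_less_iff r_def \<beta>_def by auto
        then show ?thesis
          unfolding dist_real_def Gy[OF y(1)] using r' by (intro abs_mult_less_if_less_divide) simp
      qed
      ultimately show ?thesis by blast
    next
      case True
      then have "\<beta> \<noteq> 0" using ray_frac_bounds(3)[of p] by (auto simp: r_def \<beta>_def)
      then consider (lim) "\<beta> \<in> LimOrd" | (succ) \<gamma> where "\<beta> = succ_omega1 \<gamma>"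
        using succ_or_limit by blast
      then show ?thesis
      proof cases
        case lim
        then obtain c \<mu> where \<mu>: "\<mu> < \<beta>" "\<And>\<xi>. \<xi> \<in> {\<mu><..\<beta>} \<Longrightarrow> d \<xi> = c"
          using assms unfolding \<beta>_def by blast
        obtain \<mu>' where \<mu>': "\<mu> < \<mu>'" "\<mu>' < \<beta>"
          using lim \<mu>(1) unfolding LimOrd_def by blast
        then have "\<mu>' \<noteq> 0" using zero_le_omega1[of \<mu>] by auto
        have "ord_point \<mu>' < p"
          using \<mu>' \<open>\<mu>' \<noteq> 0\<close> by (simp add: ray_less_iff ord_point_simps \<beta>_def)
        moreover have "?G y = ?G p" if "ord_point \<mu>' < y" "y < p" for y
        proof -
          have "\<mu>' \<le> ray_base y" "ray_base y < \<beta>"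
            using that \<open>\<mu>' \<noteq> 0\<close> True ray_frac_bounds(1)[of y]
            by (auto simp: ray_less_iff ord_point_simps r_def \<beta>_def)
          then have "d (ray_base y) = c" "d (succ_omega1 (ray_base y)) = c" "d \<beta> = c"
            using \<mu> \<mu>' less_succ_omega1[of "ray_base y"] succ_omega1_le[of "ray_base y" \<beta>]
            by (auto intro!: \<mu>(2))
          then show ?thesis
            unfolding Gp True by (simp add: interpolate_def algebra_simps)
        qed
        ultimately show ?thesis using \<open>0 < e\<close> by (metis dist_self)
      next
        case succ
        define E where "E = d \<beta> - d \<gamma>"
        define r' where "r' = max (1 / 2) (1 - e / (\<bar>E\<bar> + 1))"
        have r': "r' < 1" "0 < r'" "1 - e / (\<bar>E\<bar> + 1) \<le> r'"
          using \<open>0 < e\<close> by (simp_all add: r'_def less_max_iff_disj add_pos_nonneg)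
        define q where "q = ray_point \<gamma> r'"
        have q: "ray_base q = \<gamma>" "ray_frac q = r'"
          using r' r by (simp_all add: q_def ray_point_simps)
        have "q < p" using q less_succ_omega1[of \<gamma>] by (simp add: ray_less_iff \<beta>_def[symmetric] succ)
        moreover have "dist (?G y) (?G p) < e" if "q < y" "y < p" for y
        proof -
          have "ray_base y \<le> \<gamma>"
            using that(2) ray_frac_bounds(1)[of y] True
            by (auto simp: ray_less_iff \<beta>_def[symmetric] r_def[symmetric] succ less_succ_omega1_iff)
          then have y: "ray_base y = \<gamma>" "r' < ray_frac y"
            using that(1) q by (auto simp: ray_less_iff)
          have "?G y - ?G p = (ray_frac y - 1) * E"
            unfolding Gp unfolding True interpolate_def y(1) E_def succ by (simp add: algebra_simps)
          then show ?thesis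
            unfolding dist_real_def using r' y(2) ray_frac_bounds(2)[of y]
            by (simp only:) (intro abs_mult_less_if_less_divide, simp)
        qed
        ultimately show ?thesis by blast
      qed
    qed
    then obtain q where "q < p" "\<forall>y. q < y \<longrightarrow> y < p \<longrightarrow> dist (?G y) (?G p) < e" by blast
    then show "\<forall>\<^sub>F y in at_left p. dist (?G y) (?G p) < e"
      unfolding eventually_at_left[OF \<open>q < p\<close>] by blast
  qed
qed

section \<open>The bundle of a ladder system is principal\<close>

lemma arc_angle_eq: "arc_angle \<sigma> \<theta> \<alpha> p = circle_of (\<theta> * interpolate (\<lambda>\<beta>. real (zfun \<sigma> \<alpha> \<beta>)) p)"
  by (simp add: arc_angle_def interpolate_def ray_base_def ray_frac_def case_prod_beta)

lemma arc_angle_ord_point: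
  "\<beta> \<noteq> 0 \<Longrightarrow> arc_angle \<sigma> \<theta> \<alpha> (ord_point \<beta>) = circle_of (\<theta> * real (zfun \<sigma> \<alpha> \<beta>))"
  by (simp add: arc_angle_eq interpolate_def ord_point_simps)

text \<open>
  Each \<open>a\<^sub>\<alpha>\<close> may be discontinuous at limits, but interpolation commutes with differences, and the
  difference of the \<open>z\<close>-functions is locally constant at limits by coherence.
\<close>

lemma continuous_on_arc_angle_diff:
  assumes "ladder_system \<sigma>"
  shows "continuous_on {p. ray_base p \<le> \<alpha> \<and> ray_base p \<le> \<gamma>} (\<lambda>p. arc_angle \<sigma> \<theta> \<alpha> p - arc_angle \<sigma> \<theta> \<gamma> p)"
proof -
  let ?d = "\<lambda>\<beta>. real (zfun \<sigma> \<alpha> \<beta>) - real (zfun \<sigma> \<gamma> \<beta>)"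
  have "isCont (interpolate ?d) p" if p: "ray_base p \<le> \<alpha>" "ray_base p \<le> \<gamma>" for p
  proof (rule isCont_interpolate)
    assume "ray_base p \<in> LimOrd"
    then obtain c \<mu> where \<mu>: "\<mu> < ray_base p"
      "\<And>\<beta>. \<beta> \<in> {\<mu><..ray_base p} \<Longrightarrow> int (zfun \<sigma> \<alpha> \<beta>) = int (zfun \<sigma> \<gamma> \<beta>) + c"
      using zfun_coherent[OF assms _ p] unfolding eventually_parallel_def by blast
    have "?d \<beta> = of_int c" if "\<beta> \<in> {\<mu><..ray_base p}" for \<beta>
      using arg_cong[OF \<mu>(2)[OF that], of real_of_int] by simp
    then show "\<exists>c. \<exists>\<mu><ray_base p. \<forall>\<beta>\<in>{\<mu><..ray_base p}. ?d \<beta> = c"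
      using \<mu>(1) by blast
  qed
  then have "continuous_on {p. ray_base p \<le> \<alpha> \<and> ray_base p \<le> \<gamma>} (interpolate ?d)"
    by (intro continuous_at_imp_continuous_on) simp
  then have "continuous_on {p. ray_base p \<le> \<alpha> \<and> ray_base p \<le> \<gamma>} (\<lambda>p. circle_of (\<theta> * interpolate ?d p))"
    by (intro continuous_intros)
  moreover have "arc_angle \<sigma> \<theta> \<alpha> p - arc_angle \<sigma> \<theta> \<gamma> p = circle_of (\<theta> * interpolate ?d p)" for p
    by (simp add: arc_angle_eq circle_of_diff interpolate_def algebra_simps)
  ultimately show ?thesis by simp
qed

lemma mem_strip_iff: "x \<in> strip \<alpha> \<longleftrightarrow> ray_base (fst x) \<le> \<alpha>"
  by (cases x) (simp add: strip_def less_ord_point_succ_iff)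

lemma open_strip: "open (strip \<alpha>)"
  unfolding strip_def by (intro open_Times) auto

definition untwist ::
  "(omega1 \<Rightarrow> nat \<Rightarrow> omega1) \<Rightarrow> real \<Rightarrow> omega1 \<Rightarrow> long_ray \<times> circle \<Rightarrow> long_ray \<times> circle" where
  "untwist \<sigma> \<theta> \<alpha> = (\<lambda>(p, \<phi>). (p, \<phi> - arc_angle \<sigma> \<theta> \<alpha> p))"

lemma twist_untwist [simp]: "twist \<sigma> \<theta> \<alpha> (untwist \<sigma> \<theta> \<alpha> x) = x" "untwist \<sigma> \<theta> \<alpha> (twist \<sigma> \<theta> \<alpha> x) = x"
  by (simp_all add: twist_def untwist_def case_prod_beta)

lemma fst_twist [simp]: "fst (twist \<sigma> \<theta> \<alpha> x) = fst x" "fst (untwist \<sigma> \<theta> \<alpha> x) = fst x"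
  by (simp_all add: twist_def untwist_def case_prod_beta)

lemma twist_in_strip [simp]:
  "twist \<sigma> \<theta> \<alpha> x \<in> strip \<gamma> \<longleftrightarrow> x \<in> strip \<gamma>" "untwist \<sigma> \<theta> \<alpha> x \<in> strip \<gamma> \<longleftrightarrow> x \<in> strip \<gamma>"
  by (simp_all add: mem_strip_iff)

lemma twist_image_eq: "twist \<sigma> \<theta> \<alpha> ` U = untwist \<sigma> \<theta> \<alpha> -` U"
  by (auto intro!: image_eqI[of _ _ "untwist \<sigma> \<theta> \<alpha> x" for x])

lemma continuous_on_transition:
  assumes "ladder_system \<sigma>"
  shows "continuous_on (strip \<alpha> \<inter> strip \<gamma>) (\<lambda>x. untwist \<sigma> \<theta> \<gamma> (twist \<sigma> \<theta> \<alpha> x))"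
proof -
  have "continuous_on (strip \<alpha> \<inter> strip \<gamma>) (\<lambda>x. arc_angle \<sigma> \<theta> \<alpha> (fst x) - arc_angle \<sigma> \<theta> \<gamma> (fst x))"
    by (rule continuous_on_compose2[OF continuous_on_arc_angle_diff[OF assms]])
      (auto simp: mem_strip_iff intro: continuous_intros)
  then have "continuous_on (strip \<alpha> \<inter> strip \<gamma>)
      (\<lambda>x. (fst x, (arc_angle \<sigma> \<theta> \<alpha> (fst x) - arc_angle \<sigma> \<theta> \<gamma> (fst x)) + snd x))"
    by (rule continuous_on_Pair[OF continuous_on_fst[OF continuous_on_id]
          continuous_on_add[OF _ continuous_on_snd[OF continuous_on_id]]])
  then show ?thesis
    by (simp add: untwist_def twist_def case_prod_beta algebra_simps)
qed

text \<open>
  The workhorse for this topology: a set is open iff it is open in every strip. Open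
  images in one strip are open in another one as the transition maps are continuous.
\<close>

lemma openin_ladder_bundle:
  assumes "ladder_system \<sigma>"
  shows "openin (total_space (ladder_bundle \<sigma> \<theta>)) U \<longleftrightarrow> (\<forall>\<alpha>. open (strip \<alpha> \<inter> twist \<sigma> \<theta> \<alpha> -` U))"
proof
  assume "openin (total_space (ladder_bundle \<sigma> \<theta>)) U"
  then have "generate_topology_on (\<Union>\<alpha>. strip_opens \<sigma> \<theta> \<alpha>) U"
    by (simp add: ladder_bundle_def openin_topology_generated_by_iff)
  then show "\<forall>\<alpha>. open (strip \<alpha> \<inter> twist \<sigma> \<theta> \<alpha> -` U)"
  proof induction
    case (Int a b)
    have "strip \<alpha> \<inter> twist \<sigma> \<theta> \<alpha> -` (a \<inter> b) = (strip \<alpha> \<inter> twist \<sigma> \<theta> \<alpha> -` a) \<inter> (strip \<alpha> \<inter> twist \<sigma> \<theta> \<alpha> -` b)" for \<alpha>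
      by auto
    then show ?case using Int by (simp add: open_Int)
  next
    case (UN K)
    have "strip \<alpha> \<inter> twist \<sigma> \<theta> \<alpha> -` \<Union>K = (\<Union>k\<in>K. strip \<alpha> \<inter> twist \<sigma> \<theta> \<alpha> -` k)" for \<alpha>
      by auto
    moreover have "open (\<Union>k\<in>K. strip \<alpha> \<inter> twist \<sigma> \<theta> \<alpha> -` k)" for \<alpha>
      using UN by (intro open_UN) blast
    ultimately show ?case by (simp only:) blast
  next
    case (Basis s)
    then obtain \<gamma> V where s: "s = twist \<sigma> \<theta> \<gamma> ` V" and V: "openin (top_of_set (strip \<gamma>)) V"
      by (auto simp: strip_opens_def)
    then have V': "open V" "V \<subseteq> strip \<gamma>"
      using openin_open_eq[OF open_strip] by auto
    show ?case
    proof
      fix \<alpha>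
      let ?g = "\<lambda>x. untwist \<sigma> \<theta> \<gamma> (twist \<sigma> \<theta> \<alpha> x)"
      have "x \<in> strip \<gamma>" if "?g x \<in> V" for x
        using subsetD[OF V'(2) that] by simp
      then have "strip \<alpha> \<inter> twist \<sigma> \<theta> \<alpha> -` s = (strip \<alpha> \<inter> strip \<gamma>) \<inter> ?g -` V"
        unfolding s twist_image_eq by blast
      moreover have "open ((strip \<alpha> \<inter> strip \<gamma>) \<inter> ?g -` V)"
        using continuous_on_open_vimage[of "strip \<alpha> \<inter> strip \<gamma>" ?g] continuous_on_transition[OF assms]
          open_strip V'(1) by (metis Int_commute open_Int)
      ultimately show "open (strip \<alpha> \<inter> twist \<sigma> \<theta> \<alpha> -` s)" by simp
    qed
  qed simp
next
  assume op: "\<forall>\<alpha>. open (strip \<alpha> \<inter> twist \<sigma> \<theta> \<alpha> -` U)"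
  let ?V = "\<lambda>\<alpha>. twist \<sigma> \<theta> \<alpha> ` (strip \<alpha> \<inter> twist \<sigma> \<theta> \<alpha> -` U)"
  have "openin (total_space (ladder_bundle \<sigma> \<theta>)) (?V \<alpha>)" for \<alpha>
  proof -
    have "openin (top_of_set (strip \<alpha>)) (strip \<alpha> \<inter> twist \<sigma> \<theta> \<alpha> -` U)"
      using op openin_open_eq[OF open_strip] by blast
    then have "?V \<alpha> \<in> strip_opens \<sigma> \<theta> \<alpha>"
      unfolding strip_opens_def by blast
    then show ?thesis
      unfolding ladder_bundle_def by (auto intro: topology_generated_by_Basis)
  qed
  then have "openin (total_space (ladder_bundle \<sigma> \<theta>)) (\<Union>\<alpha>. ?V \<alpha>)" by blast
  moreover have "(\<Union>\<alpha>. ?V \<alpha>) = U"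
  proof (intro equalityI subsetI)
    fix x assume "x \<in> U"
    then have "x \<in> ?V (ray_base (fst x))"
      unfolding twist_image_eq by (simp add: mem_strip_iff)
    then show "x \<in> (\<Union>\<alpha>. ?V \<alpha>)" by blast
  qed auto
  ultimately show "openin (total_space (ladder_bundle \<sigma> \<theta>)) U" by simp
qed

lemma topspace_ladder_bundle:
  assumes "ladder_system \<sigma>"
  shows "topspace (total_space (ladder_bundle \<sigma> \<theta>)) = UNIV"
proof -
  have "openin (total_space (ladder_bundle \<sigma> \<theta>)) UNIV"
    unfolding openin_ladder_bundle[OF assms] by (simp add: open_strip)
  then show ?thesis
    by (metis openin_subset top.extremum_uniqueI)
qed

lemma over_ladder_bundle:
  assumes "ladder_system \<sigma>"
  shows "over (ladder_bundle \<sigma> \<theta>) A = A \<times> UNIV"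
  unfolding over_def topspace_ladder_bundle[OF assms] by (auto simp: ladder_bundle_def)

lemma closedin_ladder_bundle:
  assumes "ladder_system \<sigma>"
  shows "closedin (total_space (ladder_bundle \<sigma> \<theta>)) F \<longleftrightarrow> (\<forall>\<alpha>. open (strip \<alpha> - twist \<sigma> \<theta> \<alpha> -` F))"
proof -
  have "strip \<alpha> \<inter> twist \<sigma> \<theta> \<alpha> -` (- F) = strip \<alpha> - twist \<sigma> \<theta> \<alpha> -` F" for \<alpha> by auto
  then show ?thesis
    unfolding closedin_def topspace_ladder_bundle[OF assms]
    by (simp add: Compl_eq_Diff_UNIV[symmetric] openin_ladder_bundle[OF assms])
qed

lemma openin_twist_image:
  assumes "ladder_system \<sigma>" "open V" "V \<subseteq> strip \<alpha>"
  shows "openin (total_space (ladder_bundle \<sigma> \<theta>)) (twist \<sigma> \<theta> \<alpha> ` V)"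
proof -
  have "twist \<sigma> \<theta> \<alpha> ` V \<in> strip_opens \<sigma> \<theta> \<alpha>"
    unfolding strip_opens_def using assms(2,3) openin_open_eq[OF open_strip] by blast
  then show ?thesis
    unfolding ladder_bundle_def by (auto intro: topology_generated_by_Basis)
qed

lemma locally_trivial_ladder_bundle:
  assumes "ladder_system \<sigma>"
  shows "locally_trivial (ladder_bundle \<sigma> \<theta>)"
  unfolding locally_trivial_def
proof
  fix p
  let ?M = "ladder_bundle \<sigma> \<theta>"
  define \<alpha> where "\<alpha> = ray_base p"
  define U where "U = {..<ord_point (succ_omega1 \<alpha>)}"
  have over: "over ?M U = strip \<alpha>"
    by (simp add: over_ladder_bundle[OF assms] U_def strip_def)
  have prod: "prod_topology (top_of_set U) (euclidean :: circle topology) = top_of_set (strip \<alpha>)"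
    using prod_topology_subtopology_eu[of U "UNIV :: circle set"]
    by (simp add: strip_def U_def[symmetric])
  have "homeomorphic_maps (subtopology (total_space ?M) (strip \<alpha>)) (top_of_set (strip \<alpha>))
      (untwist \<sigma> \<theta> \<alpha>) (twist \<sigma> \<theta> \<alpha>)"
    unfolding homeomorphic_maps_def
  proof (intro conjI)
    show "continuous_map (subtopology (total_space ?M) (strip \<alpha>)) (top_of_set (strip \<alpha>)) (untwist \<sigma> \<theta> \<alpha>)"
      unfolding continuous_map_def
    proof (intro conjI allI impI)
      show "untwist \<sigma> \<theta> \<alpha> \<in> topspace (subtopology (total_space ?M) (strip \<alpha>)) \<rightarrow> topspace (top_of_set (strip \<alpha>))"
        by auto
      fix V assume "openin (top_of_set (strip \<alpha>)) V"
      then have V: "open V" "V \<subseteq> strip \<alpha>"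
        using openin_open_eq[OF open_strip] by auto
      have "{x \<in> topspace (subtopology (total_space ?M) (strip \<alpha>)). untwist \<sigma> \<theta> \<alpha> x \<in> V} =
          twist \<sigma> \<theta> \<alpha> ` V \<inter> strip \<alpha>"
        using V(2) by (auto simp: twist_image_eq topspace_ladder_bundle[OF assms])
      then show "openin (subtopology (total_space ?M) (strip \<alpha>))
          {x \<in> topspace (subtopology (total_space ?M) (strip \<alpha>)). untwist \<sigma> \<theta> \<alpha> x \<in> V}"
        using openin_twist_image[OF assms V] by (auto simp: openin_subtopology)
    qed
    show "continuous_map (top_of_set (strip \<alpha>)) (subtopology (total_space ?M) (strip \<alpha>)) (twist \<sigma> \<theta> \<alpha>)"
      unfolding continuous_map_in_subtopology
    proof
      show "continuous_map (top_of_set (strip \<alpha>)) (total_space ?M) (twist \<sigma> \<theta> \<alpha>)"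
        unfolding continuous_map_def
      proof (intro conjI allI impI)
        fix W assume "openin (total_space ?M) W"
        then have "open (strip \<alpha> \<inter> twist \<sigma> \<theta> \<alpha> -` W)"
          using openin_ladder_bundle[OF assms] by blast
        then show "openin (top_of_set (strip \<alpha>)) {x \<in> topspace (top_of_set (strip \<alpha>)). twist \<sigma> \<theta> \<alpha> x \<in> W}"
          unfolding openin_open_eq[OF open_strip] by (auto simp: vimage_def Int_def)
      qed (simp add: topspace_ladder_bundle[OF assms])
    qed auto
  qed auto
  then have "homeomorphic_map (subtopology (total_space ?M) (over ?M U))
      (prod_topology (top_of_set U) (euclidean :: circle topology)) (untwist \<sigma> \<theta> \<alpha>)"
    unfolding over prod homeomorphic_map_maps by blast
  moreover have "open U" "p \<in> U"
    by (simp_all add: U_def less_ord_point_succ_iff \<alpha>_def)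
  moreover have "\<forall>x\<in>over ?M U. fst (untwist \<sigma> \<theta> \<alpha> x) = proj ?M x"
    by (simp add: ladder_bundle_def)
  ultimately show "\<exists>U h. open U \<and> p \<in> U \<and>
      homeomorphic_map (subtopology (total_space ?M) (over ?M U))
        (prod_topology (top_of_set U) (euclidean :: circle topology)) h \<and>
      (\<forall>x\<in>over ?M U. fst (h x) = proj ?M x)"
    by blast
qed

lemma continuous_map_act_ladder_bundle:
  assumes "ladder_system \<sigma>"
  shows "continuous_map (prod_topology (total_space (ladder_bundle \<sigma> \<theta>)) euclidean)
    (total_space (ladder_bundle \<sigma> \<theta>)) (\<lambda>(x, t). act (ladder_bundle \<sigma> \<theta>) x t)"
  unfolding continuous_map_def
proof (intro conjI allI impI)
  let ?M = "ladder_bundle \<sigma> \<theta>"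
  let ?act = "\<lambda>(x, t). act ?M x t"
  fix W assume W: "openin (total_space ?M) W"
  show "openin (prod_topology (total_space ?M) euclidean)
      {x \<in> topspace (prod_topology (total_space ?M) euclidean). ?act x \<in> W}"
    unfolding openin_prod_topology_alt
  proof (intro allI impI)
    fix x t assume xt: "(x, t) \<in> {x \<in> topspace (prod_topology (total_space ?M) euclidean). ?act x \<in> W}"
    define \<alpha> where "\<alpha> = ray_base (fst x)"
    let ?x = "untwist \<sigma> \<theta> \<alpha> x"
    let ?O = "strip \<alpha> \<inter> twist \<sigma> \<theta> \<alpha> -` W"
    have "open ?O" using W openin_ladder_bundle[OF assms] by blast
    have act: "act ?M (twist \<sigma> \<theta> \<alpha> y) s = twist \<sigma> \<theta> \<alpha> (fst y, snd y + s)" for y s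
      by (simp add: ladder_bundle_def twist_def case_prod_beta add.assoc)
    let ?g = "\<lambda>z. (fst (fst z), snd (fst z) + snd z) :: long_ray \<times> circle"
    have "continuous_on UNIV ?g" by (intro continuous_intros)
    with \<open>open ?O\<close> have "open (?g -` ?O)" by (rule open_vimage)
    moreover have "(?x, t) \<in> ?g -` ?O"
      using xt act[of ?x t] by (simp add: mem_strip_iff \<alpha>_def)
    ultimately obtain A B where "open A" "open B" "(?x, t) \<in> A \<times> B" "A \<times> B \<subseteq> ?g -` ?O"
      by (rule open_prod_elim)
    then have AB: "open A" "open B" "?x \<in> A" "t \<in> B" "A \<times> B \<subseteq> ?g -` ?O"
      by simp_all
    have "A \<subseteq> strip \<alpha>"
      using AB(4,5) by (auto simp: mem_strip_iff subset_iff)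
    then have "openin (total_space ?M) (twist \<sigma> \<theta> \<alpha> ` A)"
      using openin_twist_image[OF assms AB(1)] by blast
    moreover have "x \<in> twist \<sigma> \<theta> \<alpha> ` A"
      using AB(3) by (simp add: twist_image_eq)
    moreover have "act ?M y s \<in> W" if y: "y \<in> twist \<sigma> \<theta> \<alpha> ` A" and s: "s \<in> B" for y s
    proof -
      obtain a where a: "y = twist \<sigma> \<theta> \<alpha> a" "a \<in> A" using y by blast
      then have "?g (a, s) \<in> ?O" using AB(5) s by blast
      then show ?thesis unfolding a(1) act by simp
    qed
    then have "twist \<sigma> \<theta> \<alpha> ` A \<times> B \<subseteq> {x \<in> topspace (prod_topology (total_space ?M) euclidean). ?act x \<in> W}"
      by (auto simp: topspace_ladder_bundle[OF assms])
    ultimately show "\<exists>U V. openin (total_space ?M) U \<and> openin euclidean V \<and> x \<in> U \<and> t \<in> V \<and>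
        U \<times> V \<subseteq> {x \<in> topspace (prod_topology (total_space ?M) euclidean). ?act x \<in> W}"
      using AB(2,4) by (intro exI[of _ "twist \<sigma> \<theta> \<alpha> ` A"] exI[of _ B]) simp
  qed
qed (simp add: topspace_ladder_bundle[OF assms])

lemma proj_ladder_bundle [simp]: "proj (ladder_bundle \<sigma> \<theta>) x = fst x"
  by (simp add: ladder_bundle_def)

lemma act_ladder_bundle [simp]: "act (ladder_bundle \<sigma> \<theta>) x t = (fst x, snd x + t)"
  by (simp add: ladder_bundle_def case_prod_beta)

lemma principal_ladder_bundle:
  assumes "ladder_system \<sigma>"
  shows "principal_circle_bundle (ladder_bundle \<sigma> \<theta>)"
proof -
  let ?M = "ladder_bundle \<sigma> \<theta>"
  have cont_proj: "continuous_map (total_space ?M) euclidean (proj ?M)"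
    unfolding continuous_map_def
  proof (intro conjI allI impI)
    fix V :: "long_ray set" assume V: "openin euclidean V"
    have "open (strip \<alpha> \<inter> twist \<sigma> \<theta> \<alpha> -` (V \<times> UNIV))" for \<alpha>
    proof -
      have "twist \<sigma> \<theta> \<alpha> x \<in> V \<times> UNIV \<longleftrightarrow> x \<in> V \<times> UNIV" for x
        by (simp add: mem_Times_iff)
      then have "strip \<alpha> \<inter> twist \<sigma> \<theta> \<alpha> -` (V \<times> UNIV) = strip \<alpha> \<inter> (V \<times> UNIV)"
        by (simp only: set_eq_iff Int_iff vimage_eq) simp
      moreover have "open (strip \<alpha> \<inter> V \<times> (UNIV :: circle set))"
        using V by (intro open_Int open_strip open_Times) simp_all
      ultimately show ?thesis by simp
    qed
    then have "openin (total_space ?M) (V \<times> UNIV)"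
      unfolding openin_ladder_bundle[OF assms] by blast
    moreover have "{x \<in> topspace (total_space ?M). proj ?M x \<in> V} = V \<times> UNIV"
      unfolding topspace_ladder_bundle[OF assms] proj_ladder_bundle by auto
    ultimately show "openin (total_space ?M) {x \<in> topspace (total_space ?M). proj ?M x \<in> V}" by simp
  qed simp
  show ?thesis
    unfolding principal_circle_bundle_def
  proof (intro conjI ballI allI impI)
    show "locally_trivial ?M"
      "continuous_map (prod_topology (total_space ?M) euclidean) (total_space ?M) (\<lambda>(x, t). act ?M x t)"
      by (rule locally_trivial_ladder_bundle[OF assms], rule continuous_map_act_ladder_bundle[OF assms])
    show "act ?M (act ?M x s) t = act ?M x (s + t)" for x s t
      by (simp add: add.assoc)
    show "t = 0" if "act ?M x t = x" for x t
      using arg_cong[OF that, of snd] by simp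
    show "\<exists>t. act ?M x t = y" if "proj ?M y = proj ?M x" for x y
    proof
      show "act ?M x (snd y - snd x) = y"
        using that by (cases x; cases y) simp
    qed
  qed (rule cont_proj, simp_all)
qed

section \<open>Closed sets of the bundle, fibre by fibre\<close>

text \<open>
  Fibres over ordinals are lifted to \<open>2 * pi\<close>-periodic sets of reals, where angles can be compared by
  their distance. By periodicity they inherit compactness arguments from the circle.
\<close>

definition lifted_fibre :: "(long_ray \<times> circle) set \<Rightarrow> omega1 \<Rightarrow> real set" where
  "lifted_fibre F \<alpha> = {x. (ord_point \<alpha>, circle_of x) \<in> F}"

lemma lifted_fibre_periodic:
  assumes "x \<in> lifted_fibre F \<alpha>"
  shows "x + 2 * pi * of_int k \<in> lifted_fibre F \<alpha>"
proof -
  have "circle_of (x + 2 * pi * of_int k) = circle_of x"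
    unfolding circle_of_eq_iff by (intro exI[of _ k]) simp
  then show ?thesis using assms by (simp add: lifted_fibre_def)
qed

lemma twist_ord_point_self: "\<alpha> \<noteq> 0 \<Longrightarrow> twist \<sigma> \<theta> \<alpha> (ord_point \<alpha>, \<phi>) = (ord_point \<alpha>, \<phi>)"
  by (simp add: twist_def arc_angle_ord_point zfun_self circle_of_zero)

lemma closed_lifted_fibre:
  assumes "ladder_system \<sigma>" "closedin (total_space (ladder_bundle \<sigma> \<theta>)) F" "\<alpha> \<noteq> 0"
  shows "closed (lifted_fibre F \<alpha>)"
proof -
  let ?O = "strip \<alpha> - twist \<sigma> \<theta> \<alpha> -` F"
  have "open ?O"
    using assms(2) unfolding closedin_ladder_bundle[OF assms(1)] by blast
  moreover have "continuous_on UNIV (\<lambda>x::real. (ord_point \<alpha>, circle_of x))"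
    by (intro continuous_intros)
  ultimately have "open ((\<lambda>x. (ord_point \<alpha>, circle_of x)) -` ?O)"
    by (rule open_vimage)
  moreover have "(\<lambda>x. (ord_point \<alpha>, circle_of x)) -` ?O = - lifted_fibre F \<alpha>"
    using assms(3)
    by (auto simp: lifted_fibre_def twist_ord_point_self mem_strip_iff ord_point_simps)
  ultimately show ?thesis
    by (simp add: closed_def)
qed

text \<open>
  The tube lemma in the strip of \<open>\<alpha>\<close>, whose coordinate agrees with the given one over \<open>\<alpha>\<close> itself since
  \<open>z\<^sub>\<alpha>(\<alpha>) = 0\<close>.
\<close>

lemma avoids_left_neighbourhood:
  assumes "ladder_system \<sigma>" "closedin (total_space (ladder_bundle \<sigma> \<theta>)) F" "\<alpha> \<noteq> 0"
    and "closed V" "\<And>\<phi>. \<phi> \<in> V \<Longrightarrow> (ord_point \<alpha>, \<phi>) \<notin> F"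
  shows "\<exists>\<mu><\<alpha>. \<forall>p \<phi>. \<mu> < ray_base p \<longrightarrow> p \<le> ord_point \<alpha> \<longrightarrow> \<phi> \<in> V \<longrightarrow> (p, arc_angle \<sigma> \<theta> \<alpha> p + \<phi>) \<notin> F"
proof -
  let ?O = "strip \<alpha> - twist \<sigma> \<theta> \<alpha> -` F"
  have O: "open ?O"
    using assms(2) unfolding closedin_ladder_bundle[OF assms(1)] by blast
  have "compact V"
    using compact_Int_closed[OF compact_UNIV_circle assms(4)] by simp
  moreover have "{ord_point \<alpha>} \<times> V \<subseteq> ?O"
    using assms(3,5) by (auto simp: twist_ord_point_self mem_strip_iff ord_point_simps)
  ultimately obtain A where A: "ord_point \<alpha> \<in> A" "open A" "A \<times> V \<subseteq> ?O"
    using O Elementary_Topology.tube_lemma[of V ?O "ord_point \<alpha>"] by blast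
  have "0 < \<alpha>" using assms(3) zero_le_omega1[of \<alpha>] by simp
  then have "ray_point 0 (1/2) < ord_point \<alpha>"
    by (simp add: less_ord_point_iff ray_point_simps)
  then obtain b where b: "b < ord_point \<alpha>" "{b<..ord_point \<alpha>} \<subseteq> A"
    using open_left[OF A(2,1)] by blast
  have "(p, arc_angle \<sigma> \<theta> \<alpha> p + \<phi>) \<notin> F"
    if "ray_base b < ray_base p" "p \<le> ord_point \<alpha>" "\<phi> \<in> V" for p \<phi>
  proof -
    have "b < p" using that(1) by (simp add: ray_less_iff)
    then have "p \<in> A" using b(2) that(2) by auto
    then have "(p, \<phi>) \<in> ?O" using A(3) that(3) by blast
    then show ?thesis by (simp add: twist_def)
  qed
  moreover have "ray_base b < \<alpha>"
    using b(1) assms(3) by (simp add: less_ord_point_iff)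
  ultimately show ?thesis by blast
qed

text \<open>
  Closedness of \<open>F\<close> as upper semicontinuity of its fibres: \<open>F\<close> avoids the closed complement of the
  \<open>\<eta>\<close>-neighbourhood of its fibre over \<open>\<alpha>\<close>, hence also over a left neighbourhood of \<open>\<alpha>\<close>.
\<close>

lemma lifted_fibre_usc:
  assumes "ladder_system \<sigma>" "closedin (total_space (ladder_bundle \<sigma> \<theta>)) F" "\<alpha> \<noteq> 0" "0 < \<eta>"
  shows "\<exists>\<mu><\<alpha>. \<forall>\<beta>. \<mu> < \<beta> \<longrightarrow> \<beta> \<le> \<alpha> \<longrightarrow>
    (\<forall>x\<in>lifted_fibre F \<beta>. \<exists>y\<in>lifted_fibre F \<alpha>. \<bar>x - \<theta> * real (zfun \<sigma> \<alpha> \<beta>) - y\<bar> < \<eta>)"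
proof -
  let ?U = "\<Union>y\<in>lifted_fibre F \<alpha>. ball y \<eta>"
  have "open (circle_of ` ?U)"
    by (intro open_circle_of_image) auto
  then have cl: "closed (- circle_of ` ?U)"
    by (simp add: closed_def)
  have av: "(ord_point \<alpha>, \<phi>) \<notin> F" if \<phi>: "\<phi> \<in> - circle_of ` ?U" for \<phi>
  proof
    assume F: "(ord_point \<alpha>, \<phi>) \<in> F"
    obtain x where x: "\<phi> = circle_of x" by (rule circle_of_cases)
    then have "x \<in> lifted_fibre F \<alpha>" using F by (simp add: lifted_fibre_def)
    then have "x \<in> ?U" using centre_in_ball[of x \<eta>] assms(4) by blast
    then show False using \<phi> x by blast
  qed
  obtain \<mu> where \<mu>: "\<mu> < \<alpha>" "\<And>p \<phi>. \<mu> < ray_base p \<Longrightarrow> p \<le> ord_point \<alpha> \<Longrightarrow>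
      \<phi> \<in> - circle_of ` ?U \<Longrightarrow> (p, arc_angle \<sigma> \<theta> \<alpha> p + \<phi>) \<notin> F"
    using avoids_left_neighbourhood[OF assms(1,2,3) cl av] by blast
  have "\<exists>y\<in>lifted_fibre F \<alpha>. \<bar>x - \<theta> * real (zfun \<sigma> \<alpha> \<beta>) - y\<bar> < \<eta>"
    if \<beta>: "\<mu> < \<beta>" "\<beta> \<le> \<alpha>" and x: "x \<in> lifted_fibre F \<beta>" for \<beta> x
  proof -
    have "\<beta> \<noteq> 0" using \<beta>(1) zero_le_omega1[of \<mu>] by auto
    let ?x = "x - \<theta> * real (zfun \<sigma> \<alpha> \<beta>)"
    have eq: "(ord_point \<beta>, arc_angle \<sigma> \<theta> \<alpha> (ord_point \<beta>) + circle_of ?x) = (ord_point \<beta>, circle_of x)"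
      using \<open>\<beta> \<noteq> 0\<close> by (simp add: arc_angle_ord_point circle_of_add)
    have "ord_point \<beta> \<le> ord_point \<alpha>" "\<mu> < ray_base (ord_point \<beta>)"
      using \<beta> \<open>\<beta> \<noteq> 0\<close> assms(3) by (auto simp: ray_le_iff ord_point_simps)
    then have "circle_of ?x \<in> circle_of ` ?U"
      using \<mu>(2)[of "ord_point \<beta>" "circle_of ?x"] x unfolding eq lifted_fibre_def by auto
    then obtain y x' where y: "y \<in> lifted_fibre F \<alpha>" "x' \<in> ball y \<eta>" "circle_of ?x = circle_of x'"
      by blast
    then obtain k :: int where k: "?x - x' = 2 * pi * of_int k"
      unfolding circle_of_eq_iff by blast
    have "?x - (y + 2 * pi * of_int k) = x' - y" using k by simp
    moreover have "\<bar>x' - y\<bar> < \<eta>" using y(2) by (simp add: dist_real_def abs_minus_commute)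
    ultimately show ?thesis
      using lifted_fibre_periodic[OF y(1), of k] by (metis (no_types, lifting))
  qed
  then show ?thesis using \<mu>(1) by blast
qed

text \<open>
  An unbounded \<open>F\<close> might have points only over non-ordinals, but their bases have limits, and over such a
  limit \<open>F\<close> has a point by compactness of the circle.
\<close>

lemma club_nonempty_fibres:
  assumes "ladder_system \<sigma>" "bundle_club (ladder_bundle \<sigma> \<theta>) F"
  shows "club {\<alpha>\<in>LimOrd. lifted_fibre F \<alpha> \<noteq> {}}" (is "club ?N")
  unfolding club_def
proof
  have cl: "closedin (total_space (ladder_bundle \<sigma> \<theta>)) F" and unb: "\<not> bdd_above (fst ` F)"
    using assms(2) by (simp_all add: bundle_club_def)
  show "closed ?N"
  proof (rule closed_omega1I)
    fix \<alpha> assume \<alpha>: "\<alpha> \<in> LimOrd" and ex: "\<And>\<mu>. \<mu> < \<alpha> \<Longrightarrow> \<exists>\<beta>\<in>?N. \<mu> < \<beta> \<and> \<beta> < \<alpha>"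
    have "\<alpha> \<noteq> 0" using LimOrd_pos[OF \<alpha>] by auto
    obtain \<mu> where "\<mu> < \<alpha>" and \<mu>: "\<And>\<beta> x. \<mu> < \<beta> \<Longrightarrow> \<beta> \<le> \<alpha> \<Longrightarrow> x \<in> lifted_fibre F \<beta> \<Longrightarrow>
        \<exists>y\<in>lifted_fibre F \<alpha>. \<bar>x - \<theta> * real (zfun \<sigma> \<alpha> \<beta>) - y\<bar> < 1"
      using lifted_fibre_usc[OF assms(1) cl \<open>\<alpha> \<noteq> 0\<close>, of 1] by auto
    obtain \<beta> where "\<beta> \<in> ?N" "\<mu> < \<beta>" "\<beta> < \<alpha>" using ex[OF \<open>\<mu> < \<alpha>\<close>] by blast
    then show "\<alpha> \<in> ?N" using \<mu>[of \<beta>] \<alpha> by fastforce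
  qed
  show "\<not> bdd_above ?N"
    unfolding not_bdd_above_omega1_iff
  proof
    fix \<gamma>
    have "\<exists>x\<in>F. \<xi> < ray_base (fst x)" for \<xi>
    proof -
      let ?q = "ord_point (succ_omega1 \<xi>)"
      obtain x where "x \<in> F" "\<not> fst x \<le> ?q"
        using unb unfolding bdd_above_def by blast
      then show ?thesis
        using less_ord_point_succ_iff[of "fst x" \<xi>] by (meson leI less_imp_le)
    qed
    then obtain g where g: "\<And>\<xi>. g \<xi> \<in> F" "\<And>\<xi>. \<xi> < ray_base (fst (g \<xi>))" by metis
    obtain \<alpha> where \<alpha>: "\<alpha> \<in> LimOrd" "\<gamma> < \<alpha>" and closure: "\<And>\<xi>. \<xi> < \<alpha> \<Longrightarrow> ray_base (fst (g \<xi>)) < \<alpha>"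
      using club_closure_points[of "\<lambda>\<xi>. ray_base (fst (g \<xi>))"]
      unfolding club_def not_bdd_above_omega1_iff by blast
    have "\<alpha> \<noteq> 0" using LimOrd_pos[OF \<alpha>(1)] by auto
    have "lifted_fibre F \<alpha> \<noteq> {}"
    proof
      assume empty: "lifted_fibre F \<alpha> = {}"
      have "(ord_point \<alpha>, \<phi>) \<notin> F" for \<phi>
        using empty by (cases \<phi> rule: circle_of_cases) (auto simp: lifted_fibre_def)
      then obtain \<mu> where \<mu>: "\<mu> < \<alpha>" "\<And>p \<phi>. \<mu> < ray_base p \<Longrightarrow> p \<le> ord_point \<alpha> \<Longrightarrow>
          (p, arc_angle \<sigma> \<theta> \<alpha> p + \<phi>) \<notin> F"
        using avoids_left_neighbourhood[OF assms(1) cl \<open>\<alpha> \<noteq> 0\<close> closed_UNIV] by blast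
      let ?p = "fst (g \<mu>)"
      have "?p \<le> ord_point \<alpha>"
        using closure[OF \<mu>(1)] less_ord_point_iff[OF \<open>\<alpha> \<noteq> 0\<close>, of ?p] by simp
      then show False
        using \<mu>(2)[OF g(2)[of \<mu>], of "snd (g \<mu>) - arc_angle \<sigma> \<theta> \<alpha> ?p"] g(1)[of \<mu>] by simp
    qed
    then show "\<exists>\<alpha>\<in>?N. \<gamma> < \<alpha>" using \<alpha> by blast
  qed
qed

section \<open>A pair of points that differ by \<open>\<theta>\<close>\<close>

text \<open>
  By periodicity the subtrahends can be taken in one period, where they have a convergent
  subsequence.
\<close>

lemma approximate_difference_attained:
  fixes A :: "real set"
  assumes "closed A" "\<And>x k::int. x \<in> A \<Longrightarrow> x + 2 * pi * of_int k \<in> A"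
    and "\<And>m::nat. \<exists>a\<in>A. \<exists>b\<in>A. \<bar>a - b - \<theta>\<bar> < 3 / real (Suc m)"
  shows "\<exists>x\<in>A. x + \<theta> \<in> A"
proof -
  have "\<exists>a\<in>A. \<exists>b\<in>A. b \<in> {0..2 * pi} \<and> \<bar>a - b - \<theta>\<bar> < 3 / real (Suc m)" for m
  proof -
    obtain a b where ab: "a \<in> A" "b \<in> A" "\<bar>a - b - \<theta>\<bar> < 3 / real (Suc m)"
      using assms(3) by blast
    obtain k :: int where "b + 2 * pi * of_int k \<in> {0..2 * pi}"
      using ex_shift_into_period by blast
    then show ?thesis
      using assms(2)[OF ab(1), of k] assms(2)[OF ab(2), of k] ab(3)
      by (intro bexI[of _ "a + 2 * pi * of_int k"] bexI[of _ "b + 2 * pi * of_int k"]) auto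
  qed
  then obtain a b where a: "\<And>m. a m \<in> A" and b: "\<And>m. b m \<in> A" "\<And>m. b m \<in> {0..2 * pi}"
    and close: "\<And>m. \<bar>a m - b m - \<theta>\<bar> < 3 / real (Suc m)"
    by metis
  have "seq_compact {0..2 * pi}"
    by (intro compact_imp_seq_compact compact_Icc)
  then obtain l r where r: "strict_mono r" "(b \<circ> r) \<longlonglongrightarrow> l"
    using b(2) unfolding seq_compact_def by blast
  have "(\<lambda>m. 3 / real (Suc m)) \<longlonglongrightarrow> 0"
    using tendsto_mult[OF tendsto_const[of 3] LIMSEQ_inverse_real_of_nat] by (simp add: divide_inverse)
  then have "(\<lambda>m. a m - b m - \<theta>) \<longlonglongrightarrow> 0"
    by (rule Lim_null_comparison[rotated]) (use close in \<open>auto intro!: eventuallyI less_imp_le\<close>)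
  then have "((\<lambda>m. a m - b m - \<theta>) \<circ> r) \<longlonglongrightarrow> 0"
    using r(1) by (rule LIMSEQ_subseq_LIMSEQ)
  then have "(\<lambda>m. (((\<lambda>m. a m - b m - \<theta>) \<circ> r) m + (b \<circ> r) m) + \<theta>) \<longlonglongrightarrow> (0 + l) + \<theta>"
    using r(2) by (intro tendsto_add tendsto_const)
  then have "(a \<circ> r) \<longlonglongrightarrow> l + \<theta>"
    by (simp add: o_def)
  then have "l + \<theta> \<in> A"
    using closed_sequentially[OF assms(1)] a by (metis comp_apply)
  moreover have "l \<in> A"
    using closed_sequentially[OF assms(1) _ r(2)] b(1) by simp
  ultimately show ?thesis by blast
qed

text \<open>
  The argument sketched at the beginning. Here \<open>near m \<alpha> \<beta>\<close> expresses that the fibre over \<open>\<beta>\<close>, seen in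
  the strip of \<open>\<alpha>\<close>, is within \<open>1 / (m + 1)\<close> of the fibre over \<open>\<alpha>\<close>; the three steps \<open>\<beta> \<rightarrow> \<alpha>\<close>, \<open>\<alpha> \<rightarrow> \<epsilon>\<close> and
  \<open>\<beta> \<rightarrow> \<epsilon>\<close> add up to the error \<open>3 / (m + 1)\<close>.
\<close>

lemma rotated_pair_over_club:
  assumes "clubsuit_C_sequence \<sigma>" "\<And>\<alpha>. \<alpha> \<in> LimOrd2 \<Longrightarrow> range (\<sigma> \<alpha>) \<subseteq> LimOrd"
    and F: "bundle_club (ladder_bundle \<sigma> \<theta>) F" and C: "club C"
  shows "\<exists>\<epsilon>\<in>C \<inter> LimOrd. \<exists>x\<in>lifted_fibre F \<epsilon>. x + \<theta> \<in> lifted_fibre F \<epsilon>"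
proof -
  have lad: "ladder_system \<sigma>" using assms(1) by (simp add: clubsuit_C_sequence_def)
  have cl: "closedin (total_space (ladder_bundle \<sigma> \<theta>)) F" using F by (simp add: bundle_club_def)
  define N where "N = {\<alpha>\<in>LimOrd. lifted_fibre F \<alpha> \<noteq> {}}"
  define B where "B = {\<alpha>\<in>LimOrd. range (\<sigma> \<alpha>) \<subseteq> N}"
  have "club N" unfolding N_def using lad F by (rule club_nonempty_fibres)
  then have "stationary B" using assms(1) by (simp add: clubsuit_C_sequence_def B_def)
  have B2: "\<alpha> \<in> LimOrd2" if "\<alpha> \<in> B" for \<alpha>
  proof (rule LimOrd2I)
    have \<alpha>: "\<alpha> \<in> LimOrd" and sub: "range (\<sigma> \<alpha>) \<subseteq> LimOrd"
      using that by (auto simp: B_def N_def)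
    show "\<alpha> \<noteq> 0" using LimOrd_pos[OF \<alpha>] by auto
    show "\<exists>\<beta>\<in>LimOrd. \<gamma> < \<beta> \<and> \<beta> < \<alpha>" if \<gamma>: "\<gamma> < \<alpha>" for \<gamma>
      using ladder_cofinal[OF lad \<alpha> \<gamma>] ladder_less[OF lad \<alpha>] sub by blast
  qed
  define near where "near m \<alpha> \<beta> \<longleftrightarrow> (\<forall>x\<in>lifted_fibre F \<beta>. \<exists>y\<in>lifted_fibre F \<alpha>.
      \<bar>x - \<theta> * real (zfun \<sigma> \<alpha> \<beta>) - y\<bar> < 1 / real (Suc m))" for m \<alpha> \<beta>
  have usc: "\<exists>\<mu><\<alpha>. \<forall>\<beta>. \<mu> < \<beta> \<longrightarrow> \<beta> \<le> \<alpha> \<longrightarrow> near m \<alpha> \<beta>" if "\<alpha> \<in> LimOrd" for \<alpha> m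
    unfolding near_def using lifted_fibre_usc[OF lad cl, of \<alpha> "1 / real (Suc m)"] LimOrd_pos[OF that] by auto
  define \<mu> where "\<mu> m \<alpha> = (SOME \<mu>. \<mu> < \<alpha> \<and> (\<forall>\<beta>. \<mu> < \<beta> \<longrightarrow> \<beta> \<le> \<alpha> \<longrightarrow> near m \<alpha> \<beta>))" for m \<alpha>
  have \<mu>_props: "\<mu> m \<alpha> < \<alpha> \<and> (\<forall>\<beta>. \<mu> m \<alpha> < \<beta> \<longrightarrow> \<beta> \<le> \<alpha> \<longrightarrow> near m \<alpha> \<beta>)" if "\<alpha> \<in> LimOrd" for m \<alpha>
    unfolding \<mu>_def using usc[OF that, of m] by (rule someI_ex)
  have \<mu>: "\<And>m \<alpha>. \<alpha> \<in> LimOrd \<Longrightarrow> \<mu> m \<alpha> < \<alpha>"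
      "\<And>m \<alpha> \<beta>. \<alpha> \<in> LimOrd \<Longrightarrow> \<mu> m \<alpha> < \<beta> \<Longrightarrow> \<beta> \<le> \<alpha> \<Longrightarrow> near m \<alpha> \<beta>"
    using \<mu>_props by blast+
  have "\<exists>\<gamma>. \<forall>\<xi>. \<exists>\<alpha>\<in>B. \<mu> m \<alpha> = \<gamma> \<and> \<xi> < \<alpha>" for m
    using \<open>stationary B\<close> \<mu>(1) by (intro stationary_regressive_unbounded) (auto simp: B_def)
  then obtain \<gamma> where \<gamma>: "\<And>m \<xi>. \<exists>\<alpha>\<in>B. \<mu> m \<alpha> = \<gamma> m \<and> \<xi> < \<alpha>" by metis
  obtain \<gamma>0 where \<gamma>0: "\<And>m. \<gamma> m < \<gamma>0"
    using countable_bounded_omega1[of "range \<gamma>"] by auto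
  \<comment> \<open>The first set forces \<open>\<epsilon> \<in> C\<close>, the others provide the \<open>\<alpha>\<close> for each precision.\<close>
  define U where "U m = (case m of 0 \<Rightarrow> C | Suc m \<Rightarrow> {\<alpha>\<in>B. \<mu> m \<alpha> = \<gamma> m})" for m
  have "\<exists>\<beta>\<in>U m. \<xi> < \<beta>" for m \<xi>
  proof (cases m)
    case 0
    then show ?thesis using C by (simp add: U_def club_def not_bdd_above_omega1_iff)
  next
    case (Suc n)
    then show ?thesis using \<gamma>[of n \<xi>] by (auto simp: U_def)
  qed
  then obtain \<epsilon> where \<epsilon>: "\<epsilon> \<in> LimOrd" "\<gamma>0 < \<epsilon>" and lim: "\<And>m \<xi>. \<xi> < \<epsilon> \<Longrightarrow> \<exists>\<beta>\<in>U m. \<xi> < \<beta> \<and> \<beta> < \<epsilon>"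
    using common_limit_of_unbounded[of U \<gamma>0] by blast
  have "\<epsilon> \<in> C"
    using closed_omega1D[of C \<epsilon>] C \<epsilon>(1) lim[of _ 0] by (auto simp: U_def club_def)
  have "\<epsilon> \<in> LimOrd2"
  proof (rule LimOrd2I)
    show "\<epsilon> \<noteq> 0" using LimOrd_pos[OF \<epsilon>(1)] by auto
    show "\<exists>\<beta>\<in>LimOrd. \<xi> < \<beta> \<and> \<beta> < \<epsilon>" if "\<xi> < \<epsilon>" for \<xi>
      using lim[OF that, of "Suc 0"] by (auto simp: U_def B_def)
  qed
  have "\<exists>a\<in>lifted_fibre F \<epsilon>. \<exists>b\<in>lifted_fibre F \<epsilon>. \<bar>a - b - \<theta>\<bar> < 3 / real (Suc m)" for m
  proof -
    obtain j where j: "max (\<mu> m \<epsilon>) \<gamma>0 < \<sigma> \<epsilon> j"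
      using ladder_cofinal[OF lad \<epsilon>(1)] \<mu>(1)[OF \<epsilon>(1)] \<epsilon>(2) by (meson max_less_iff_conj)
    have "\<sigma> \<epsilon> j < \<epsilon>" using ladder_less[OF lad \<epsilon>(1)] .
    moreover have "delta \<sigma> \<epsilon> 0 < \<epsilon>" using delta_less[OF lad \<epsilon>(1)] .
    ultimately obtain \<alpha> where \<alpha>: "\<alpha> \<in> U (Suc m)" "\<sigma> \<epsilon> j < \<alpha>" "delta \<sigma> \<epsilon> 0 < \<alpha>" "\<alpha> < \<epsilon>"
      using lim[of "max (\<sigma> \<epsilon> j) (delta \<sigma> \<epsilon> 0)" "Suc m"] by auto
    have \<alpha>B: "\<alpha> \<in> B" "\<mu> m \<alpha> = \<gamma> m" using \<alpha>(1) by (simp_all add: U_def)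
    have \<alpha>L: "\<alpha> \<in> LimOrd" using \<alpha>B(1) by (simp add: B_def)
    obtain k c where k: "\<And>\<eta>. \<eta> \<in> ladder_points \<sigma> \<epsilon> \<Longrightarrow> \<eta> < \<alpha> \<Longrightarrow> \<eta> \<le> \<sigma> \<alpha> k"
      and c: "\<And>\<beta>. \<beta> \<in> {\<sigma> \<alpha> k<..\<alpha>} \<Longrightarrow> zfun \<sigma> \<epsilon> \<beta> =
        zfun \<sigma> \<alpha> \<beta> + c + (if \<beta> \<in> {\<sigma> \<alpha> (Suc k)<..\<sigma> \<alpha> (Suc (Suc k))} then 1 else 0)"
      using zfun_walk[OF lad assms(2) B2[OF \<alpha>B(1)] \<open>\<epsilon> \<in> LimOrd2\<close> \<alpha>(4,3)] by blast
    have "\<sigma> \<epsilon> j \<le> \<sigma> \<alpha> k"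
      using k[of "\<sigma> \<epsilon> j"] \<alpha>(2) by (simp add: ladder_points_def)
    have rungs: "\<sigma> \<alpha> k < \<sigma> \<alpha> (Suc k)" "\<sigma> \<alpha> (Suc k) < \<sigma> \<alpha> (Suc (Suc k))"
      using ladder_strict_mono[OF lad \<alpha>L] by (simp_all add: strict_mono_Suc_iff)
    \<comment> \<open>The only rung of \<open>\<alpha>\<close> at which \<open>z\<^sub>\<epsilon>\<close> has the additional jump; it is in \<open>N\<close> because \<open>\<alpha> \<in> B\<close>.\<close>
    define \<beta> where "\<beta> = \<sigma> \<alpha> (Suc (Suc k))"
    have "\<beta> < \<alpha>" using ladder_less[OF lad \<alpha>L] by (simp add: \<beta>_def)
    have big: "\<sigma> \<alpha> k < \<beta>" "max (\<mu> m \<epsilon>) \<gamma>0 < \<beta>"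
      using rungs j \<open>\<sigma> \<epsilon> j \<le> \<sigma> \<alpha> k\<close> by (auto simp: \<beta>_def)
    have z\<beta>: "zfun \<sigma> \<epsilon> \<beta> = zfun \<sigma> \<alpha> \<beta> + c + 1"
      using c[of \<beta>] big(1) \<open>\<beta> < \<alpha>\<close> rungs by (simp add: \<beta>_def)
    have z\<alpha>: "zfun \<sigma> \<epsilon> \<alpha> = c"
      using c[of \<alpha>] order.strict_trans[OF big(1) \<open>\<beta> < \<alpha>\<close>] \<open>\<beta> < \<alpha>\<close>
      by (simp add: \<beta>_def[symmetric] zfun_self not_le)
    have "\<beta> \<in> N" using \<alpha>B(1) by (auto simp: B_def \<beta>_def)
    then obtain x where x: "x \<in> lifted_fibre F \<beta>" by (auto simp: N_def)
    have "near m \<alpha> \<beta>"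
      using big(2) \<gamma>0[of m] \<alpha>B(2) \<open>\<beta> < \<alpha>\<close> by (intro \<mu>(2) \<alpha>L) auto
    then obtain y where y: "y \<in> lifted_fibre F \<alpha>" "\<bar>x - \<theta> * real (zfun \<sigma> \<alpha> \<beta>) - y\<bar> < 1 / real (Suc m)"
      using x unfolding near_def by blast
    have "near m \<epsilon> \<alpha>" "near m \<epsilon> \<beta>"
      using big(2) \<open>\<beta> < \<alpha>\<close> \<alpha>(4) by (auto intro!: \<mu>(2) \<epsilon>(1))
    then obtain a b where a: "a \<in> lifted_fibre F \<epsilon>" "\<bar>y - \<theta> * real c - a\<bar> < 1 / real (Suc m)"
      and b: "b \<in> lifted_fibre F \<epsilon>" "\<bar>x - \<theta> * real (zfun \<sigma> \<alpha> \<beta> + c + 1) - b\<bar> < 1 / real (Suc m)"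
      using x y(1) unfolding near_def z\<alpha> z\<beta> by meson
    have "a - b - \<theta> = - (y - \<theta> * real c - a) - (x - \<theta> * real (zfun \<sigma> \<alpha> \<beta>) - y)
        + (x - \<theta> * real (zfun \<sigma> \<alpha> \<beta> + c + 1) - b)"
      by (simp add: algebra_simps)
    then have "\<bar>a - b - \<theta>\<bar> < 3 / real (Suc m)"
      using a(2) b(2) y(2) by (simp only: abs_less_iff) (simp add: field_simps)
    then show ?thesis using a(1) b(1) by blast
  qed
  then have "\<exists>x\<in>lifted_fibre F \<epsilon>. x + \<theta> \<in> lifted_fibre F \<epsilon>"
    using closed_lifted_fibre[OF lad cl] LimOrd_pos[OF \<epsilon>(1)] lifted_fibre_periodic
    by (intro approximate_difference_attained) auto
  then show ?thesis using \<open>\<epsilon> \<in> C\<close> \<epsilon>(1) by blast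
qed

section \<open>Irrationality of \<open>\<pi>\<close>\<close>

text \<open>
  Niven's polynomials. Their integrals against the sine satisfy a two-term recurrence whose coefficients
  involve only \<open>pi\<^sup>2\<close>.
\<close>

definition niven :: "nat \<Rightarrow> real \<Rightarrow> real" where
  "niven n x = (x * (pi - x)) ^ n / fact n"

lemma niven_deriv:
  "(niven (Suc n) has_real_derivative niven n x * (pi - 2 * x)) (at x within S)"
  unfolding niven_def
  by (rule derivative_eq_intros refl | simp)+

lemma niven_Suc: "niven (Suc n) x = niven n x * (x * (pi - x)) / real (Suc n)"
  by (simp add: niven_def field_simps)

text \<open>
  For \<open>u = niven (n + 2)\<close> the function \<open>(u + u'') * sin\<close> has the antiderivative \<open>u' * sin - u * cos\<close>, which
  vanishes at both ends; the recurrence is \<open>u''\<close> written in terms of the two previous polynomials.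
\<close>

lemma niven_integral_recurrence:
  assumes "((\<lambda>x. niven n x * sin x) has_integral I0) {0..pi}"
    and "((\<lambda>x. niven (Suc n) x * sin x) has_integral I1) {0..pi}"
  shows "((\<lambda>x. niven (Suc (Suc n)) x * sin x) has_integral (4 * real n + 6) * I1 - pi\<^sup>2 * I0) {0..pi}"
proof -
  define u where "u = niven (Suc (Suc n))"
  define u' where "u' x = niven (Suc n) x * (pi - 2 * x)" for x
  define u'' where "u'' x = pi\<^sup>2 * niven n x - (4 * real n + 6) * niven (Suc n) x" for x
  have du: "(u has_real_derivative u' x) (at x within S)" for x S
    unfolding u_def u'_def by (rule niven_deriv)
  have du': "(u' has_real_derivative u'' x) (at x within S)" for x S
    unfolding u'_def u''_def
    by (rule derivative_eq_intros niven_deriv refl)+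
      (simp add: niven_Suc power2_eq_square field_simps)
  let ?G = "\<lambda>x. u' x * sin x - u x * cos x"
  have "(?G has_real_derivative (u x + u'' x) * sin x) (at x within {0..pi})" for x
    by (rule derivative_eq_intros du du' refl)+ (simp add: algebra_simps)
  then have "((\<lambda>x. (u x + u'' x) * sin x) has_integral ?G pi - ?G 0) {0..pi}"
    by (intro fundamental_theorem_of_calculus) (auto simp: has_real_derivative_iff_has_vector_derivative)
  moreover have "?G pi - ?G 0 = 0"
    by (simp add: u_def niven_def)
  ultimately have "((\<lambda>x. (u x + u'' x) * sin x - (pi\<^sup>2 * (niven n x * sin x) - (4 * real n + 6) * (niven (Suc n) x * sin x)))
      has_integral 0 - (pi\<^sup>2 * I0 - (4 * real n + 6) * I1)) {0..pi}"
    using assms by (intro has_integral_diff has_integral_mult_right) simp_all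
  then show ?thesis
    by (simp add: u_def u''_def algebra_simps)
qed

lemma niven_integral_0: "((\<lambda>x. niven 0 x * sin x) has_integral 2) {0..pi}"
proof -
  have "((\<lambda>x. sin x) has_integral - cos pi - - cos 0) {0..pi}"
    by (intro fundamental_theorem_of_calculus)
      (auto simp: has_real_derivative_iff_has_vector_derivative[symmetric] intro!: derivative_eq_intros)
  then show ?thesis
    by (simp add: niven_def)
qed

lemma niven_integral_1: "((\<lambda>x. niven 1 x * sin x) has_integral 4) {0..pi}"
proof -
  let ?G = "\<lambda>x. (pi - 2 * x) * sin x - x * (pi - x) * cos x - 2 * cos x"
  have "(?G has_real_derivative x * (pi - x) * sin x) (at x within {0..pi})" for x
    by (rule derivative_eq_intros refl)+ (simp add: algebra_simps)
  then have "((\<lambda>x. x * (pi - x) * sin x) has_integral ?G pi - ?G 0) {0..pi}"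
    by (intro fundamental_theorem_of_calculus) (auto simp: has_real_derivative_iff_has_vector_derivative)
  then show ?thesis
    by (simp add: niven_def)
qed

text \<open>
  If \<open>pi\<^sup>2 = c / d\<close>, then by the recurrence the integrals multiplied by \<open>d ^ n\<close> are integers; they are positive
  and tend to zero.
\<close>

lemma pi_irrational: "pi \<notin> \<rat>"
proof
  assume "pi \<in> \<rat>"
  then have "pi\<^sup>2 \<in> \<rat>" by simp
  then obtain c d :: int where d: "d > 0" and cd: "pi\<^sup>2 = of_int c / of_int d"
    by (metis Rats_cases')
  have ex: "\<exists>I0 I1 k0 k1. ((\<lambda>x. niven n x * sin x) has_integral I0) {0..pi} \<and>
      ((\<lambda>x. niven (Suc n) x * sin x) has_integral I1) {0..pi} \<and>
      of_int d ^ n * I0 = of_int k0 \<and> of_int d ^ Suc n * I1 = of_int k1" for n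
  proof (induction n)
    case 0
    show ?case
      using niven_integral_0 niven_integral_1
      by (intro exI[of _ 2] exI[of _ 4] exI[of _ "4 * d"]) auto
  next
    case (Suc n)
    then obtain I0 I1 k0 k1 where I: "((\<lambda>x. niven n x * sin x) has_integral I0) {0..pi}"
      "((\<lambda>x. niven (Suc n) x * sin x) has_integral I1) {0..pi}"
      and k: "of_int d ^ n * I0 = of_int k0" "of_int d ^ Suc n * I1 = of_int k1"
      by blast
    have "of_int d ^ Suc (Suc n) * ((4 * real n + 6) * I1 - pi\<^sup>2 * I0) =
      (4 * real n + 6) * of_int d * (of_int d ^ Suc n * I1) - of_int c * of_int d * (of_int d ^ n * I0)"
      using d by (simp add: cd field_simps)
    also have "\<dots> = of_int ((4 * int n + 6) * d * k1 - c * d * k0)"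
      by (simp only: k) simp
    finally show ?case
      using niven_integral_recurrence[OF I] I(2) k(2) by blast
  qed
  have "(\<lambda>n. (of_int d * pi\<^sup>2) ^ n / fact n) \<longlonglongrightarrow> 0"
    using summable_LIMSEQ_zero[OF summable_exp[of "of_int d * pi\<^sup>2"]]
    by (simp add: divide_inverse mult.commute)
  then have "\<forall>\<^sub>F n in sequentially. (of_int d * pi\<^sup>2) ^ n / fact n < 1 / pi"
    by (rule order_tendstoD) simp
  then obtain n where n: "(of_int d * pi\<^sup>2) ^ n / fact n < 1 / pi"
    by (meson eventually_sequentially order_refl)
  obtain I k where I: "((\<lambda>x. niven n x * sin x) has_integral I) {0..pi}" and k: "of_int d ^ n * I = of_int k"
    using ex by blast
  have bounds: "0 \<le> niven n x * sin x" "niven n x * sin x \<le> (pi\<^sup>2) ^ n / fact n"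
    if "x \<in> {0..pi}" for x
  proof -
    have x: "0 \<le> x * (pi - x)" "x * (pi - x) \<le> pi\<^sup>2"
      using that mult_mono[of x pi "pi - x" pi] by (auto simp: power2_eq_square)
    have s: "0 \<le> sin x" "sin x \<le> 1"
      using that by (auto intro: sin_ge_zero)
    have nv: "0 \<le> niven n x" "niven n x \<le> (pi\<^sup>2) ^ n / fact n"
      unfolding niven_def using x by (auto intro!: divide_right_mono power_mono)
    show "0 \<le> niven n x * sin x" using s nv by simp
    show "niven n x * sin x \<le> (pi\<^sup>2) ^ n / fact n"
      using mult_mono[OF nv(2) s(2)] s(1) nv by (simp add: order_trans[OF _ nv(2)])
  qed
  have "I \<le> pi * ((pi\<^sup>2) ^ n / fact n)"
    using has_integral_le[OF I has_integral_const_real[of "(pi\<^sup>2) ^ n / fact n" 0 pi]] bounds by simp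
  then have "of_int d ^ n * I \<le> of_int d ^ n * (pi * ((pi\<^sup>2) ^ n / fact n))"
    using d by (intro mult_left_mono) auto
  also have "\<dots> = pi * ((of_int d * pi\<^sup>2) ^ n / fact n)"
    by (simp add: power_mult_distrib)
  also have "\<dots> < 1"
    using n by (simp add: field_simps)
  finally have "k < 1" using k by simp
  have "I > 0"
  proof (rule ccontr)
    assume "\<not> 0 < I"
    moreover have "0 \<le> I"
      using has_integral_nonneg[OF I] bounds by blast
    ultimately have "I = 0" by simp
    have cont: "continuous_on {0..pi} (\<lambda>x. niven n x * sin x)"
      unfolding niven_def by (intro continuous_intros) simp
    have "niven n (pi/2) * sin (pi/2) = 0"
    proof (rule has_integral_0_cbox_imp_0[where f = "\<lambda>x. niven n x * sin x"])
      show "continuous_on (cbox 0 pi) (\<lambda>x. niven n x * sin x)"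
        using cont by simp
      show "((\<lambda>x. niven n x * sin x) has_integral 0) (cbox 0 pi)"
        using I \<open>I = 0\<close> by simp
    qed (use bounds(1) pi_gt_zero in \<open>auto simp: not_le[symmetric] simp del: pi_gt_zero\<close>)
    then show False by (simp add: niven_def)
  qed
  then have "0 < of_int d ^ n * I" using d by simp
  then have "0 < k" using k by simp
  with \<open>k < 1\<close> show False by simp
qed

section \<open>The order of the bundle\<close>

lemma club_greaterThan: "club {\<gamma><..}"
  unfolding club_def not_bdd_above_omega1_iff
proof
  show "closed {\<gamma><..}"
    by (rule closed_omega1I) (use LimOrd_pos in \<open>force intro: order.strict_trans\<close>)
  show "\<forall>\<xi>. \<exists>\<alpha>\<in>{\<gamma><..}. \<xi> < \<alpha>"
  proof
    fix \<xi>
    have "max \<gamma> \<xi> < succ_omega1 (max \<gamma> \<xi>)" by (rule less_succ_omega1)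
    then show "\<exists>\<alpha>\<in>{\<gamma><..}. \<xi> < \<alpha>" by (intro bexI[of _ "succ_omega1 (max \<gamma> \<xi>)"]) simp_all
  qed
qed

lemma bundle_clubI:
  assumes "closedin (total_space (ladder_bundle \<sigma> \<theta>)) F"
    and "\<And>\<gamma>. \<exists>\<alpha>>\<gamma>. lifted_fibre F \<alpha> \<noteq> {}"
  shows "bundle_club (ladder_bundle \<sigma> \<theta>) F"
  unfolding bundle_club_def
proof
  show "\<not> bdd_above (proj (ladder_bundle \<sigma> \<theta>) ` F)"
  proof
    assume "bdd_above (proj (ladder_bundle \<sigma> \<theta>) ` F)"
    then obtain q where q: "\<And>x. x \<in> F \<Longrightarrow> fst x \<le> q"
      unfolding bdd_above_def by auto
    obtain \<alpha> where \<alpha>: "ray_base q < \<alpha>" "lifted_fibre F \<alpha> \<noteq> {}" using assms(2) by blast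
    then obtain x where "(ord_point \<alpha>, circle_of x) \<in> F" by (auto simp: lifted_fibre_def)
    then have "ord_point \<alpha> \<le> q" using q by fastforce
    moreover have "\<alpha> \<noteq> 0" using \<alpha>(1) zero_le_omega1[of "ray_base q"] by auto
    ultimately show False
      using \<alpha>(1) by (auto simp: ray_le_iff ord_point_simps)
  qed
qed (rule assms(1))

text \<open>
  Iterated \<open>k\<close> times, this keeps the points whose first \<open>k\<close> rotations by \<open>\<theta>\<close> stay in \<open>F\<close>.
\<close>

definition rotation_core :: "real \<Rightarrow> (long_ray \<times> circle) set \<Rightarrow> (long_ray \<times> circle) set" where
  "rotation_core \<theta> F = {x\<in>F. (fst x, snd x + circle_of \<theta>) \<in> F}"

lemma mem_rotation_core_iff: "x \<in> rotation_core \<theta> F \<longleftrightarrow> x \<in> F \<and> (fst x, snd x + circle_of \<theta>) \<in> F"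
  by (simp add: rotation_core_def)

lemma bundle_club_rotation_core:
  assumes "clubsuit_C_sequence \<sigma>" "\<And>\<alpha>. \<alpha> \<in> LimOrd2 \<Longrightarrow> range (\<sigma> \<alpha>) \<subseteq> LimOrd"
    and F: "bundle_club (ladder_bundle \<sigma> \<theta>) F"
  shows "bundle_club (ladder_bundle \<sigma> \<theta>) (rotation_core \<theta> F)"
proof (rule bundle_clubI)
  have lad: "ladder_system \<sigma>" using assms(1) by (simp add: clubsuit_C_sequence_def)
  let ?rot = "\<lambda>x :: long_ray \<times> circle. (fst x, snd x + circle_of \<theta>)"
  show "closedin (total_space (ladder_bundle \<sigma> \<theta>)) (rotation_core \<theta> F)"
    unfolding closedin_ladder_bundle[OF lad]
  proof
    fix \<alpha>
    let ?O = "strip \<alpha> - twist \<sigma> \<theta> \<alpha> -` F"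
    have O: "open ?O"
      using F closedin_ladder_bundle[OF lad] by (simp add: bundle_club_def)
    have "continuous_on UNIV ?rot" by (intro continuous_intros)
    with O have "open (?rot -` ?O)" by (rule open_vimage)
    then have "open (strip \<alpha> \<inter> (?O \<union> ?rot -` ?O))"
      using O open_strip by (intro open_Int open_Un)
    moreover have "twist \<sigma> \<theta> \<alpha> (?rot x) = ?rot (twist \<sigma> \<theta> \<alpha> x)" "?rot x \<in> strip \<alpha> \<longleftrightarrow> x \<in> strip \<alpha>" for x
      by (simp_all add: twist_def case_prod_beta add.assoc mem_strip_iff)
    then have "strip \<alpha> - twist \<sigma> \<theta> \<alpha> -` rotation_core \<theta> F = strip \<alpha> \<inter> (?O \<union> ?rot -` ?O)"
      unfolding rotation_core_def set_eq_iff Diff_iff Int_iff Un_iff vimage_eq mem_Collect_eq by metis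
    ultimately show "open (strip \<alpha> - twist \<sigma> \<theta> \<alpha> -` rotation_core \<theta> F)" by simp
  qed
  fix \<gamma>
  obtain \<alpha> x where "\<gamma> < \<alpha>" "x \<in> lifted_fibre F \<alpha>" "x + \<theta> \<in> lifted_fibre F \<alpha>"
    using rotated_pair_over_club[OF assms club_greaterThan[of \<gamma>]] by auto
  then have "x \<in> lifted_fibre (rotation_core \<theta> F) \<alpha>"
    by (simp add: lifted_fibre_def rotation_core_def circle_of_add)
  then show "\<exists>\<alpha>>\<gamma>. lifted_fibre (rotation_core \<theta> F) \<alpha> \<noteq> {}" using \<open>\<gamma> < \<alpha>\<close> by blast
qed

lemma rotation_core_iterate:
  assumes "x \<in> (rotation_core \<theta> ^^ k) F" "j \<le> k"
  shows "(fst x, snd x + circle_of (real j * \<theta>)) \<in> F"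
  using assms
proof (induction k arbitrary: x j)
  case 0
  then show ?case by (simp add: circle_of_zero)
next
  case (Suc k)
  then have x: "x \<in> (rotation_core \<theta> ^^ k) F" "(fst x, snd x + circle_of \<theta>) \<in> (rotation_core \<theta> ^^ k) F"
    by (simp_all add: mem_rotation_core_iff)
  show ?case
  proof (cases "j \<le> k")
    case True
    then show ?thesis using Suc.IH[OF x(1)] by simp
  next
    case False
    then have j: "j = Suc k" using Suc.prems(2) by simp
    have "circle_of \<theta> + circle_of (real k * \<theta>) = circle_of (real j * \<theta>)"
      unfolding circle_of_add j by (simp add: algebra_simps)
    then show ?thesis
      using Suc.IH[OF x(2), of k] by (simp add: add.assoc)
  qed
qed

text \<open>
  The iterated cores are clubs, so the sets of ordinals over which they have points have common limits
  \<open>\<alpha>\<close>. Over such an \<open>\<alpha>\<close> the fibres of the cores are nested and compact up to period, and a common point has its whole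
  forward orbit in \<open>F\<close>.
\<close>

lemma rotation_orbit_in_club:
  assumes "clubsuit_C_sequence \<sigma>" "\<And>\<alpha>. \<alpha> \<in> LimOrd2 \<Longrightarrow> range (\<sigma> \<alpha>) \<subseteq> LimOrd"
    and F: "bundle_club (ladder_bundle \<sigma> \<theta>) F"
  shows "\<exists>\<alpha>\<in>LimOrd. \<gamma> < \<alpha> \<and> (\<exists>x. \<forall>j::nat. x + real j * \<theta> \<in> lifted_fibre F \<alpha>)"
proof -
  have lad: "ladder_system \<sigma>" using assms(1) by (simp add: clubsuit_C_sequence_def)
  define G where "G k = (rotation_core \<theta> ^^ k) F" for k
  have G: "bundle_club (ladder_bundle \<sigma> \<theta>) (G k)" for k
    by (induction k) (use F bundle_club_rotation_core[OF assms(1,2)] in \<open>simp_all add: G_def\<close>)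
  define N where "N k = {\<alpha>\<in>LimOrd. lifted_fibre (G k) \<alpha> \<noteq> {}}" for k
  have N: "club (N k)" for k
    unfolding N_def by (rule club_nonempty_fibres[OF lad G])
  then have "\<exists>\<beta>\<in>N k. \<xi> < \<beta>" for k \<xi>
    by (simp add: club_def not_bdd_above_omega1_iff)
  then obtain \<alpha> where \<alpha>: "\<alpha> \<in> LimOrd" "\<gamma> < \<alpha>" and "\<forall>k. \<forall>\<mu><\<alpha>. \<exists>\<beta>\<in>N k. \<mu> < \<beta> \<and> \<beta> < \<alpha>"
    using common_limit_of_unbounded[of N \<gamma>] by blast
  then have mem: "\<alpha> \<in> N k" for k
    using closed_omega1D[of "N k" \<alpha>] N[of k] by (simp add: club_def)
  have "\<alpha> \<noteq> 0" using LimOrd_pos[OF \<alpha>(1)] by auto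
  define K where "K k = lifted_fibre (G k) \<alpha> \<inter> {0..2 * pi}" for k
  have "\<Inter>(range K) \<noteq> {}"
  proof (rule compact_nest)
    fix k
    have "closed (lifted_fibre (G k) \<alpha>)"
      using G[of k] closed_lifted_fibre[OF lad _ \<open>\<alpha> \<noteq> 0\<close>, of \<theta> "G k"] by (simp add: bundle_club_def)
    then show "compact (K k)" unfolding K_def by (intro closed_Int_compact) simp_all
    obtain x where x: "x \<in> lifted_fibre (G k) \<alpha>" using mem[of k] by (auto simp: N_def)
    obtain l :: int where "x + 2 * pi * of_int l \<in> {0..2 * pi}" using ex_shift_into_period by blast
    then show "K k \<noteq> {}" using lifted_fibre_periodic[OF x, of l] by (auto simp: K_def)
  next
    fix m n :: nat assume "m \<le> n"
    have "G (Suc k) \<subseteq> G k" for k by (auto simp: G_def rotation_core_def)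
    then have "G n \<subseteq> G m" using \<open>m \<le> n\<close> by (rule lift_Suc_antimono_le)
    then show "K n \<subseteq> K m" by (auto simp: K_def lifted_fibre_def)
  qed
  then obtain x where x: "\<And>k. x \<in> lifted_fibre (G k) \<alpha>" by (auto simp: K_def)
  have "x + real j * \<theta> \<in> lifted_fibre F \<alpha>" for j
    using rotation_core_iterate[of "(ord_point \<alpha>, circle_of x)" j \<theta> F j] x[of j]
    by (simp add: lifted_fibre_def G_def circle_of_add)
  then show ?thesis using \<alpha> by blast
qed

text \<open>
  Kronecker's approximation theorem for the irrational number \<open>1 / (2 * pi)\<close>.
\<close>

lemma unit_rotation_orbit_dense:
  assumes "closed A" "\<And>x k::int. x \<in> A \<Longrightarrow> x + 2 * pi * of_int k \<in> A"
    and "\<And>j::nat. x + real j \<in> A"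
  shows "A = UNIV"
proof -
  have "1 / (2 * pi) \<notin> \<rat>"
  proof
    assume "1 / (2 * pi) \<in> \<rat>"
    then have "1 / (2 * (1 / (2 * pi))) \<in> \<rat>"
      by (rule Rats_divide[OF Rats_1 Rats_mult[OF Rats_number_of]])
    then show False using pi_irrational by simp
  qed
  have "t \<in> A" for t
  proof -
    have "\<exists>y\<in>A. dist y t < e" if e: "0 < e" for e
    proof -
      let ?a = "(t - x) / (2 * pi)"
      have "0 < e / (2 * pi)" using e by simp
      then obtain h k :: int where k: "k > 0" "\<bar>of_int k * (1 / (2 * pi)) - of_int h - ?a\<bar> < e / (2 * pi)"
        by (rule sequence_of_fractional_parts_is_dense[OF \<open>1 / (2 * pi) \<notin> \<rat>\<close>])
      let ?y = "x + real (nat k) + 2 * pi * of_int (- h)"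
      have "?y - t = 2 * pi * (of_int k * (1 / (2 * pi)) - of_int h - ?a)"
        using k(1) by (simp add: field_simps)
      then have "\<bar>?y - t\<bar> = 2 * pi * \<bar>of_int k * (1 / (2 * pi)) - of_int h - ?a\<bar>"
        by (simp only: abs_mult) simp
      also have "\<dots> < 2 * pi * (e / (2 * pi))"
        using k(2) by (intro mult_strict_left_mono) simp_all
      finally have "dist ?y t < e" by (simp add: dist_real_def)
      moreover have "?y \<in> A" using assms(2,3) by blast
      ultimately show ?thesis by blast
    qed
    then show ?thesis
      using closure_approachable[of t A] assms(1) by simp
  qed
  then show ?thesis by blast
qed

text \<open>
  The set of ordinals over which \<open>F\<close> contains the whole fibre is closed by upper semicontinuity and unbounded as
  unboundedly many fibres contain a dense orbit.
\<close>

lemma infinite_order_unit_angle: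
  assumes "clubsuit_C_sequence \<sigma>" "\<And>\<alpha>. \<alpha> \<in> LimOrd2 \<Longrightarrow> range (\<sigma> \<alpha>) \<subseteq> LimOrd"
  shows "has_infinite_order (ladder_bundle \<sigma> 1)"
  unfolding has_infinite_order_def
proof (intro conjI allI impI)
  have lad: "ladder_system \<sigma>" using assms(1) by (simp add: clubsuit_C_sequence_def)
  show "principal_circle_bundle (ladder_bundle \<sigma> 1)" using lad by (rule principal_ladder_bundle)
  fix F assume F: "bundle_club (ladder_bundle \<sigma> 1) F"
  then have cl: "closedin (total_space (ladder_bundle \<sigma> 1)) F" by (simp add: bundle_club_def)
  define C where "C = {\<alpha>\<in>LimOrd. lifted_fibre F \<alpha> = UNIV}"
  have "closed C"
  proof (rule closed_omega1I)
    fix \<alpha> assume \<alpha>: "\<alpha> \<in> LimOrd" and ex: "\<And>\<mu>. \<mu> < \<alpha> \<Longrightarrow> \<exists>\<beta>\<in>C. \<mu> < \<beta> \<and> \<beta> < \<alpha>"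
    have "\<alpha> \<noteq> 0" using LimOrd_pos[OF \<alpha>] by auto
    have "t \<in> lifted_fibre F \<alpha>" for t
    proof -
      have "\<exists>y\<in>lifted_fibre F \<alpha>. dist y t < e" if e: "0 < e" for e
      proof -
        obtain \<mu> where "\<mu> < \<alpha>" and \<mu>: "\<And>\<beta> x. \<mu> < \<beta> \<Longrightarrow> \<beta> \<le> \<alpha> \<Longrightarrow> x \<in> lifted_fibre F \<beta> \<Longrightarrow>
            \<exists>y\<in>lifted_fibre F \<alpha>. \<bar>x - 1 * real (zfun \<sigma> \<alpha> \<beta>) - y\<bar> < e"
          using lifted_fibre_usc[OF lad cl \<open>\<alpha> \<noteq> 0\<close> e] by blast
        obtain \<beta> where \<beta>: "\<beta> \<in> C" "\<mu> < \<beta>" "\<beta> < \<alpha>" using ex[OF \<open>\<mu> < \<alpha>\<close>] by blast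
        then have "t + real (zfun \<sigma> \<alpha> \<beta>) \<in> lifted_fibre F \<beta>" by (simp add: C_def)
        then show ?thesis
          using \<mu>[OF \<beta>(2) less_imp_le[OF \<beta>(3)]] by (fastforce simp: dist_real_def abs_minus_commute)
      qed
      then show ?thesis
        using closure_approachable[of t "lifted_fibre F \<alpha>"] closed_lifted_fibre[OF lad cl \<open>\<alpha> \<noteq> 0\<close>] by simp
    qed
    then show "\<alpha> \<in> C" using \<alpha> by (auto simp: C_def)
  qed
  moreover have "\<exists>\<alpha>\<in>C. \<gamma> < \<alpha>" for \<gamma>
  proof -
    obtain \<alpha> x where \<alpha>: "\<alpha> \<in> LimOrd" "\<gamma> < \<alpha>" "\<And>j::nat. x + real j * 1 \<in> lifted_fibre F \<alpha>"
      using rotation_orbit_in_club[OF assms F] by blast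
    have "\<alpha> \<noteq> 0" using LimOrd_pos[OF \<alpha>(1)] by auto
    then have "lifted_fibre F \<alpha> = UNIV"
      using \<alpha>(3) closed_lifted_fibre[OF lad cl] lifted_fibre_periodic
      by (intro unit_rotation_orbit_dense[of _ x]) auto
    then show ?thesis using \<alpha> by (auto simp: C_def)
  qed
  ultimately have "club C" by (simp add: club_def not_bdd_above_omega1_iff)
  moreover have "0 \<notin> C" using LimOrd_pos by (auto simp: C_def)
  moreover have "over (ladder_bundle \<sigma> 1) (ord_point ` C) \<subseteq> F"
  proof
    fix x assume "x \<in> over (ladder_bundle \<sigma> 1) (ord_point ` C)"
    then obtain \<alpha> \<phi> where "\<alpha> \<in> C" "x = (ord_point \<alpha>, \<phi>)"
      unfolding over_ladder_bundle[OF lad] by blast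
    moreover obtain t where "\<phi> = circle_of t" by (rule circle_of_cases)
    ultimately show "x \<in> F" by (auto simp: C_def lifted_fibre_def)
  qed
  ultimately show "\<exists>C. club C \<and> 0 \<notin> C \<and> over (ladder_bundle \<sigma> 1) (ord_point ` C) \<subseteq> F" by blast
qed

text \<open>
  The cyclic subgroup of order \<open>n\<close>.
\<close>

definition root_angles :: "nat \<Rightarrow> circle set" where
  "root_angles n = {circle_of (2 * pi * of_int k / real n) | k :: int. True}"

lemma circle_of_in_root_angles_iff:
  assumes "1 \<le> n"
  shows "circle_of x \<in> root_angles n \<longleftrightarrow> real n * x / (2 * pi) \<in> \<int>"
proof
  assume "circle_of x \<in> root_angles n"
  then obtain k l :: int where "x - 2 * pi * of_int k / real n = 2 * pi * of_int l"
    by (auto simp: root_angles_def circle_of_eq_iff)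
  then have "x = 2 * pi * of_int k / real n + 2 * pi * of_int l" by simp
  then have "real n * x / (2 * pi) = of_int (k + int n * l)"
    using assms by (simp add: field_simps)
  then show "real n * x / (2 * pi) \<in> \<int>" by (metis Ints_of_int)
next
  assume "real n * x / (2 * pi) \<in> \<int>"
  then obtain k where "real n * x / (2 * pi) = of_int k" by (rule Ints_cases)
  then have "x = 2 * pi * of_int k / real n" using assms by (simp add: field_simps)
  then show "circle_of x \<in> root_angles n" by (auto simp: root_angles_def)
qed

lemma root_angles_eq_image:
  assumes "1 \<le> n"
  shows "root_angles n = (\<lambda>k. circle_of (2 * pi * real k / real n)) ` {..<n}"
proof (intro equalityI subsetI)
  fix \<phi> assume "\<phi> \<in> root_angles n"
  then obtain k :: int where \<phi>: "\<phi> = circle_of (2 * pi * of_int k / real n)" by (auto simp: root_angles_def)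
  define r where "r = nat (k mod int n)"
  have r: "r < n" "int r = k mod int n" using assms by (simp_all add: r_def nat_less_iff)
  have "k = int r + int n * (k div int n)" unfolding r(2) by simp
  then have "real_of_int k = real r + real n * real_of_int (k div int n)"
    by (metis of_int_add of_int_mult of_int_of_nat_eq)
  then have "2 * pi * of_int k / real n - 2 * pi * real r / real n = 2 * pi * of_int (k div int n)"
    using assms by (simp add: field_simps)
  then have "\<phi> = circle_of (2 * pi * real r / real n)"
    unfolding \<phi> circle_of_eq_iff by blast
  then show "\<phi> \<in> (\<lambda>k. circle_of (2 * pi * real k / real n)) ` {..<n}" using r(1) by blast
next
  fix \<phi> assume "\<phi> \<in> (\<lambda>k. circle_of (2 * pi * real k / real n)) ` {..<n}"
  then obtain k where "\<phi> = circle_of (2 * pi * of_int (int k) / real n)" by auto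
  then show "\<phi> \<in> root_angles n" unfolding root_angles_def by blast
qed

lemma card_root_angles:
  assumes "1 \<le> n"
  shows "card (root_angles n) = n"
proof -
  have "inj_on (\<lambda>k. circle_of (2 * pi * real k / real n)) {..<n}"
  proof (rule inj_onI)
    fix j k assume jk: "j \<in> {..<n}" "k \<in> {..<n}"
      and "circle_of (2 * pi * real j / real n) = circle_of (2 * pi * real k / real n)"
    then obtain l :: int where "2 * pi * real j / real n - 2 * pi * real k / real n = 2 * pi * of_int l"
      unfolding circle_of_eq_iff by blast
    then have "2 * pi * (real j - real k) = 2 * pi * (real n * of_int l)"
      using assms by (simp add: field_simps)
    then have "real j - real k = real n * of_int l" by simp
    then have "of_int (int j - int k) = real_of_int (int n * l)" by simp
    then have "int j - int k = int n * l" by (simp only: of_int_eq_iff)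
    moreover have "\<bar>int j - int k\<bar> < int n" using jk by auto
    ultimately have "l = 0" using assms by (auto simp: abs_mult)
    then show "j = k" using \<open>int j - int k = int n * l\<close> by simp
  qed
  then show ?thesis
    unfolding root_angles_eq_image[OF assms] by (simp add: card_image)
qed

lemma root_angles_add:
  assumes "\<phi> \<in> root_angles n"
  shows "\<phi> + \<psi> \<in> root_angles n \<longleftrightarrow> \<psi> \<in> root_angles n"
proof -
  obtain k :: int where k: "\<phi> = circle_of (2 * pi * of_int k / real n)"
    using assms by (auto simp: root_angles_def)
  have add: "\<exists>m::int. circle_of (2 * pi * of_int i / real n) + circle_of (2 * pi * of_int j / real n) =
      circle_of (2 * pi * of_int m / real n)" for i j :: int
    unfolding circle_of_add by (intro exI[of _ "i + j"]) (simp add: algebra_simps add_divide_distrib)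
  show ?thesis
  proof
    assume "\<phi> + \<psi> \<in> root_angles n"
    then obtain l :: int where l: "\<phi> + \<psi> = circle_of (2 * pi * of_int l / real n)"
      by (auto simp: root_angles_def)
    have "\<psi> = - \<phi> + (\<phi> + \<psi>)" by simp
    also have "\<dots> = circle_of (2 * pi * of_int (- k) / real n) + circle_of (2 * pi * of_int l / real n)"
      unfolding l unfolding k by (simp add: circle_of_uminus)
    finally show "\<psi> \<in> root_angles n" using add unfolding root_angles_def by (simp only: mem_Collect_eq) blast
  next
    assume "\<psi> \<in> root_angles n"
    then show "\<phi> + \<psi> \<in> root_angles n" using add k unfolding root_angles_def by auto
  qed
qed

lemma closed_root_angles:
  assumes "1 \<le> n"
  shows "closed (root_angles n)"
proof -
  have "closed ((\<lambda>x. real n * x / (2 * pi)) -` \<int>)"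
    by (intro closed_vimage closed_Ints continuous_intros) simp
  moreover have "(\<lambda>x. real n * x / (2 * pi)) -` \<int> = circle_of -` root_angles n"
    by (simp only: set_eq_iff vimage_eq circle_of_in_root_angles_iff[OF assms]) simp
  ultimately have "open (circle_of -` (- root_angles n))"
    unfolding vimage_Compl by (simp add: open_Compl)
  then show ?thesis
    by (simp add: closed_def open_circle_def)
qed

lemma closed_ord_points: "closed (ord_point ` {0<..})"
proof -
  have eq: "ord_point ` {0<..} = {p. ray_frac p = 0}"
  proof (intro equalityI subsetI)
    fix p assume "p \<in> {p. ray_frac p = 0}"
    then have p: "ray_frac p = 0" "ray_base p \<noteq> 0" using ray_frac_bounds(3)[of p] by auto
    then have "p = ord_point (ray_base p)" by (intro ray_eqI) (simp_all add: ord_point_simps)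
    moreover have "0 < ray_base p" using p(2) zero_le_omega1[of "ray_base p"] by simp
    ultimately show "p \<in> ord_point ` {0<..}" by blast
  qed (auto simp: ord_point_simps)
  show ?thesis
    unfolding closed_def
  proof (subst open_subopen, intro ballI)
    fix p assume "p \<in> - ord_point ` {0<..}"
    then have p: "0 < ray_frac p" using ray_frac_bounds(1)[of p] unfolding eq by simp
    let ?q = "ray_point (ray_base p) (ray_frac p / 2)"
    have q: "ray_base ?q = ray_base p" "ray_frac ?q = ray_frac p / 2"
      using p ray_frac_bounds(2)[of p] by (simp_all add: ray_point_simps)
    let ?T = "{?q<..<ord_point (succ_omega1 (ray_base p))}"
    have "open ?T" by simp
    moreover have "?q < p"
      unfolding ray_less_iff q using p by simp
    then have "p \<in> ?T" by (simp add: less_ord_point_succ_iff)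
    moreover have "ray_frac r \<noteq> 0" if "r \<in> ?T" for r
    proof -
      have "ray_base r \<le> ray_base p" "?q < r"
        using that by (simp_all add: less_ord_point_succ_iff)
      then have "ray_frac p / 2 < ray_frac r"
        unfolding ray_less_iff q by auto
      then show ?thesis using p by simp
    qed
    then have "?T \<subseteq> - ord_point ` {0<..}"
      unfolding eq by blast
    ultimately show "\<exists>T. open T \<and> p \<in> T \<and> T \<subseteq> - ord_point ` {0<..}" by blast
  qed
qed

text \<open>
  Over ordinals all twists are by multiples of \<open>2 * pi / n\<close>, so this set looks the same in
  every strip.
\<close>

lemma closedin_root_section:
  assumes "ladder_system \<sigma>" "1 \<le> n"
  shows "closedin (total_space (ladder_bundle \<sigma> (2 * pi / real n))) (ord_point ` {0<..} \<times> root_angles n)"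
    (is "closedin _ ?E")
  unfolding closedin_ladder_bundle[OF assms(1)]
proof
  fix \<alpha>
  let ?tw = "twist \<sigma> (2 * pi / real n) \<alpha>"
  have "?tw x \<in> ?E \<longleftrightarrow> x \<in> ?E" for x
  proof (cases "fst x \<in> ord_point ` {0<..}")
    case True
    then obtain \<beta> where \<beta>: "0 < \<beta>" "fst x = ord_point \<beta>" by auto
    have "circle_of (2 * pi / real n * real (zfun \<sigma> \<alpha> \<beta>)) =
        circle_of (2 * pi * of_int (int (zfun \<sigma> \<alpha> \<beta>)) / real n)"
      by simp
    then have "circle_of (2 * pi / real n * real (zfun \<sigma> \<alpha> \<beta>)) \<in> root_angles n"
      unfolding root_angles_def by blast
    then have "arc_angle \<sigma> (2 * pi / real n) \<alpha> (fst x) \<in> root_angles n"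
      using \<beta> by (simp add: arc_angle_ord_point)
    from root_angles_add[OF this, of "snd x"] show ?thesis
      using True by (simp add: twist_def case_prod_beta mem_Times_iff)
  next
    case False
    then show ?thesis by (simp add: mem_Times_iff)
  qed
  then have "strip \<alpha> - ?tw -` ?E = strip \<alpha> - ?E"
    by (simp only: set_eq_iff Diff_iff vimage_eq) simp
  moreover have "open (strip \<alpha> - ?E)"
    by (intro open_Diff open_strip closed_Times closed_ord_points closed_root_angles assms(2))
  ultimately show "open (strip \<alpha> - ?tw -` ?E)" by simp
qed

text \<open>
  The order is not smaller than \<open>n\<close>: a cyclic club of order \<open>m\<close> contains two points of one fibre that differ by
  \<open>2 * pi / n\<close>, so this angle is a multiple of \<open>2 * pi / m\<close> up to full turns, and \<open>n\<close> divides \<open>m\<close>.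
\<close>

lemma finite_order_rational_angle:
  assumes "clubsuit_C_sequence \<sigma>" "\<And>\<alpha>. \<alpha> \<in> LimOrd2 \<Longrightarrow> range (\<sigma> \<alpha>) \<subseteq> LimOrd" "1 \<le> n"
  shows "has_finite_order (ladder_bundle \<sigma> (2 * pi / real n)) n"
  unfolding has_finite_order_def
proof (intro conjI allI impI)
  have lad: "ladder_system \<sigma>" using assms(1) by (simp add: clubsuit_C_sequence_def)
  let ?M = "ladder_bundle \<sigma> (2 * pi / real n)"
  let ?E = "ord_point ` {0<..} \<times> root_angles n"
  have E: "bundle_club ?M ?E"
  proof (rule bundle_clubI[OF closedin_root_section[OF lad assms(3)]])
    fix \<gamma>
    have "circle_of 0 \<in> root_angles n"
      using circle_of_in_root_angles_iff[OF assms(3), of 0] by simp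
    moreover have "0 < succ_omega1 \<gamma>"
      using zero_le_omega1[of "succ_omega1 \<gamma>"] by (simp add: order.order_iff_strict)
    ultimately have "0 \<in> lifted_fibre ?E (succ_omega1 \<gamma>)"
      by (simp add: lifted_fibre_def)
    then show "\<exists>\<alpha>>\<gamma>. lifted_fibre ?E \<alpha> \<noteq> {}" using less_succ_omega1 by blast
  qed
  show "principal_circle_bundle ?M" using lad by (rule principal_ladder_bundle)
  show "\<not> has_infinite_order ?M"
  proof
    assume "has_infinite_order ?M"
    then obtain C where C: "club C" "0 \<notin> C" "over ?M (ord_point ` C) \<subseteq> ?E"
      using E unfolding has_infinite_order_def by blast
    obtain \<alpha> where "\<alpha> \<in> C" using C(1) by (auto simp: club_def not_bdd_above_omega1_iff)
    then have "(ord_point \<alpha>, circle_of (pi / real n)) \<in> ?E"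
      using C(3) unfolding over_ladder_bundle[OF lad] by blast
    then have "real n * (pi / real n) / (2 * pi) \<in> \<int>"
      using circle_of_in_root_angles_iff[OF assms(3)] by simp
    \<comment> \<open>The angle \<open>pi / n\<close> is half a step between two points of the section.\<close>
    then have "(1 / 2 :: real) \<in> \<int>" using assms(3) by simp
    then show False by (auto elim!: Ints_cases)
  qed
  show "has_cyclic_club ?M n"
    unfolding has_cyclic_club_def
  proof (intro exI[of _ ?E] exI[of _ "{0<..}"] conjI ballI)
    show "bundle_club ?M ?E" "club {0 :: omega1<..}" by (rule E, rule club_greaterThan)
    fix \<alpha> :: omega1 assume "\<alpha> \<in> {0<..}"
    then have fib: "?E \<inter> over ?M {ord_point \<alpha>} = {ord_point \<alpha>} \<times> root_angles n"
      unfolding over_ladder_bundle[OF lad] by auto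
    show "card (?E \<inter> over ?M {ord_point \<alpha>}) = n"
      unfolding fib by (simp add: card_cartesian_product card_root_angles[OF assms(3)])
    fix x assume "x \<in> ?E \<inter> over ?M {ord_point \<alpha>}"
    then have x: "fst x = ord_point \<alpha>" "snd x \<in> root_angles n" unfolding fib by auto
    have "{act ?M x (circle_of (2 * pi * real k / real n)) | k. k < n} = {ord_point \<alpha>} \<times> ((+) (snd x) ` root_angles n)"
      unfolding root_angles_eq_image[OF assms(3)] act_ladder_bundle x(1) by auto
    also have "(+) (snd x) ` root_angles n = root_angles n"
    proof (intro equalityI subsetI)
      fix \<psi> assume "\<psi> \<in> root_angles n"
      then have "\<psi> - snd x \<in> root_angles n"
        using root_angles_add[OF x(2), of "\<psi> - snd x"] by simp
      then show "\<psi> \<in> (+) (snd x) ` root_angles n" by (intro image_eqI[of _ _ "\<psi> - snd x"]) simp_all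
    qed (use root_angles_add[OF x(2)] in auto)
    finally show "?E \<inter> over ?M {ord_point \<alpha>} = {act ?M x (circle_of (2 * pi * real k / real n)) | k. k < n}"
      unfolding fib by simp
  qed simp
  fix m :: nat assume "1 \<le> m" "has_cyclic_club ?M m"
  then obtain E C where E: "bundle_club ?M E" and C: "club C"
    and cyc: "\<And>\<alpha> x. \<alpha> \<in> C \<Longrightarrow> x \<in> E \<inter> over ?M {ord_point \<alpha>} \<Longrightarrow>
      E \<inter> over ?M {ord_point \<alpha>} = {act ?M x (circle_of (2 * pi * real k / real m)) | k. k < m}"
    unfolding has_cyclic_club_def by blast
  obtain \<alpha> x where \<alpha>: "\<alpha> \<in> C" "x \<in> lifted_fibre E \<alpha>" "x + 2 * pi / real n \<in> lifted_fibre E \<alpha>"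
    using rotated_pair_over_club[OF assms(1,2) E C] by blast
  have mem: "(ord_point \<alpha>, circle_of y) \<in> E \<inter> over ?M {ord_point \<alpha>}" if "y \<in> lifted_fibre E \<alpha>" for y
    using that unfolding over_ladder_bundle[OF lad] lifted_fibre_def by simp
  obtain k where "circle_of (x + 2 * pi / real n) = circle_of x + circle_of (2 * pi * real k / real m)"
    using mem[OF \<alpha>(3)] unfolding cyc[OF \<alpha>(1) mem[OF \<alpha>(2)]] by auto
  then obtain l :: int where "x + 2 * pi / real n - (x + 2 * pi * real k / real m) = 2 * pi * of_int l"
    unfolding circle_of_add circle_of_eq_iff by blast
  then have "2 * pi * (real m) = 2 * pi * (real n * (real k + of_int l * real m))"
    using \<open>1 \<le> m\<close> assms(3) by (simp add: field_simps)
  then have "real m = real n * (real k + of_int l * real m)" by simp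
  then have "real_of_int (int m) = of_int (int n * (int k + l * int m))" by simp
  then have "int m = int n * (int k + l * int m)" by (simp only: of_int_eq_iff)
  then have "int n dvd int m" by (metis dvd_triv_left)
  then show "n \<le> m" using \<open>1 \<le> m\<close> by (auto dest: dvd_imp_le)
qed (rule assms(3))

theorem theorem5p3:
  fixes \<sigma> :: "omega1 \<Rightarrow> nat \<Rightarrow> omega1"
  assumes "clubsuit_C_sequence \<sigma>"
    and "\<And>\<alpha>. \<alpha> \<in> LimOrd2 \<Longrightarrow> range (\<sigma> \<alpha>) \<subseteq> LimOrd"
  shows "has_infinite_order (ladder_bundle \<sigma> 1) \<and>
    (\<forall>n\<ge>1. has_finite_order (ladder_bundle \<sigma> (2 * pi / real n)) n)"
  using infinite_order_unit_angle[OF assms] finite_order_rational_angle[OF assms] by blast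

end
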